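(* Let $k\ge 2$ be an integer, let $f(x)\in\mathbb{Z}[x]$ be an irreducible polynomial of degree $d\ge 1$, and let $(X,\mu,T)$ be a uniquely ergodic topological dynamical system. For $Y\ge 1$ and positive integers $N$ let $$E_f(Y,N)=\sum_{\substack{d>Y\\ d\text{ squarefree}}}\#\{1\le n\le N: d^k\mid f(n)\}.$$ Suppose there exist constants $\delta>0$, $\Delta>0$ and $C>0$ such that $E_f(N^{1-\delta},N)\le C N^{1-\Delta}$ for all positive integers $N$. Then for every $g\in C(X)$ and every $x\in X$, $$\lim_{N\to\infty}\frac1N\sum_{1\le n\le N}\nu_k(f(n))\,g(T^{\Omega(n)}x)=\prod_{p}\Big(1-\frac{\rho_f(p^k)}{p^k}\Big)\int_X g\,d\mu,$$ where the product runs over all primes $p$.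
   Context: A uniquely ergodic topological dynamical system $(X,\mu,T)$ consists of a compact metric space $X$, a continuous map $T\colon X\to X$, and $\mu$ the unique $T$-invariant Borel probability measure on $X$. $C(X)$ is the space of continuous complex-valued functions on $X$. For $n\in\mathbb{N}$, $\Omega(n)$ is the number of prime factors of $n$ counted with multiplicity. For an integer $m$, $\nu_k(m)=1$ if there is no prime $p$ with $p^k\mid m$, and $\nu_k(m)=0$ otherwise. For a positive integer $q$, $\rho_f(q)=\#\{\nu \bmod q : f(\nu)\equiv 0 \pmod q\}$. *)

theory Defs
  imports
    "HOL-Probability.Probability"
    "HOL-Computational_Algebra.Computational_Algebra"
begin

text \<open>
  The space is a compact subset \<open>X\<close> of a metric space type, so that it need not exhaust a type.
  Borel measures on \<open>X\<close> are measures on the trace of the Borel sigma-algebra on \<open>X\<close>.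
\<close>

definition invariant_borel_prob :: "'a::metric_space set \<Rightarrow> ('a \<Rightarrow> 'a) \<Rightarrow> 'a measure \<Rightarrow> bool" where
  "invariant_borel_prob X T \<mu> \<longleftrightarrow>
     prob_space \<mu> \<and> sets \<mu> = sets (restrict_space borel X) \<and>
     (\<forall>A\<in>sets \<mu>. emeasure \<mu> (T -` A \<inter> X) = emeasure \<mu> A)"

definition uniquely_ergodic_system :: "'a::metric_space set \<Rightarrow> 'a measure \<Rightarrow> ('a \<Rightarrow> 'a) \<Rightarrow> bool" where
  "uniquely_ergodic_system X \<mu> T \<longleftrightarrow>
     compact X \<and> continuous_on X T \<and> T ` X \<subseteq> X \<and>
     invariant_borel_prob X T \<mu> \<and>
     (\<forall>\<mu>'. invariant_borel_prob X T \<mu>' \<longrightarrow> \<mu>' = \<mu>)"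

definition big_omega :: "nat \<Rightarrow> nat" where
  "big_omega n = size (prime_factorization n)"

definition kfree_indicator :: "nat \<Rightarrow> int \<Rightarrow> nat" where
  "kfree_indicator k m = (if \<exists>p::int. prime p \<and> p ^ k dvd m then 0 else 1)"

definition root_count :: "int poly \<Rightarrow> nat \<Rightarrow> nat" where
  "root_count f q = card {v \<in> {0..<int q}. int q dvd poly f v}"

text \<open>
  The sum is taken in the extended nonnegative reals: if \<open>f\<close> has a root in \<open>{1..N}\<close>, every \<open>d\<close>
  contributes and the sum is infinite, whereas a real-valued sum would silently be \<open>0\<close>.
\<close>

definition divisor_excess :: "nat \<Rightarrow> int poly \<Rightarrow> real \<Rightarrow> nat \<Rightarrow> ennreal" where
  "divisor_excess k f Y N =
     (\<Sum>\<^sub>\<infinity> d \<in> {d::nat. real d > Y \<and> squarefree d}.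
        of_nat (card {n \<in> {1..N}. int d ^ k dvd poly f (int n)}))"

end

theory Submission
  imports
    Defs
    "HOL-Number_Theory.Number_Theory"
    "HOL-Real_Asymp.Real_Asymp"
begin

text \<open>
  The core is a proof, in the style of Bergelson and Richter, that averages of \<open>\<phi> n * a (\<Omega> n)\<close> with
  \<open>\<phi>\<close> periodic and \<open>a\<close> bounded do not change asymptotically if \<open>\<Omega> n\<close> is replaced by \<open>\<Omega> n + 1\<close>.
  By the Turan-Kubilius inequality, such an average up to \<open>x\<close> is close to a weighted mean, over any
  finite set of primes \<open>p\<close> with large reciprocal sum, of the averages of \<open>\<phi> (p * n) * a (\<Omega> n + 1)\<close> up to
  \<open>x / p\<close>. Comparing two families of primes whose members differ by a nearly constant ratio \<open>exp \<sigma>\<close>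
  shows that the average up to \<open>x\<close> and the one up to \<open>x * exp (-\<sigma>)\<close> nearly agree. Mertens' estimate
  and Selberg's upper bound for primes in short intervals provide such families for arbitrarily
  small \<open>\<sigma>\<close>, so the averages do not depend on the scale, and \<open>x / p\<close> may be replaced by \<open>x\<close>. The factor \<open>p\<close>
  inside \<open>\<phi>\<close> is removed by composing such steps; the only obstruction would be a character modulo the
  period that takes one value different from \<open>1\<close> on almost all primes, and this is excluded by the
  nonvanishing of \<open>L(1, \<chi>)\<close> for real characters.

  Shift invariance means that every limit of the weighted empirical measures along an orbit is
  invariant under \<open>T\<close>, hence equal to \<open>\<mu>\<close>. This gives the theorem with the indicator of \<open>k\<close>-freeness replaced by
  its periodic truncation to primes \<open>p \<le> z\<close>, whose mean is the partial product. The truncation error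
  is controlled by \<open>\<rho>\<^sub>f(p\<^sup>k) \<le> degree f\<close> for the primes up to \<open>N powr (1 - \<delta>)\<close> and by the hypothesis for larger
  primes.
\<close>

section \<open>Chebyshev and Mertens estimates\<close>

text \<open>The ratio \<open>exp \<sigma>\<close> of the two prime families cannot be prescribed:
  pigeonholing only yields some \<open>\<sigma>\<close> between \<open>d / R\<close> and
  \<open>d\<close>. The iteration works because \<open>R = 800 * Q\<close> does not depend on the
  accuracy \<open>eta\<close>. The number of steps that lead from \<open>x\<close> down to
  \<open>x * exp (-W)\<close> is therefore bounded before \<open>eta\<close> is chosen, and
  \<open>eta\<close> can be taken small compared with it. The lower bound \<open>d / R\<close> is
  the contribution of the sieve; Mertens' estimate has a bounded error and by itself would allow the
  mass of a window to sit in one short cluster. The masses of two matched cells are equalised by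
  weights on the primes, which is why the Turan-Kubilius inequality is stated with weights. Residue
  classes whose primes have a convergent reciprocal sum are put into an exceptional set
  \<open>E\<close>, so the argument about characters has to tolerate such a set. Limits of empirical
  measures are taken on all subsets of the space at once; they are only finitely additive and exist
  along a filter, so a countably additive invariant measure has to be rebuilt from them.\<close>

lemma sum_divisors_eq_sum_multiples:
  fixes F :: "nat \<Rightarrow> nat \<Rightarrow> 'a::comm_monoid_add"
  shows "(\<Sum>n=1..N. \<Sum>d | d dvd n. F d (n div d)) = (\<Sum>d=1..N. \<Sum>e=1..N div d. F d e)"
proof -
  have le: "b \<le> N" if "b * k \<le> N" "0 < k" for b k :: nat
  proof -
    have "b * 1 \<le> b * k" using that by (intro mult_le_mono2) auto
    thus ?thesis using that(1) by linarith
  qed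
  have "(\<Sum>n=1..N. \<Sum>d | d dvd n. F d (n div d))
      = (\<Sum>(n,d)\<in>Sigma {1..N} (\<lambda>n. {d. d dvd n}). F d (n div d))"
    by (rule sum.Sigma) auto
  also have "\<dots> = (\<Sum>(d,e)\<in>Sigma {1..N} (\<lambda>d. {1..N div d}). F d e)"
    by (rule sum.reindex_bij_witness[where i = "\<lambda>(d,e). (d*e, d)" and j = "\<lambda>(n,d). (d, n div d)"])
       (auto simp: div_le_mono Suc_le_eq dvd_div_eq_0_iff less_eq_div_iff_mult_less_eq mult.commute
             dest: dvd_imp_le intro: dvd_pos_nat elim!: dvdE intro: le)
  also have "\<dots> = (\<Sum>d=1..N. \<Sum>e=1..N div d. F d e)"
    by (rule sum.Sigma[symmetric]) auto
  finally show ?thesis .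
qed

lemma real_div_le_nat_div: "real N / real n \<le> real (N div n) + 1"
proof -
  have "real N / real n \<le> of_int \<lfloor>real N / real n\<rfloor> + 1" by linarith
  thus ?thesis by (simp add: floor_divide_of_nat_eq)
qed

lemma nat_div_le_real_div: "real (N div n) \<le> real N / real n"
proof -
  have "of_int \<lfloor>real N / real n\<rfloor> \<le> real N / real n" by linarith
  thus ?thesis by (simp add: floor_divide_of_nat_eq)
qed

text \<open>Legendre's factorisation of \<open>N!\<close>, obtained by expanding \<open>ln n\<close>
  into \<open>mangoldt\<close> over divisors. Both Chebyshev's and Mertens' estimates start
  here.\<close>

lemma ln_fact_eq_sum_mangoldt: "ln (fact N) = (\<Sum>d=1..N. mangoldt d * real (N div d))"
proof -
  have "ln (fact N :: real) = (\<Sum>n=1..N. ln (real n))"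
    by (subst fact_prod, subst of_nat_prod, subst ln_prod) auto
  also have "\<dots> = (\<Sum>n=1..N. \<Sum>d | d dvd n. mangoldt d)"
    by (intro sum.cong refl, subst mangoldt_sum) auto
  also have "\<dots> = (\<Sum>d=1..N. \<Sum>e=1..N div d. mangoldt d)"
    by (rule sum_divisors_eq_sum_multiples)
  finally show ?thesis by (simp add: mult.commute)
qed

definition chebyshev_psi :: "nat \<Rightarrow> real" where "chebyshev_psi N = (\<Sum>n=1..N. mangoldt n)"

lemma chebyshev_psi_mono: "M \<le> N \<Longrightarrow> chebyshev_psi M \<le> chebyshev_psi N"
  unfolding chebyshev_psi_def by (intro sum_mono2) (auto simp: mangoldt_nonneg)

text \<open>Comparison with the central binomial coefficient \<open>2*m choose m\<close>, whose
  logarithm is the \<open>mangoldt\<close> sum with coefficients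
  \<open>2*m div d - 2 * (m div d)\<close>. These are nonnegative, and at least \<open>1\<close> for
  \<open>m < d \<le> 2*m\<close>.\<close>

lemma chebyshev_psi_double: "chebyshev_psi (2*m) - chebyshev_psi m \<le> 2 * real m * ln 2"
proof -
  have "chebyshev_psi (2*m) - chebyshev_psi m = (\<Sum>d\<in>{m+1..2*m}. mangoldt d)"
    unfolding chebyshev_psi_def
    by (subst sum_diff[symmetric]) (auto intro!: sum.cong)
  also have "\<dots> \<le> (\<Sum>d\<in>{m+1..2*m}. mangoldt d * (real (2*m div d) - 2 * real (m div d)))"
  proof (intro sum_mono)
    fix d assume d: "d \<in> {m+1..2*m}"
    have "2*m div d \<ge> 1" "m div d = 0"
      using d by (simp_all add: less_eq_div_iff_mult_less_eq)
    hence "real (2*m div d) - 2 * real (m div d) \<ge> 1" by simp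
    thus "mangoldt d \<le> mangoldt d * (real (2*m div d) - 2 * real (m div d))"
      using mult_left_mono[OF _ mangoldt_nonneg[of d]] by fastforce
  qed
  also have "\<dots> \<le> (\<Sum>d\<in>{1..2*m}. mangoldt d * (real (2*m div d) - 2 * real (m div d)))"
  proof (intro sum_mono2)
    fix d assume "d \<in> {1..2*m} - {m+1..2*m}"
    have "2 * (m div d) \<le> 2*m div d"
      by (metis div_le_mono div_mult2_eq div_mult_self1_is_m div_times_less_eq_dividend dual_order.refl
         less_eq_div_iff_mult_less_eq mult.assoc mult.commute neq0_conv div_by_0 mult_0_right)
    hence "real (2*m div d) - 2 * real (m div d) \<ge> 0"
      using of_nat_mono[where 'a=real] by fastforce
    thus "0 \<le> mangoldt d * (real (2*m div d) - 2 * real (m div d))"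
      by (simp add: mangoldt_nonneg)
  qed auto
  also have "\<dots> = ln (fact (2*m)) - 2 * (\<Sum>d\<in>{1..2*m}. mangoldt d * real (m div d))"
    by (simp add: ln_fact_eq_sum_mangoldt right_diff_distrib sum_subtractf sum_distrib_left mult.left_commute)
  also have "(\<Sum>d\<in>{1..2*m}. mangoldt d * real (m div d)) = (\<Sum>d\<in>{1..m}. mangoldt d * real (m div d))"
    by (intro sum.mono_neutral_right) auto
  also have "\<dots> = ln (fact m)" by (simp add: ln_fact_eq_sum_mangoldt)
  also have "ln (fact (2*m)) - 2 * ln (fact m) = ln (fact (2*m) / (fact m * fact m) :: real)"
    by (simp add: ln_div ln_mult)
  also have "fact (2*m) / (fact m * fact m) = real (2*m choose m)"
    by (subst binomial_fact) auto
  also have "ln \<dots> \<le> ln (2 ^ (2*m))"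
  proof -
    have "(2*m choose m) \<le> 2 ^ (2*m)"
      by (rule binomial_le_pow2)
    hence "real (2*m choose m) \<le> 2 ^ (2*m)" by (metis of_nat_le_iff of_nat_numeral of_nat_power)
    thus ?thesis by (subst ln_le_cancel_iff) (auto simp: zero_less_binomial)
  qed
  also have "\<dots> = 2 * real m * ln 2" by (simp add: ln_realpow)
  finally show ?thesis .
qed

lemma chebyshev_psi_power2: "chebyshev_psi (2^k) \<le> 2 * 2^k"
proof (induction k)
  case 0
  then show ?case by (simp add: chebyshev_psi_def)
next
  case (Suc k)
  have "2 * real (2^k) * ln 2 \<le> 2 * real (2^k) * 1"
    using ln_2_less_1 by (intro mult_left_mono) auto
  moreover have "2 * real (2^k) = 2 * 2^k" by simp
  ultimately show ?case using Suc chebyshev_psi_double[of "2^k"] unfolding power_Suc by linarith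
qed

lemma chebyshev_psi_le: "chebyshev_psi N \<le> 4 * real N"
proof (cases "N = 0")
  case False
  \<comment> \<open>The least power of two above \<open>N\<close> overshoots by a factor of at most
    two, which turns the dyadic constant \<open>2\<close> into \<open>4\<close>.\<close>
  define k where "k = (LEAST k. N \<le> 2^k)"
  have ex: "N \<le> 2^N" by (simp add: less_imp_le)
  have k: "N \<le> 2^k" unfolding k_def by (rule LeastI[of _ N]) (rule ex)
  have "2^k \<le> 2 * N"
  proof (cases k)
    case (Suc j)
    have "\<not> N \<le> 2^j" using not_less_Least[of j "\<lambda>k. N \<le> 2^k"] Suc unfolding k_def by simp
    thus ?thesis using Suc by simp
  qed (use False in auto)
  hence "(2::real)^k \<le> 2 * real N" by (metis of_nat_le_iff of_nat_mult of_nat_numeral of_nat_power)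
  moreover have "chebyshev_psi N \<le> chebyshev_psi (2^k)" by (rule chebyshev_psi_mono[OF k])
  ultimately show ?thesis using chebyshev_psi_power2[of k] by linarith
qed (simp add: chebyshev_psi_def)

lemma ln_fact_ge: "real N * ln (real N) - real N \<le> ln (fact N)"
proof (induction N)
  case (Suc N)
  show ?case
  proof (cases "N = 0")
    case False
    have "ln (real (Suc N)) - ln (real N) = ln (1 + 1 / real N)"
      using False ln_div[of "real (Suc N)" "real N"] by (simp add: field_simps)
    also have "\<dots> \<le> 1 / real N" by (rule ln_add_one_self_le_self) simp
    finally have "real N * (ln (real (Suc N)) - ln (real N)) \<le> 1"
      using False by (simp add: field_simps)
    moreover have "ln (fact (Suc N)) = ln (real (Suc N)) + ln (fact N)"
      by (simp add: ln_mult del: of_nat_Suc)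
    ultimately show ?thesis using Suc by (simp add: algebra_simps)
  qed simp
qed simp

lemma ln_fact_le_mult_ln: "ln (fact N) \<le> real N * ln (real N)"
proof (cases "N = 0")
  case False
  have "ln (fact N) = (\<Sum>n=1..N. ln (real n))" by (subst fact_prod, subst of_nat_prod, subst ln_prod) auto
  also have "\<dots> \<le> (\<Sum>n=1..N. ln (real N))" by (intro sum_mono) auto
  finally show ?thesis by simp
qed simp

text \<open>In the identity for \<open>ln (fact N)\<close>, replacing \<open>N div n\<close> by
  \<open>N / n\<close> costs nothing in one direction and at most
  \<open>chebyshev_psi N \<le> 4 * N\<close> in the other. Dividing by \<open>N\<close> gives the
  claim.\<close>

lemma mertens_mangoldt:
  assumes "N \<ge> 1"
  shows "\<bar>(\<Sum>n=1..N. mangoldt n / real n) - ln (real N)\<bar> \<le> 4"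
proof -
  let ?S = "\<Sum>n=1..N. mangoldt n / real n :: real"
  have "real N * ?S = (\<Sum>n=1..N. mangoldt n * (real N / real n))"
    by (simp add: sum_distrib_left field_simps)
  also have "\<dots> \<le> (\<Sum>n=1..N. mangoldt n * (real (N div n) + 1))"
    by (intro sum_mono mult_left_mono mangoldt_nonneg)
       (use real_div_le_nat_div in \<open>auto\<close>)
  also have "\<dots> = ln (fact N) + chebyshev_psi N"
    by (simp add: ln_fact_eq_sum_mangoldt chebyshev_psi_def distrib_left sum.distrib)
  also have "\<dots> \<le> real N * ln (real N) + 4 * real N"
    using ln_fact_le_mult_ln chebyshev_psi_le by (intro add_mono)
  finally have "real N * ?S \<le> real N * (ln (real N) + 4)" by (simp add: algebra_simps)
  hence 1: "?S \<le> ln (real N) + 4" using assms by simp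
  have "real N * ln (real N) - real N \<le> ln (fact N)" by (rule ln_fact_ge)
  also have "\<dots> \<le> (\<Sum>n=1..N. mangoldt n * (real N / real n))"
    unfolding ln_fact_eq_sum_mangoldt by (intro sum_mono mult_left_mono mangoldt_nonneg nat_div_le_real_div)
  also have "\<dots> = real N * ?S" by (simp add: sum_distrib_left field_simps)
  finally have "real N * (ln (real N) - 1) \<le> real N * ?S" by (simp add: algebra_simps)
  hence "ln (real N) - 1 \<le> ?S" using assms by simp
  with 1 show ?thesis by (simp add: abs_le_iff)
qed

lemma ln_le_two_sqrt: "x > 0 \<Longrightarrow> ln x \<le> 2 * sqrt x"
  using ln_le_minus_one[of "sqrt x"] by (simp add: ln_sqrt)

text \<open>Only proper prime powers contribute. For each \<open>p\<close> the geometric series over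
  exponents \<open>k \<ge> 2\<close> is at most \<open>2 / p^2\<close>, and
  \<open>ln p \<le> 2 * sqrt p\<close> leaves the summable \<open>4 * p powr (-3/2)\<close>.\<close>

lemma nonprime_mangoldt_bounded:
  obtains K where "K \<ge> 0" "\<And>N. (\<Sum>n\<in>{n\<in>{1..N}. \<not> prime n}. mangoldt n / real n) \<le> K"
proof -
  define K where "K = (\<Sum>n. 4 * real n powr (-3/2))"
  have summ: "summable (\<lambda>n. 4 * real n powr (-3/2))"
    by (intro summable_mult) (simp add: summable_real_powr_iff)
  have "(\<Sum>n\<in>{n\<in>{1..N}. \<not> prime n}. mangoldt n / real n) \<le> K" for N
  proof -
    define P where "P = {p\<in>{1..N}. prime p}"
    let ?f = "\<lambda>(p,k). p ^ k :: nat"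
    have sub: "{n\<in>{1..N}. \<not> prime n \<and> primepow n} \<subseteq> ?f ` (P \<times> {2..N})"
    proof
      fix n assume n: "n \<in> {n\<in>{1..N}. \<not> prime n \<and> primepow n}"
      then obtain p k where pk: "prime p" "k > 0" "n = p ^ k" by (auto simp: primepow_def)
      have "k \<noteq> 1" using n pk by auto
      moreover have "k < n" using pk by (metis less_exp power_less_imp_less_base prime_ge_2_nat
         less_le_trans power_mono zero_le)
      moreover have "p \<le> n" using pk by (metis dvd_imp_le dvd_power n prime_gt_0_nat zero_less_power)
      ultimately show "n \<in> ?f ` (P \<times> {2..N})" using n pk
        by (auto simp: P_def prime_gt_0_nat Suc_le_eq intro!: image_eqI[of _ _ "(p,k)"])
    qed
    have "(\<Sum>n\<in>{n\<in>{1..N}. \<not> prime n}. mangoldt n / real n)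
        = (\<Sum>n\<in>{n\<in>{1..N}. \<not> prime n \<and> primepow n}. mangoldt n / real n)"
      by (intro sum.mono_neutral_right) (auto simp: mangoldt_def)
    also have "\<dots> \<le> (\<Sum>n\<in>?f ` (P \<times> {2..N}). mangoldt n / real n)"
      using sub by (intro sum_mono2) (auto simp: mangoldt_nonneg P_def)
    also have "\<dots> \<le> (\<Sum>x\<in>P \<times> {2..N}. mangoldt (?f x) / real (?f x))"
      by (rule sum_image_le[where g = "\<lambda>n. mangoldt n / real n", unfolded o_def])
         (auto simp: P_def mangoldt_nonneg)
    also have "\<dots> = (\<Sum>p\<in>P. \<Sum>k\<in>{2..N}. mangoldt (p ^ k) / real (p ^ k))"
      by (subst sum.cartesian_product) (simp add: case_prod_unfold)
    also have "\<dots> \<le> (\<Sum>p\<in>P. 4 * real p powr (-3/2))"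
    proof (rule sum_mono)
      fix p assume "p \<in> P"
      hence p: "prime p" "p \<ge> 2" using prime_ge_2_nat by (auto simp: P_def)
      have "(\<Sum>k\<in>{2..N}. mangoldt (p ^ k) / real (p ^ k)) = ln (real p) * (\<Sum>k\<in>{2..N}. (1 / real p) ^ k)"
        using p by (simp add: sum_distrib_left power_divide)
      also have "(\<Sum>k\<in>{2..N}. (1 / real p) ^ k) \<le> 2 / real p ^ 2"
      proof (cases "N \<ge> 2")
        case True
        have "(\<Sum>k\<in>{2..N}. (1 / real p) ^ k) = ((1 / real p) ^ 2 - (1 / real p) ^ Suc N) / (1 - 1 / real p)"
          using p True by (subst sum_gp) auto
        also have "\<dots> \<le> (1 / real p) ^ 2 / (1 - 1 / real p)"
          using p by (intro divide_right_mono) auto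
        also have "\<dots> \<le> (1 / real p) ^ 2 / (1 / 2)"
          using p by (intro divide_left_mono) (auto simp: field_simps)
        finally show ?thesis by (simp add: power_divide)
      qed auto
      also have "ln (real p) * (2 / real p ^ 2) \<le> 2 * sqrt (real p) * (2 / real p ^ 2)"
        using p by (intro mult_right_mono ln_le_two_sqrt) auto
      also have "\<dots> = 4 * real p powr (-3/2)"
      proof -
        have "real p powr (-3/2) = real p powr (1/2 - 2)" by simp
        also have "\<dots> = sqrt (real p) / real p ^ 2"
          using p by (subst powr_diff) (auto simp: powr_half_sqrt)
        finally show ?thesis by simp
      qed
      finally show "(\<Sum>k\<in>{2..N}. mangoldt (p ^ k) / real (p ^ k)) \<le> 4 * real p powr (-3/2)"
        using p by (simp add: mult_left_mono)
    qed
    also have "\<dots> \<le> K" unfolding K_def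
      by (intro sum_le_suminf summ) (auto simp: P_def)
    finally show ?thesis .
  qed
  moreover have "K \<ge> 0" unfolding K_def by (intro suminf_nonneg summ) auto
  ultimately show ?thesis using that by blast
qed

lemma mertens_primes:
  obtains K where "\<And>M N. 1 \<le> M \<Longrightarrow> M \<le> N \<Longrightarrow>
    \<bar>(\<Sum>p\<in>{p\<in>{M<..N}. prime p}. ln (real p) / real p) - (ln (real N) - ln (real M))\<bar> \<le> K"
proof -
  obtain K where K: "K \<ge> 0" "\<And>N. (\<Sum>n\<in>{n\<in>{1..N}. \<not> prime n}. mangoldt n / real n) \<le> K"
    using nonprime_mangoldt_bounded by blast
  have "\<bar>(\<Sum>p\<in>{p\<in>{M<..N}. prime p}. ln (real p) / real p) - (ln (real N) - ln (real M))\<bar> \<le> 8 + K"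
    if MN: "1 \<le> M" "M \<le> N" for M N
  proof -
    let ?f = "\<lambda>n. mangoldt n / real n :: real"
    let ?P = "\<Sum>p\<in>{p\<in>{M<..N}. prime p}. ln (real p) / real p"
    have "(\<Sum>n=1..N. ?f n) - (\<Sum>n=1..M. ?f n) = (\<Sum>n\<in>{M<..N}. ?f n)"
      using MN by (subst sum_diff[symmetric]) (auto intro!: sum.cong)
    also have "\<dots> = (\<Sum>n\<in>{p\<in>{M<..N}. prime p} \<union> {p\<in>{M<..N}. \<not>prime p}. ?f n)"
      by (rule sum.cong) auto
    also have "\<dots> = (\<Sum>n\<in>{p\<in>{M<..N}. prime p}. ?f n) + (\<Sum>n\<in>{p\<in>{M<..N}. \<not>prime p}. ?f n)"
      by (rule sum.union_disjoint) auto
    also have "(\<Sum>n\<in>{p\<in>{M<..N}. prime p}. ?f n) = ?P" by (intro sum.cong) auto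
    finally have 1: "(\<Sum>n=1..N. ?f n) - (\<Sum>n=1..M. ?f n) = ?P + (\<Sum>n\<in>{p\<in>{M<..N}. \<not>prime p}. ?f n)" .
    have 2: "(\<Sum>n\<in>{p\<in>{M<..N}. \<not>prime p}. ?f n) \<ge> 0" by (intro sum_nonneg) (auto simp: mangoldt_nonneg)
    have "(\<Sum>n\<in>{p\<in>{M<..N}. \<not>prime p}. ?f n) \<le> (\<Sum>n\<in>{n\<in>{1..N}. \<not> prime n}. ?f n)"
      using MN by (intro sum_mono2) (auto simp: mangoldt_nonneg)
    with K(2)[of N] have 3: "(\<Sum>n\<in>{p\<in>{M<..N}. \<not>prime p}. ?f n) \<le> K" by linarith
    show ?thesis using 1 2 3 mertens_mangoldt[of M] mertens_mangoldt[of N] MN by linarith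
  qed
  thus ?thesis using that by blast
qed

section \<open>The Moebius function and the Selberg sieve\<close>

definition moebius_mu :: "nat \<Rightarrow> real" where
  "moebius_mu n = (if squarefree n then (-1) ^ card (prime_factors n) else 0)"

lemma moebius_mu_1 [simp]: "moebius_mu (Suc 0) = 1"
  by (simp add: moebius_mu_def)

lemma abs_moebius_mu_le: "\<bar>moebius_mu n\<bar> \<le> 1"
  by (simp add: moebius_mu_def)

lemma moebius_mu_prime_times:
  assumes "prime p" "\<not> p dvd n" "n > 0"
  shows "moebius_mu (p * n) = - moebius_mu n"
proof -
  have cop: "coprime p n" using assms by (simp add: prime_imp_coprime)
  have sq: "squarefree (p * n) \<longleftrightarrow> squarefree n"
    using squarefree_mult_coprime[OF cop squarefree_prime[OF assms(1)]] squarefree_multD(2)[of p n] by blast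
  have "prime_factors (p * n) = insert p (prime_factors n)"
    using assms by (subst prime_factors_product) (auto simp: prime_factorization_prime prime_gt_0_nat)
  moreover have "p \<notin> prime_factors n" using assms by auto
  ultimately have "card (prime_factors (p * n)) = Suc (card (prime_factors n))"
    by simp
  thus ?thesis using sq by (simp add: moebius_mu_def)
qed

text \<open>Fix a prime \<open>p\<close> dividing \<open>n\<close>. The terms \<open>d\<close> and
  \<open>p * d\<close> with \<open>d\<close> not divisible by \<open>p\<close> cancel, and the
  remaining divisors are divisible by \<open>p^2\<close>.\<close>

lemma sum_moebius_mu_divisors:
  assumes "n > 0"
  shows "(\<Sum>d | d dvd n. moebius_mu d) = (if n = 1 then 1 else 0)"
proof (cases "n = 1")
  case False
  then obtain p where p: "prime p" "p dvd n" using prime_factor_nat by blast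
  have fin: "finite {d. d dvd n}" using assms by simp
  let ?A = "{d. d dvd n \<and> \<not> p dvd d}" and ?B = "{d. d dvd n \<and> p dvd d}"
  have "(\<Sum>d | d dvd n. moebius_mu d) = (\<Sum>d\<in>?A \<union> ?B. moebius_mu d)"
    by (rule sum.cong) auto
  also have "\<dots> = (\<Sum>d\<in>?A. moebius_mu d) + (\<Sum>d\<in>?B. moebius_mu d)"
    by (rule sum.union_disjoint) (use fin in auto)
  also have "(\<Sum>d\<in>?B. moebius_mu d) = (\<Sum>d\<in>(\<lambda>d. p * d) ` ?A. moebius_mu d)"
  proof (rule sum.mono_neutral_right)
    show "(\<lambda>d. p * d) ` ?A \<subseteq> ?B"
      using p by (auto intro!: divides_mult prime_imp_coprime)
    show "\<forall>d\<in>?B - (\<lambda>d. p * d) ` ?A. moebius_mu d = 0"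
    proof
      fix d assume d: "d \<in> ?B - (\<lambda>d. p * d) ` ?A"
      then obtain e where e: "d = p * e" by auto
      have "e dvd n" using d e by (auto dest: dvd_mult_right)
      hence "p dvd e" using d e by auto
      hence "p\<^sup>2 dvd d" using e by (auto simp: power2_eq_square)
      hence "\<not> squarefree d" using p by (auto simp: squarefree_def)
      thus "moebius_mu d = 0" by (simp add: moebius_mu_def)
    qed
  qed (use fin in auto)
  also have "\<dots> = (\<Sum>d\<in>?A. moebius_mu (p * d))"
    using p by (subst sum.reindex) (auto simp: inj_on_def)
  also have "\<dots> = (\<Sum>d\<in>?A. - moebius_mu d)"
    using p assms by (intro sum.cong refl moebius_mu_prime_times) (auto intro: dvd_pos_nat)
  finally show ?thesis using False by (simp add: sum_negf)
qed simp

text \<open>Moebius inversion along multiples instead of divisors. It inverts the change of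
  variables between the sieve weights and the diagonal variables.\<close>

lemma sum_moebius_mu_between:
  assumes "n > 0" "m dvd n"
  shows "(\<Sum>d | m dvd d \<and> d dvd n. moebius_mu (n div d)) = (if n = m then 1 else 0)"
proof -
  from assms obtain k where k: "n = m * k" by auto
  have pos: "m > 0" "k > 0" using assms k by auto
  have "(\<Sum>d | m dvd d \<and> d dvd n. moebius_mu (n div d)) = (\<Sum>e | e dvd k. moebius_mu e)"
    by (rule sum.reindex_bij_witness[where i = "\<lambda>e. n div e" and j = "\<lambda>d. n div d"])
       (use pos in \<open>auto simp: k elim!: dvdE\<close>)
  also have "\<dots> = (if k = 1 then 1 else 0)" using pos by (simp add: sum_moebius_mu_divisors)
  also have "\<dots> = (if n = m then 1 else 0)" using pos by (simp add: k)
  finally show ?thesis .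
qed

lemma sum_inverse_squares_le: "(\<Sum>k=1..n. 1 / real k ^ 2) \<le> 2"
proof -
  have "(\<Sum>k=1..n. 1 / real k ^ 2) \<le> 2 - 1 / real n" if "n \<ge> 1"
    using that
  proof (induction n rule: nat_induct_at_least)
    case (Suc n)
    have "1 / real (Suc n) ^ 2 \<le> 1 / (real n * real (Suc n))"
      using Suc by (intro divide_left_mono) (auto simp: power2_eq_square)
    also have "\<dots> = 1 / real n - 1 / real (Suc n)" using Suc by (simp add: field_simps)
    finally show ?case using Suc by simp
  qed simp
  thus ?thesis by (cases "n \<ge> 1") (auto intro: order.trans)
qed

text \<open>Every \<open>n\<close> is \<open>m * k^2\<close> with \<open>m\<close> squarefree, so
  the harmonic sum is at most the squarefree sum times the sum of \<open>1 / k^2\<close>, which is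
  at most \<open>2\<close>.\<close>

lemma sum_inverse_squarefree_ge:
  "ln (real (Suc R)) \<le> 2 * (\<Sum>m\<in>{m\<in>{1..R}. squarefree m}. 1 / real m)"
proof -
  let ?S = "{m\<in>{1..R}. squarefree m}"
  have "ln (real (Suc R)) \<le> harm R" using ln_le_harm[of R] by (simp add: add_ac)
  also have "\<dots> = (\<Sum>n=1..R. 1 / real n)" by (simp add: harm_def divide_inverse)
  also have "\<dots> \<le> (\<Sum>n\<in>(\<lambda>(m,k). m * k\<^sup>2) ` (?S \<times> {1..R}). 1 / real n)"
  proof (rule sum_mono2)
    show "{1..R} \<subseteq> (\<lambda>(m,k). m * k\<^sup>2) ` (?S \<times> {1..R})"
    proof
      fix n assume n: "n \<in> {1..R}"
      have eq: "n = squarefree_part n * square_part n ^ 2"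
        by (rule squarefree_decompose)
      have pos: "squarefree_part n > 0" "square_part n > 0" using n by (auto intro!: Nat.gr0I)
      have "squarefree_part n dvd n" using eq by (metis dvd_triv_left)
      hence "squarefree_part n \<le> n" using n by (intro dvd_imp_le) auto
      moreover have "square_part n dvd n" 
        using square_part_square_dvd[of n] by (metis dvd_mult_left power2_eq_square)
      hence "square_part n \<le> n" using n by (intro dvd_imp_le) auto
      ultimately show "n \<in> (\<lambda>(m,k). m * k\<^sup>2) ` (?S \<times> {1..R})"
        using n eq[symmetric] pos by (intro image_eqI[of _ _ "(squarefree_part n, square_part n)"]) auto
    qed
  qed auto
  also have "\<dots> \<le> (\<Sum>x\<in>?S \<times> {1..R}. 1 / real ((\<lambda>(m,k). m * k\<^sup>2) x))"
    by (rule sum_image_le[where g = "\<lambda>n. 1 / real n", unfolded o_def]) auto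
  also have "\<dots> = (\<Sum>m\<in>?S. 1 / real m) * (\<Sum>k=1..R. 1 / real k ^ 2)"
    by (simp add: sum_product sum.cartesian_product case_prod_unfold)
  also have "\<dots> \<le> (\<Sum>m\<in>?S. 1 / real m) * 2"
    by (intro mult_left_mono sum_inverse_squares_le sum_nonneg) auto
  finally show ?thesis by simp
qed

lemma card_multiples_Ioc:
  assumes "q > 0" "A \<le> B"
  shows "\<bar>real (card {n\<in>{A<..B}. q dvd n}) - real (B - A) / real q\<bar> \<le> 1"
proof -
  have "{n\<in>{A<..B}. q dvd n} = (\<lambda>k. q * k) ` {A div q<..B div q}"
    using assms by (auto simp: image_iff div_less_iff_less_mult less_eq_div_iff_mult_less_eq mult.commute elim!: dvdE)
  hence "card {n\<in>{A<..B}. q dvd n} = B div q - A div q"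
    using assms by (subst \<open>_ = _\<close>, subst card_image) (auto simp: inj_on_def)
  moreover have "A div q \<le> B div q" using assms by (simp add: div_le_mono)
  ultimately have "real (card {n\<in>{A<..B}. q dvd n}) = real (B div q) - real (A div q)" by simp
  moreover have "real (B - A) / real q = real B / real q - real A / real q"
    using assms by (simp add: diff_divide_distrib of_nat_diff)
  moreover have "real (A div q) = of_int \<lfloor>real A / real q\<rfloor>" "real (B div q) = of_int \<lfloor>real B / real q\<rfloor>"
    by (simp_all add: floor_divide_of_nat_eq)
  ultimately show ?thesis by linarith
qed

text \<open>The sieve weights are obtained by prescribing the diagonalised variables \<open>y\<close>; the crude bound
  \<open>R\<^sup>2\<close> on the weights suffices for the remainder.\<close>

lemma selberg_sieve_primes:
  assumes R: "R \<ge> 1" and AB: "R \<le> A" "A \<le> B"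
  shows "real (card {p\<in>{A<..B}. prime p}) \<le> real (B - A) * 2 / ln (real (Suc R)) + real R ^ 6"
proof -
  define V where "V = (\<Sum>m=1..R. moebius_mu m ^ 2 / real (totient m))"
  \<comment> \<open>The minimiser of the diagonal form, the sum of
    \<open>totient m * y m ^ 2\<close>, under the constraint that \<open>moebius_mu m * y m\<close>
    sums to \<open>1\<close>, which is the normalisation \<open>l 1 = 1\<close>.\<close>
  define y where "y m = moebius_mu m / (real (totient m) * V)" for m
  define l where "l d = real d * (\<Sum>n\<in>{n\<in>{1..R}. d dvd n}. moebius_mu (n div d) * y n)" for d
  have tot: "real (totient m) \<ge> 1" if "m \<ge> 1" for m
    using that by (simp add: Suc_le_eq)
  have "ln (real (Suc R)) / 2 \<le> (\<Sum>m\<in>{m\<in>{1..R}. squarefree m}. 1 / real m)"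
    using sum_inverse_squarefree_ge[of R] by simp
  also have "\<dots> \<le> (\<Sum>m\<in>{m\<in>{1..R}. squarefree m}. moebius_mu m ^ 2 / real (totient m))"
    by (intro sum_mono) (auto simp: moebius_mu_def totient_le power_mult[symmetric] intro!: frac_le)
  also have "\<dots> = V" unfolding V_def
    by (intro sum.mono_neutral_left) (auto simp: moebius_mu_def)
  finally have V: "ln (real (Suc R)) / 2 \<le> V" .
  have V1: "V \<ge> 1"
  proof -
    have "(\<Sum>m\<in>{1}. moebius_mu m ^ 2 / real (totient m)) \<le> V"
      unfolding V_def by (rule sum_mono2) (use R in auto)
    thus ?thesis by simp
  qed
  have y_le: "\<bar>y m\<bar> \<le> 1" if "m \<ge> 1" for m
  proof -
    have "1 \<le> real (totient m) * V" using tot[OF that] V1 by (metis mult_mono mult_1 zero_le_one order.trans)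
    moreover have "\<bar>y m\<bar> = \<bar>moebius_mu m\<bar> / (real (totient m) * V)"
      using V1 by (simp add: y_def abs_mult)
    ultimately show ?thesis using abs_moebius_mu_le[of m]
      by (metis divide_le_eq_1_pos less_le_trans order.trans zero_less_one)
  qed
  have l_le: "\<bar>l d\<bar> \<le> real R ^ 2" if "d \<in> {1..R}" for d
  proof -
    have "\<bar>\<Sum>n\<in>{n\<in>{1..R}. d dvd n}. moebius_mu (n div d) * y n\<bar> \<le> (\<Sum>n\<in>{n\<in>{1..R}. d dvd n}. 1)"
      by (rule order.trans[OF sum_abs], intro sum_mono)
         (auto simp: abs_mult intro!: mult_le_one abs_moebius_mu_le y_le)
    also have "\<dots> = real (card {n\<in>{1..R}. d dvd n})" by simp
    also have "\<dots> \<le> real (card {1..R})" by (intro of_nat_mono card_mono) auto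
    finally have "\<bar>\<Sum>n\<in>{n\<in>{1..R}. d dvd n}. moebius_mu (n div d) * y n\<bar> \<le> real R" by simp
    thus ?thesis unfolding l_def abs_mult power2_eq_square using that by (intro mult_mono) auto
  qed
  have l1: "l 1 = 1"
  proof -
    have "{n\<in>{1..R}. 1 dvd n} = {1..R}" by auto
    hence "l 1 = (\<Sum>n=1..R. moebius_mu n * y n)" unfolding l_def by simp
    also have "\<dots> = (\<Sum>n=1..R. moebius_mu n ^ 2 / real (totient n)) / V"
      by (simp add: y_def sum_divide_distrib power2_eq_square)
    also have "\<dots> = V / V" by (simp only: V_def)
    also have "\<dots> = 1" using V1 by simp
    finally show ?thesis .
  qed
  have inv: "(\<Sum>d\<in>{d\<in>{1..R}. m dvd d}. l d / real d) = y m" if m: "m \<in> {1..R}" for m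
  proof -
    have "(\<Sum>d\<in>{d\<in>{1..R}. m dvd d}. l d / real d)
        = (\<Sum>d\<in>{d\<in>{1..R}. m dvd d}. \<Sum>n\<in>{n\<in>{1..R}. d dvd n}. moebius_mu (n div d) * y n)"
      by (intro sum.cong) (auto simp: l_def)
    also have "\<dots> = (\<Sum>n\<in>{1..R}. \<Sum>d | d \<in> {d\<in>{1..R}. m dvd d} \<and> d dvd n. moebius_mu (n div d) * y n)"
      by (rule sum.swap_restrict) auto
    also have "\<dots> = (\<Sum>n\<in>{1..R}. if m dvd n then (\<Sum>d | m dvd d \<and> d dvd n. moebius_mu (n div d)) * y n else 0)"
    proof (intro sum.cong refl)
      fix n assume n: "n \<in> {1..R}"
      show "(\<Sum>d | d \<in> {d\<in>{1..R}. m dvd d} \<and> d dvd n. moebius_mu (n div d) * y n)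
          = (if m dvd n then (\<Sum>d | m dvd d \<and> d dvd n. moebius_mu (n div d)) * y n else 0)"
      proof (cases "m dvd n")
        case True
        have "{d. d \<in> {d\<in>{1..R}. m dvd d} \<and> d dvd n} = {d. m dvd d \<and> d dvd n}"
          using n by (auto dest: dvd_imp_le simp: Suc_le_eq intro!: Nat.gr0I)
        thus ?thesis using True by (simp add: sum_distrib_right)
      next
        case False
        hence "{d. d \<in> {d\<in>{1..R}. m dvd d} \<and> d dvd n} = {}" by (auto dest: dvd_trans)
        thus ?thesis using False by (metis sum.empty)
      qed
    qed
    also have "\<dots> = (\<Sum>n\<in>{1..R}. if n = m then y n else 0)"
      by (intro sum.cong refl) (auto simp: sum_moebius_mu_between)
    also have "\<dots> = y m" using m by simp
    finally show ?thesis .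
  qed
  \<comment> \<open>Since \<open>1 / lcm d e = gcd d e / (d * e)\<close> and \<open>gcd d e\<close>
    is the sum of \<open>totient m\<close> over the common divisors \<open>m\<close>, the form
    becomes a sum of squares in \<open>y\<close>.\<close>
  have quad: "(\<Sum>d=1..R. \<Sum>e=1..R. l d * l e / real (lcm d e)) = 1 / V"
  proof -
    have "(\<Sum>d=1..R. \<Sum>e=1..R. l d * l e / real (lcm d e))
        = (\<Sum>d=1..R. \<Sum>e=1..R. \<Sum>m=1..R. if m dvd d \<and> m dvd e then real (totient m) * (l d / real d) * (l e / real e) else 0)"
    proof (intro sum.cong refl)
      fix d e assume d: "d \<in> {1..R}" "e \<in> {1..R}"
      have "1 / real (lcm d e) = real (gcd d e) / (real d * real e)"
      proof -
        have "real (lcm d e) * real (gcd d e) = real d * real e"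
          by (metis of_nat_mult mult.commute prod_gcd_lcm_nat)
        thus ?thesis using d by (auto simp: field_simps)
      qed
      hence "l d * l e / real (lcm d e) = real (gcd d e) * (l d / real d) * (l e / real e)"
        by (metis (no_types, lifting) mult.commute times_divide_eq_left times_divide_times_eq times_divide_eq_right mult_1)
      also have "gcd d e = (\<Sum>m | m dvd gcd d e. totient m)" by (rule totient_divisor_sum[symmetric])
      also have "{m. m dvd gcd d e} = {m\<in>{1..R}. m dvd d \<and> m dvd e}"
        using d by (auto dest: dvd_imp_le simp: Suc_le_eq intro!: Nat.gr0I)
      also have "real (\<Sum>m\<in>\<dots>. totient m) * (l d / real d) * (l e / real e)
         = (\<Sum>m\<in>{m\<in>{1..R}. m dvd d \<and> m dvd e}. real (totient m) * (l d / real d) * (l e / real e))"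
        unfolding of_nat_sum sum_distrib_right ..
      also have "\<dots> = (\<Sum>m=1..R. if m dvd d \<and> m dvd e then real (totient m) * (l d / real d) * (l e / real e) else 0)"
        by (rule sum.inter_filter) auto
      finally show "l d * l e / real (lcm d e) = \<dots>" .
    qed
    also have "\<dots> = (\<Sum>m=1..R. \<Sum>d=1..R. \<Sum>e=1..R. if m dvd d \<and> m dvd e then real (totient m) * (l d / real d) * (l e / real e) else 0)"
      by (subst (2) sum.swap, subst sum.swap) (intro sum.cong refl)
    also have "\<dots> = (\<Sum>m=1..R. real (totient m) * y m ^ 2)"
    proof (intro sum.cong refl)
      fix m assume m: "m \<in> {1..R}"
      let ?g = "\<lambda>d. if m dvd d then l d / real d else 0"
      have "(\<Sum>d=1..R. \<Sum>e=1..R. if m dvd d \<and> m dvd e then real (totient m) * (l d / real d) * (l e / real e) else 0)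
          = (\<Sum>d=1..R. \<Sum>e=1..R. real (totient m) * (?g d * ?g e))"
        by (intro sum.cong refl) auto
      also have "\<dots> = real (totient m) * ((\<Sum>d=1..R. ?g d) * (\<Sum>e=1..R. ?g e))"
        by (subst sum_product) (simp only: sum_distrib_left)
      also have "(\<Sum>d=1..R. ?g d) = y m"
        using inv[OF m] by (subst sum.inter_filter[symmetric]) auto
      finally show "(\<Sum>d=1..R. \<Sum>e=1..R. if m dvd d \<and> m dvd e then real (totient m) * (l d / real d) * (l e / real e) else 0)
         = real (totient m) * y m ^ 2" by (simp add: power2_eq_square)
    qed
    also have "\<dots> = (\<Sum>m=1..R. moebius_mu m ^ 2 / real (totient m)) / V ^ 2"
      unfolding sum_divide_distrib
      by (intro sum.cong refl) (auto simp: y_def power2_eq_square field_simps)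
    also have "\<dots> = V / V ^ 2" by (simp only: V_def)
    also have "\<dots> = 1 / V" using V1 by (simp add: power2_eq_square)
    finally show ?thesis .
  qed
  have "real (card {p\<in>{A<..B}. prime p}) = (\<Sum>p\<in>{p\<in>{A<..B}. prime p}. 1)" by simp
  also have "\<dots> = (\<Sum>p\<in>{p\<in>{A<..B}. prime p}. (\<Sum>d=1..R. if d dvd p then l d else 0) ^ 2)"
  proof (intro sum.cong refl)
    fix p assume p: "p \<in> {p\<in>{A<..B}. prime p}"
    \<comment> \<open>A prime above \<open>A \<ge> R\<close> has no divisor up to \<open>R\<close>
      except \<open>1\<close>, so the sieve weight is exactly \<open>1\<close> there and nonnegative
      elsewhere.\<close>
    have "(\<Sum>d=1..R. if d dvd p then l d else 0) = (\<Sum>d=1..R. if d = 1 then l d else 0)"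
      using p AB by (intro sum.cong refl) (auto simp: prime_nat_iff)
    also have "\<dots> = 1" using R l1 by simp
    finally show "1 = (\<Sum>d=1..R. if d dvd p then l d else 0) ^ 2" by simp
  qed
  also have "\<dots> \<le> (\<Sum>n\<in>{A<..B}. (\<Sum>d=1..R. if d dvd n then l d else 0) ^ 2)"
    by (intro sum_mono2) auto
  also have "\<dots> = (\<Sum>n\<in>{A<..B}. \<Sum>d=1..R. \<Sum>e=1..R. if lcm d e dvd n then l d * l e else 0)"
    unfolding power2_eq_square sum_product by (intro sum.cong refl) auto
  also have "\<dots> = (\<Sum>d=1..R. \<Sum>e=1..R. \<Sum>n\<in>{A<..B}. if lcm d e dvd n then l d * l e else 0)"
    by (rule trans[OF sum.swap], rule sum.cong[OF refl], rule sum.swap)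
  also have "\<dots> = (\<Sum>d=1..R. \<Sum>e=1..R. l d * l e * real (card {n\<in>{A<..B}. lcm d e dvd n}))"
    by (intro sum.cong refl, subst sum.inter_filter[symmetric]) (auto simp: mult.commute)
  also have "\<dots> \<le> (\<Sum>d=1..R. \<Sum>e=1..R. real (B - A) * (l d * l e / real (lcm d e)) + real R ^ 4)"
  proof (intro sum_mono)
    fix d e assume d: "d \<in> {1..R}" "e \<in> {1..R}"
    let ?c = "real (card {n\<in>{A<..B}. lcm d e dvd n})"
    \<comment> \<open>The count is off by at most \<open>1\<close> and each weight is at most
      \<open>R^2\<close>; over all \<open>R^2\<close> pairs this gives the remainder
      \<open>R^6\<close>.\<close>
    have "\<bar>l d * l e * (?c - real (B - A) / real (lcm d e))\<bar> \<le> (real R ^ 2 * real R ^ 2) * 1"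
      unfolding abs_mult using d AB
      by (intro mult_mono l_le card_multiples_Ioc) (auto intro!: lcm_pos_nat)
    thus "l d * l e * ?c \<le> real (B - A) * (l d * l e / real (lcm d e)) + real R ^ 4"
      by (simp add: algebra_simps abs_le_iff flip: power_add)
  qed
  also have "\<dots> = real (B - A) * (1 / V) + real R ^ 6"
    by (simp add: sum.distrib quad[symmetric] sum_distrib_left) (simp add: power_numeral_reduce)
  also have "real (B - A) * (1 / V) \<le> real (B - A) * (1 / (ln (real (Suc R)) / 2))"
    using V R V1 by (intro mult_left_mono divide_left_mono) auto
  finally show ?thesis by simp
qed

lemma prime_mass_short_interval:
  assumes e: "0 < e" "e \<le> (1::real)"
  shows "eventually (\<lambda>y::real. \<forall>P. P \<subseteq> {p. prime p \<and> y < real p \<and> real p \<le> y * exp e} \<longrightarrow>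
           (\<Sum>p\<in>P. ln (real p) / real p) \<le> 100 * e) at_top"
proof -
  have "eventually (\<lambda>y::real. (2*y*e + 1) * (48 / ln y) * ((ln y + 1) / y) + sqrt y * ((ln y + 1) / y) \<le> 100 * e) at_top"
    using e by real_asymp
  moreover have "eventually (\<lambda>y::real. y powr (1/24) \<le> y powr (1/12) - 1) at_top" by real_asymp
  moreover have "eventually (\<lambda>y::real. y powr (1/12) \<le> y - 1) at_top" by real_asymp
  moreover have "eventually (\<lambda>y::real. y > 3) at_top" by real_asymp
  ultimately show ?thesis
  proof eventually_elim
    case (elim y)
    define A B R where "A = nat \<lfloor>y\<rfloor>" and "B = nat \<lfloor>y * exp e\<rfloor>" and "R = nat \<lfloor>y powr (1/12)\<rfloor>"
    let ?P = "{p\<in>{A<..B}. prime p}"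
    have y: "y > 3" by (rule elim)
    have Rr: "real R \<le> y powr (1/12)" "real R > y powr (1/12) - 1"
      unfolding R_def by (auto simp: of_nat_floor)
    have Rlow: "y powr (1/24) < real R" using Rr elim by linarith
    have R1: "R \<ge> 1" 
      using Rlow y ge_one_powr_ge_zero[of y "1/24"] by simp
    have RA: "R \<le> A"
    proof -
      have "\<lfloor>y powr (1/12)\<rfloor> \<le> \<lfloor>y\<rfloor>" using elim by (intro floor_mono) auto
      thus ?thesis unfolding A_def R_def by simp
    qed
    have "exp e \<ge> 1" using e by simp
    hence "y \<le> y * exp e" using y by simp
    hence AB: "A \<le> B" unfolding A_def B_def by (intro nat_mono floor_mono)
    have "exp e - 1 \<le> 2 * e"
    proof -
      have "exp e \<le> 1 + e + e\<^sup>2" using e by (intro exp_bound) auto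
      also have "e\<^sup>2 \<le> e * 1" unfolding power2_eq_square using e by (intro mult_left_mono) auto
      finally show ?thesis by simp
    qed
    hence "y * (exp e - 1) \<le> y * (2 * e)" using y by (intro mult_left_mono) auto
    moreover have "real (B - A) \<le> y * exp e - (y - 1)"
      using AB y unfolding A_def B_def by (simp add: of_nat_diff) linarith
    ultimately have BA: "real (B - A) \<le> 2*y*e + 1" by (simp add: algebra_simps)
    have lnR: "ln y / 24 \<le> ln (real (Suc R))"
    proof -
      have "ln y / 24 = ln (y powr (1/24))" using y by (simp add: ln_powr)
      also have "\<dots> \<le> ln (real (Suc R))" using Rlow y by (subst ln_le_cancel_iff) auto
      finally show ?thesis .
    qed
    have lny: "ln y > 0" using y by simp
    have "real R ^ 6 \<le> (y powr (1/12)) ^ 6" using Rr by (intro power_mono) auto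
    also have "\<dots> = sqrt y" using y by (simp add: powr_power powr_half_sqrt)
    finally have R6: "real R ^ 6 \<le> sqrt y" .
    have "real (card ?P) \<le> real (B - A) * 2 / ln (real (Suc R)) + real R ^ 6"
      by (rule selberg_sieve_primes[OF R1 RA AB])
    also have "real (B - A) * 2 / ln (real (Suc R)) \<le> real (B - A) * 2 / (ln y / 24)"
      using lnR lny R1 by (intro divide_left_mono mult_pos_pos) auto
    also have "\<dots> = real (B - A) * (48 / ln y)" by simp
    also have "\<dots> \<le> (2*y*e + 1) * (48 / ln y)" using BA lny by (intro mult_right_mono) auto
    finally have card: "real (card ?P) \<le> (2*y*e + 1) * (48 / ln y) + sqrt y" using R6 by linarith
    show ?case
    proof (intro allI impI)
      fix P assume P: "P \<subseteq> {p. prime p \<and> y < real p \<and> real p \<le> y * exp e}"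
      have PP: "P \<subseteq> ?P"
      proof
        fix p assume "p \<in> P"
        hence p: "prime p" "y < real p" "real p \<le> y * exp e" using P by auto
        have "A < p" unfolding A_def using p y by (simp add: floor_less_iff nat_less_iff)
        moreover have "p \<le> B" unfolding B_def using p y by (simp add: le_nat_floor)
        ultimately show "p \<in> ?P" using p by simp
      qed
      have "(\<Sum>p\<in>P. ln (real p) / real p) \<le> (\<Sum>p\<in>P. (ln y + 1) / y)"
      proof (rule sum_mono)
        fix p assume "p \<in> P"
        hence p: "y < real p" "real p \<le> y * exp e" using P by auto
        have "ln (real p) \<le> ln (y * exp e)" using p y by (subst ln_le_cancel_iff) auto
        also have "\<dots> \<le> ln y + 1" using y e by (subst ln_mult) auto
        finally show "ln (real p) / real p \<le> (ln y + 1) / y" using p y lny by (intro frac_le) auto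
      qed
      also have "\<dots> = real (card P) * ((ln y + 1) / y)" by simp
      also have "\<dots> \<le> real (card ?P) * ((ln y + 1) / y)"
        using PP lny y by (intro mult_right_mono of_nat_mono card_mono) auto
      also have "\<dots> \<le> ((2*y*e + 1) * (48 / ln y) + sqrt y) * ((ln y + 1) / y)"
        using card lny y by (intro mult_right_mono) auto
      also have "\<dots> \<le> 100 * e" using elim(1) unfolding distrib_right[of "(2*y*e + 1) * (48 / ln y)"] by simp
      finally show "(\<Sum>p\<in>P. ln (real p) / real p) \<le> 100 * e" .
    qed
  qed
qed

section \<open>Dirichlet characters\<close>

text \<open>Summation by parts. The induction carries the sum minus its boundary term
  \<open>f N * C N\<close>, so that the decrements of \<open>f\<close> telescope.\<close>

lemma abel_summation_bound:
  fixes c :: "nat \<Rightarrow> complex" and f :: "nat \<Rightarrow> real"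
  assumes B: "\<And>N. norm (\<Sum>n\<in>{M<..N}. c n) \<le> B"
    and f: "\<And>n. n > M \<Longrightarrow> f n \<ge> 0" "\<And>n. n > M \<Longrightarrow> f (Suc n) \<le> f n"
  shows "norm (\<Sum>n\<in>{M<..N}. of_real (f n) * c n) \<le> B * f (Suc M)"
proof (cases "N > M")
  case True
  define C where "C N = (\<Sum>n\<in>{M<..N}. c n)" for N
  define S where "S N = (\<Sum>n\<in>{M<..N}. of_real (f n) * c n)" for N
  have B0: "B \<ge> 0" using order.trans[OF norm_ge_zero B] .
  have "norm (S N - of_real (f N) * C N) \<le> B * (f (Suc M) - f N)"
    using True[unfolded Suc_le_eq[symmetric]]
  proof (induction N rule: dec_induct)
    case base
    have "{M<..Suc M} = {Suc M}" by auto
    thus ?case by (simp add: S_def C_def)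
  next
    case (step N)
    have ins: "{M<..Suc N} = insert (Suc N) {M<..N}" using step by auto
    have "S (Suc N) - of_real (f (Suc N)) * C (Suc N) = (S N - of_real (f N) * C N) + of_real (f N - f (Suc N)) * C N"
      unfolding S_def C_def ins by (simp add: algebra_simps)
    also have "norm \<dots> \<le> norm (S N - of_real (f N) * C N) + norm (of_real (f N - f (Suc N)) * C N)"
      by (rule norm_triangle_ineq)
    also have "norm (of_real (f N - f (Suc N)) * C N) \<le> (f N - f (Suc N)) * B"
      using f(2)[of N] step B[of N] by (auto simp: norm_mult C_def simp flip: of_real_diff intro!: mult_left_mono)
    finally show ?case using step.IH by (simp add: algebra_simps)
  qed
  moreover have "norm (of_real (f N) * C N) \<le> f N * B"
    using f(1)[OF True] B[of N] by (auto simp: norm_mult C_def intro!: mult_left_mono)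
  moreover have "norm (S N) \<le> norm (S N - of_real (f N) * C N) + norm (of_real (f N) * C N)"
    using norm_triangle_ineq[of "S N - of_real (f N) * C N" "of_real (f N) * C N"] by simp
  ultimately show ?thesis unfolding S_def by (simp add: algebra_simps)
next
  case False
  have "B \<ge> 0" using order.trans[OF norm_ge_zero B] .
  with False f(1)[of "Suc M"] show ?thesis by simp
qed

lemma tail_bound_imp_limit:
  fixes X :: "nat \<Rightarrow> 'a::banach"
  assumes X: "\<And>M N. m \<le> M \<Longrightarrow> M \<le> N \<Longrightarrow> norm (X N - X M) \<le> e M" and e: "e \<longlonglongrightarrow> 0"
  shows "\<exists>L. X \<longlonglongrightarrow> L \<and> (\<forall>M\<ge>m. norm (X M - L) \<le> e M)"
proof -
  have "Cauchy X"
  proof (rule CauchyI)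
    fix r :: real assume r: "r > 0"
    have "eventually (\<lambda>n. e n < r / 2 \<and> n \<ge> m) sequentially"
      using order_tendstoD(2)[OF e, of "r/2"] r eventually_ge_at_top[of m] by (auto simp: eventually_conj_iff)
    then obtain M where M: "e M < r / 2" "M \<ge> m" by (auto simp: eventually_sequentially)
    show "\<exists>M. \<forall>a\<ge>M. \<forall>b\<ge>M. norm (X a - X b) < r"
    proof (intro exI[of _ M] allI impI)
      fix a b assume "a \<ge> M" "b \<ge> M"
      hence "norm (X a - X M) < r / 2" "norm (X b - X M) < r / 2" using X[OF M(2)] M by (meson le_less_trans)+
      thus "norm (X a - X b) < r" using norm_triangle_ineq4[of "X a - X M" "X b - X M"] by simp
    qed
  qed
  then obtain L where L: "X \<longlonglongrightarrow> L" using Cauchy_convergent convergent_def by blast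
  moreover have "norm (X M - L) \<le> e M" if "m \<le> M" for M
  proof -
    have "(\<lambda>N. norm (X N - X M)) \<longlonglongrightarrow> norm (L - X M)" by (intro tendsto_intros L)
    moreover have "eventually (\<lambda>N. norm (X N - X M) \<le> e M) sequentially"
      using eventually_ge_at_top[of M] by eventually_elim (use X that in auto)
    ultimately have "norm (L - X M) \<le> e M" by (rule tendsto_upperbound) auto
    thus ?thesis by (simp add: norm_minus_commute)
  qed
  ultimately show ?thesis by blast
qed

text \<open>Moebius inversion of \<open>mangoldt_sum\<close> gives \<open>mangoldt n\<close> as the
  sum of \<open>moebius_mu d * ln (n div d)\<close>. After splitting this logarithm, the part with
  \<open>ln n\<close> vanishes: either the Moebius sum is \<open>0\<close>, or
  \<open>n = 1\<close>.\<close>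

lemma sum_moebius_mu_ln:
  assumes "n > 0"
  shows "(\<Sum>d | d dvd n. moebius_mu d * ln (real d)) = - mangoldt n"
proof -
  have fin: "finite {d. d dvd n}" using assms by simp
  have "(\<Sum>d | d dvd n. moebius_mu d * ln (real (n div d)))
      = (\<Sum>d | d dvd n. \<Sum>e | e dvd n div d. moebius_mu d * mangoldt e)"
  proof (intro sum.cong refl)
    fix d assume "d \<in> {d. d dvd n}"
    hence "n div d \<noteq> 0" using assms by (auto simp: dvd_div_eq_0_iff)
    thus "moebius_mu d * ln (real (n div d)) = (\<Sum>e | e dvd n div d. moebius_mu d * mangoldt e)"
      using mangoldt_sum[of "n div d", where 'a=real] by (simp add: sum_distrib_left[symmetric])
  qed
  also have "\<dots> = (\<Sum>d | d dvd n. \<Sum>e | e \<in> {e. e dvd n} \<and> d * e dvd n. moebius_mu d * mangoldt e)"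
  proof (intro sum.cong refl)
    fix d assume d: "d \<in> {d. d dvd n}"
    then obtain k where k: "n = d * k" by auto
    show "{e. e dvd n div d} = {e \<in> {e. e dvd n}. d * e dvd n}"
      using assms k by (auto intro: dvd_mult)
  qed
  also have "\<dots> = (\<Sum>e | e dvd n. \<Sum>d | d \<in> {d. d dvd n} \<and> d * e dvd n. moebius_mu d * mangoldt e)"
    by (rule sum.swap_restrict) (use fin in auto)
  also have "\<dots> = (\<Sum>e | e dvd n. \<Sum>d | d dvd n div e. moebius_mu d * mangoldt e)"
  proof (intro sum.cong refl)
    fix e assume e: "e \<in> {e. e dvd n}"
    then obtain k where k: "n = e * k" by auto
    show "{d \<in> {d. d dvd n}. d * e dvd n} = {d. d dvd n div e}"
      using assms k by (auto intro: dvd_mult simp: mult.commute)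
  qed
  also have "\<dots> = (\<Sum>e | e dvd n. if e = n then mangoldt e else 0)"
  proof (intro sum.cong refl)
    fix e assume e: "e \<in> {e. e dvd n}"
    then obtain k where k: "n = e * k" by auto
    show "(\<Sum>d | d dvd n div e. moebius_mu d * mangoldt e) = (if e = n then mangoldt e else 0)"
      using assms k sum_moebius_mu_divisors[of k] by (auto simp: sum_distrib_right[symmetric])
  qed
  also have "\<dots> = mangoldt n" using fin by simp
  finally have 1: "(\<Sum>d | d dvd n. moebius_mu d * ln (real (n div d))) = mangoldt n" .
  have "(\<Sum>d | d dvd n. moebius_mu d * ln (real (n div d)))
      = (\<Sum>d | d dvd n. moebius_mu d * ln (real n) - moebius_mu d * ln (real d))"
  proof (intro sum.cong refl)
    fix d assume d: "d \<in> {d. d dvd n}"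
    then obtain k where k: "n = d * k" by auto
    show "moebius_mu d * ln (real (n div d)) = moebius_mu d * ln (real n) - moebius_mu d * ln (real d)"
      using assms k by (auto simp: ln_mult algebra_simps)
  qed
  also have "\<dots> = ln (real n) * (\<Sum>d | d dvd n. moebius_mu d) - (\<Sum>d | d dvd n. moebius_mu d * ln (real d))"
    by (simp add: sum_subtractf sum_distrib_left mult.commute)
  also have "ln (real n) * (\<Sum>d | d dvd n. moebius_mu d) = 0"
    using assms by (simp add: sum_moebius_mu_divisors)
  finally show ?thesis using 1 by simp
qed

text \<open>Beyond a point where the tail of \<open>a\<close> is small,
  \<open>ln n \<le> ln N\<close> suffices; the head is constant. This makes an exceptional set of
  primes negligible against the \<open>ln N\<close> of Mertens.\<close>

lemma summable_imp_ln_weighted_sum_small: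
  fixes a :: "nat \<Rightarrow> real"
  assumes a: "\<And>n. a n \<ge> 0" "summable a"
  shows "(\<lambda>N. (\<Sum>n=1..N. a n * ln (real n)) / ln (real N)) \<longlonglongrightarrow> 0"
proof (rule tendstoI)
  fix e :: real assume e: "e > 0"
  have nn: "a n * ln (real n) \<ge> 0" for n using a(1)[of n] by (cases "n = 0") auto
  obtain M where M: "\<And>n. n \<ge> M \<Longrightarrow> norm (\<Sum>i\<in>{M..<n}. a i) < e / 2"
    using a(2) e unfolding summable_Cauchy by (meson half_gt_zero order_refl)
  define K where "K = (\<Sum>n=1..M. a n * ln (real n))"
  have "eventually (\<lambda>N::nat. K / ln (real N) < e / 2) sequentially"
  proof -
    have "(\<lambda>N::nat. K / ln (real N)) \<longlonglongrightarrow> 0" by real_asymp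
    thus ?thesis using e by (intro order_tendstoD(2)) auto
  qed
  moreover have "eventually (\<lambda>N::nat. N \<ge> M \<and> N \<ge> 2) sequentially"
    using eventually_ge_at_top[of "max M 2"] by eventually_elim auto
  ultimately show "eventually (\<lambda>N. dist ((\<Sum>n=1..N. a n * ln (real n)) / ln (real N)) 0 < e) sequentially"
  proof eventually_elim
    case (elim N)
    hence lnN: "ln (real N) > 0" by simp
    have "(\<Sum>n=1..N. a n * ln (real n)) \<le> (\<Sum>n\<in>{1..M} \<union> {M..<Suc N}. a n * ln (real n))"
      by (rule sum_mono2) (use nn in auto)
    also have "\<dots> \<le> K + (\<Sum>n\<in>{M..<Suc N}. a n * ln (real n))"
      unfolding K_def
      by (subst sum_Un) (use nn in \<open>auto intro!: sum_nonneg\<close>)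
    also have "(\<Sum>n\<in>{M..<Suc N}. a n * ln (real n)) \<le> (\<Sum>n\<in>{M..<Suc N}. a n * ln (real N))"
    proof (intro sum_mono mult_left_mono a)
      fix n assume n: "n \<in> {M..<Suc N}"
      show "ln (real n) \<le> ln (real N)" using n lnN by (cases "n = 0") auto
    qed
    also have "\<dots> = (\<Sum>n\<in>{M..<Suc N}. a n) * ln (real N)" by (rule sum_distrib_right[symmetric])
    also have "\<dots> \<le> (e / 2) * ln (real N)"
      using M[of "Suc N"] elim lnN by (intro mult_right_mono) (auto simp: abs_if split: if_splits)
    finally have "(\<Sum>n=1..N. a n * ln (real n)) / ln (real N) \<le> K / ln (real N) + e / 2"
      using lnN by (simp add: field_simps)
    moreover have "(\<Sum>n=1..N. a n * ln (real n)) / ln (real N) \<ge> 0"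
      using nn lnN by (intro divide_nonneg_nonneg sum_nonneg) auto
    ultimately show ?case using elim(1) unfolding dist_real_def diff_0_right by linarith
  qed
qed

section \<open>Characters modulo \<open>Q\<close> and their sums at \<open>1\<close>\<close>

locale dirichlet_char =
  fixes Q :: nat and chi :: "nat \<Rightarrow> complex"
  assumes Q_pos: "Q > 0"
    and mult: "chi (m * n) = chi m * chi n"
    and period: "chi (n + Q) = chi n"
    and zero: "\<not> coprime n Q \<Longrightarrow> chi n = 0"
    and unit: "coprime n Q \<Longrightarrow> norm (chi n) = 1"
begin

lemma char_one [simp]: "chi (Suc 0) = 1"
proof -
  have "chi (Suc 0) * chi (Suc 0) = chi (Suc 0)" using mult[of 1 1] by simp
  moreover have "chi (Suc 0) \<noteq> 0" using unit[of "Suc 0"] by auto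
  ultimately show ?thesis by simp
qed

lemma norm_le_1: "norm (chi n) \<le> 1"
  using zero[of n] unit[of n] by (cases "coprime n Q") auto

lemma period_mult: "chi (n + k * Q) = chi n"
proof (induction k)
  case (Suc k)
  have "chi (n + Suc k * Q) = chi ((n + k * Q) + Q)" by (simp add: algebra_simps)
  thus ?case using Suc period by simp
qed simp

lemma mod_eq: "chi (n mod Q) = chi n"
  using period_mult[of "n mod Q" "n div Q"] by (simp add: add.commute)

lemma cong_eq: "[m = n] (mod Q) \<Longrightarrow> chi m = chi n"
  using mod_eq[of m] mod_eq[of n] by (simp add: cong_def)

end

locale nonprincipal_char = dirichlet_char +
  assumes nonprincipal: "\<exists>y. coprime y Q \<and> chi y \<noteq> 1"
begin

text \<open>Multiplication by a unit \<open>y\<close> with \<open>chi y \<noteq> 1\<close> permutes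
  the residues but multiplies the sum by \<open>chi y\<close>.\<close>

lemma sum_period: "(\<Sum>n<Q. chi n) = 0"
proof -
  obtain y where y: "coprime y Q" "chi y \<noteq> 1" using nonprincipal by blast
  have inj: "inj_on (\<lambda>n. y * n mod Q) {..<Q}"
  proof (rule inj_onI)
    fix a b assume ab: "a \<in> {..<Q}" "b \<in> {..<Q}" "y * a mod Q = y * b mod Q"
    hence "[a = b] (mod Q)" using cong_mult_lcancel_nat[OF y(1), of a b] by (simp add: cong_def)
    thus "a = b" using ab by (simp add: cong_def)
  qed
  have "(\<lambda>n. y * n mod Q) ` {..<Q} = {..<Q}"
    by (rule endo_inj_surj) (use inj Q_pos in auto)
  hence "(\<Sum>n<Q. chi n) = (\<Sum>n<Q. chi (y * n mod Q))"
    using sum.reindex[OF inj, of chi] by simp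
  also have "\<dots> = chi y * (\<Sum>n<Q. chi n)"
    by (simp add: mod_eq mult sum_distrib_left)
  finally have "(1 - chi y) * (\<Sum>n<Q. chi n) = 0" by (simp add: algebra_simps)
  thus ?thesis using y by simp
qed

lemma norm_sum_lessThan_le: "norm (\<Sum>n<N. chi n) \<le> real Q"
proof -
  have *: "(\<Sum>n<k*Q + r. chi n) = (\<Sum>n<r. chi n)" for k r
  proof (induction k)
    case (Suc k)
    have "(\<Sum>n<Suc k * Q + r. chi n) = (\<Sum>n<Q. chi n) + (\<Sum>n\<in>{Q..<Suc k*Q+r}. chi n)"
      by (subst sum.union_disjoint[symmetric]) (auto intro!: sum.cong)
    also have "(\<Sum>n\<in>{Q..<Suc k*Q+r}. chi n) = (\<Sum>n<k*Q+r. chi (n + Q))"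
      by (rule sum.reindex_bij_witness[where i = "\<lambda>n. n + Q" and j = "\<lambda>n. n - Q"]) auto
    finally show ?case using Suc by (simp add: period sum_period)
  qed simp
  have "(\<Sum>n<N. chi n) = (\<Sum>n<N mod Q. chi n)" using *[of "N div Q" "N mod Q"] by simp
  also have "norm \<dots> \<le> (\<Sum>n<N mod Q. 1)"
    by (rule order.trans[OF norm_sum]) (intro sum_mono norm_le_1)
  also have "\<dots> = real (N mod Q)" by simp
  also have "\<dots> \<le> real Q" using Q_pos by (simp add: less_imp_le)
  finally show ?thesis .
qed

lemma norm_sum_Ioc_le: "norm (\<Sum>n\<in>{M<..N}. chi n) \<le> 2 * real Q"
proof (cases "M \<le> N")
  case True
  have "(\<Sum>n\<in>{M<..N}. chi n) = (\<Sum>n<Suc N. chi n) - (\<Sum>n<Suc M. chi n)"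
  proof -
    have "{M<..N} = {..<Suc N} - {..<Suc M}" by auto
    thus ?thesis using True by (simp only:) (rule sum_diff, auto)
  qed
  also have "norm \<dots> \<le> norm (\<Sum>n<Suc N. chi n) + norm (\<Sum>n<Suc M. chi n)" by (rule norm_triangle_ineq4)
  also have "\<dots> \<le> 2 * real Q" using norm_sum_lessThan_le[of "Suc N"] norm_sum_lessThan_le[of "Suc M"] by linarith
  finally show ?thesis .
qed simp

lemma norm_weighted_sum_le:
  assumes "\<And>n. n > M \<Longrightarrow> f n \<ge> 0" "\<And>n. n > M \<Longrightarrow> f (Suc n) \<le> f n"
  shows "norm (\<Sum>n\<in>{M<..N}. of_real (f n) * chi n) \<le> 2 * real Q * f (Suc M)"
  by (rule abel_summation_bound[OF norm_sum_Ioc_le]) (use assms in auto)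

definition Lsum :: "nat \<Rightarrow> complex" where "Lsum N = (\<Sum>n=1..N. chi n / of_nat n)"

text \<open>Partial sums of the Dirichlet series of \<open>- L' / L\<close> at
  \<open>1\<close>.\<close>

definition Lambda_sum :: "nat \<Rightarrow> complex" where "Lambda_sum N = (\<Sum>n=1..N. chi n * mangoldt n / of_nat n)"

definition L1 :: complex where "L1 = lim Lsum"

lemma Lsum_tail: "M \<le> N \<Longrightarrow> norm (Lsum N - Lsum M) \<le> 2 * real Q / real (Suc M)"
proof -
  assume MN: "M \<le> N"
  have "Lsum N - Lsum M = (\<Sum>n\<in>{M<..N}. chi n / of_nat n)"
    unfolding Lsum_def using MN by (subst sum_diff[symmetric]) (auto intro!: sum.cong)
  also have "\<dots> = (\<Sum>n\<in>{M<..N}. of_real (1 / real n) * chi n)"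
    by (intro sum.cong) auto
  also have "norm \<dots> \<le> 2 * real Q * (1 / real (Suc M))"
    by (rule norm_weighted_sum_le) (auto simp: field_simps)
  finally show ?thesis by simp
qed

lemma Lsum_error: "norm (Lsum N - L1) \<le> 2 * real Q / real (Suc N)"
proof -
  have "(\<lambda>M. 2 * real Q / real (Suc M)) \<longlonglongrightarrow> 0" by real_asymp
  then obtain L where L: "Lsum \<longlonglongrightarrow> L" "\<And>M. norm (Lsum M - L) \<le> 2 * real Q / real (Suc M)"
    using tail_bound_imp_limit[of 0 Lsum "\<lambda>M. 2 * real Q / real (Suc M)"] Lsum_tail by auto
  have "L1 = L" unfolding L1_def using L(1) by (rule limI)
  with L(2) show ?thesis by auto
qed

lemma Lsum_div_error:
  assumes "d \<in> {1..N}"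
  shows "norm (Lsum (N div d) - L1) \<le> 2 * real Q * real d / real N"
proof -
  have "real N / real d \<le> real (Suc (N div d))" using real_div_le_nat_div[of N d] by simp
  hence "2 * real Q / real (Suc (N div d)) \<le> 2 * real Q / (real N / real d)"
    using assms by (intro divide_left_mono) auto
  thus ?thesis using Lsum_error[of "N div d"] by simp
qed

lemma ln_weighted_sum_bounded: "\<exists>K. \<forall>N. norm (\<Sum>n=1..N. chi n * of_real (ln (real n)) / of_nat n) \<le> K"
proof -
  define f where "f n = ln (real n) / real n" for n :: nat
  have *: "norm (\<Sum>n=1..N. chi n * of_real (ln (real n)) / of_nat n) \<le> 3 + 2 * real Q * f 4" for N
  proof -
    \<comment> \<open>The function \<open>ln n / n\<close> decreases only from \<open>e\<close> on,
      so the first three terms are split off before summing by parts.\<close>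
    have "(\<Sum>n=1..N. chi n * of_real (ln (real n)) / of_nat n) = (\<Sum>n\<in>{0<..min N 3} \<union> {3<..N}. of_real (f n) * chi n)"
      by (intro sum.cong) (auto simp: f_def)
    also have "\<dots> = (\<Sum>n\<in>{0<..min N 3}. of_real (f n) * chi n) + (\<Sum>n\<in>{3<..N}. of_real (f n) * chi n)"
      by (rule sum.union_disjoint) auto
    also have "norm \<dots> \<le> norm (\<Sum>n\<in>{0<..min N 3}. of_real (f n) * chi n) + norm (\<Sum>n\<in>{3<..N}. of_real (f n) * chi n)"
      by (rule norm_triangle_ineq)
    also have "norm (\<Sum>n\<in>{0<..min N 3}. of_real (f n) * chi n) \<le> (\<Sum>n\<in>{0<..min N 3}. 1)"
    proof (rule order.trans[OF norm_sum], intro sum_mono)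
      fix n assume n: "n \<in> {0<..min N 3}"
      have "ln (real n) \<le> real n" using n ln_le_minus_one[of "real n"] by simp
      hence "f n \<le> 1" "f n \<ge> 0" using n by (auto simp: f_def divide_le_eq)
      thus "norm (of_real (f n) * chi n) \<le> 1" using norm_le_1[of n] by (simp add: norm_mult mult_le_one)
    qed
    also have "\<dots> \<le> 3" by simp
    also have "norm (\<Sum>n\<in>{3<..N}. of_real (f n) * chi n) \<le> 2 * real Q * f (Suc 3)"
    proof (rule norm_weighted_sum_le)
      fix n :: nat assume n: "n > 3"
      show "f n \<ge> 0" using n by (simp add: f_def)
      have "exp 1 \<le> real n" using exp_le n by linarith
      thus "f (Suc n) \<le> f n" unfolding f_def by (intro ln_x_over_x_mono) auto
    qed
    finally show ?thesis by simp
  qed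
  thus ?thesis by blast
qed

text \<open>The bounded series with coefficients \<open>chi n * ln n / n\<close> is the convolution
  of the one behind \<open>Lambda_sum\<close> with the one behind \<open>Lsum\<close>. Replacing
  each inner sum \<open>Lsum (N div d)\<close> by \<open>L1\<close> costs \<open>O(d / N)\<close>,
  in total \<open>O(chebyshev_psi N / N)\<close>.\<close>

lemma L1_times_Lambda_sum_bounded: "\<exists>K. \<forall>N. norm (L1 * Lambda_sum N) \<le> K"
proof -
  obtain K where K: "\<And>N. norm (\<Sum>n=1..N. chi n * of_real (ln (real n)) / of_nat n) \<le> K"
    using ln_weighted_sum_bounded by blast
  have "norm (L1 * Lambda_sum N) \<le> K + 8 * real Q" for N
  proof (cases "N = 0")
    case True
    thus ?thesis using order.trans[OF norm_ge_zero K[of 0]] by (simp add: Lambda_sum_def)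
  next
    case False
    have "(\<Sum>n=1..N. chi n * of_real (ln (real n)) / of_nat n)
       = (\<Sum>n=1..N. \<Sum>d | d dvd n. (chi d * mangoldt d / of_nat d) * (chi (n div d) / of_nat (n div d)))"
    proof (intro sum.cong refl)
      fix n assume n: "n \<in> {1..N}"
      have "chi n * of_real (ln (real n)) / of_nat n = (\<Sum>d | d dvd n. chi n * mangoldt d / of_nat n)"
        using n mangoldt_sum[of n, where 'a=complex] by (simp add: sum_distrib_left[symmetric] sum_divide_distrib[symmetric])
      also have "\<dots> = (\<Sum>d | d dvd n. (chi d * mangoldt d / of_nat d) * (chi (n div d) / of_nat (n div d)))"
        by (intro sum.cong refl) (auto simp: mult elim!: dvdE)
      finally show "chi n * of_real (ln (real n)) / of_nat n = \<dots>" .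
    qed
    also have "\<dots> = (\<Sum>d=1..N. \<Sum>e=1..N div d. (chi d * mangoldt d / of_nat d) * (chi e / of_nat e))"
      by (rule sum_divisors_eq_sum_multiples)
    also have "\<dots> = (\<Sum>d=1..N. (chi d * mangoldt d / of_nat d) * Lsum (N div d))"
      by (simp add: Lsum_def sum_distrib_left)
    also have "\<dots> = (\<Sum>d=1..N. (chi d * mangoldt d / of_nat d) * L1 + (chi d * mangoldt d / of_nat d) * (Lsum (N div d) - L1))"
      by (intro sum.cong refl) (simp only: right_diff_distrib, simp)
    also have "\<dots> = L1 * Lambda_sum N + (\<Sum>d=1..N. (chi d * mangoldt d / of_nat d) * (Lsum (N div d) - L1))"
      by (simp add: sum.distrib Lambda_sum_def sum_distrib_left mult.commute)
    finally have eq: "L1 * Lambda_sum N = (\<Sum>n=1..N. chi n * of_real (ln (real n)) / of_nat n)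
       - (\<Sum>d=1..N. (chi d * mangoldt d / of_nat d) * (Lsum (N div d) - L1))" by simp
    have "norm (\<Sum>d=1..N. (chi d * mangoldt d / of_nat d) * (Lsum (N div d) - L1))
       \<le> (\<Sum>d=1..N. mangoldt d * (2 * real Q / real N))"
    proof (rule order.trans[OF norm_sum], intro sum_mono)
      fix d assume d: "d \<in> {1..N}"
      have "norm ((chi d * mangoldt d / of_nat d) * (Lsum (N div d) - L1))
          \<le> (1 * mangoldt d / real d) * (2 * real Q * real d / real N)"
        unfolding norm_mult norm_divide norm_mangoldt norm_of_nat using d
        by (intro mult_mono divide_right_mono norm_le_1 Lsum_div_error) (auto simp: mangoldt_nonneg)
      also have "\<dots> = mangoldt d * (2 * real Q / real N)" using d by simp
      finally show "norm ((chi d * mangoldt d / of_nat d) * (Lsum (N div d) - L1)) \<le> \<dots>" .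
    qed
    also have "\<dots> = chebyshev_psi N * (2 * real Q / real N)" by (simp only: chebyshev_psi_def sum_distrib_right)
    also have "\<dots> \<le> (4 * real N) * (2 * real Q / real N)" by (intro mult_right_mono chebyshev_psi_le) auto
    also have "\<dots> = 8 * real Q" using False by simp
    finally show ?thesis unfolding eq using K[of N]
      by (intro order.trans[OF norm_triangle_ineq4] add_mono)
  qed
  thus ?thesis by blast
qed

text \<open>Summing \<open>moebius_mu d * ln (N / d)\<close> over the divisors of \<open>n\<close>
  gives \<open>mangoldt n\<close>, plus \<open>ln N\<close> for \<open>n = 1\<close>. If
  \<open>L1 = 0\<close>, the inner sums of this convolution are themselves \<open>O(d / N)\<close>,
  and the sum of \<open>ln (N / d)\<close> over \<open>d \<le> N\<close> is
  \<open>N * ln N - ln (fact N) \<le> N\<close>.\<close>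

lemma Lambda_sum_if_L1_eq_0:
  assumes L: "L1 = 0" and N: "N \<ge> 1"
  shows "norm (Lambda_sum N + of_real (ln (real N))) \<le> 2 * real Q"
proof -
  let ?g = "\<lambda>d. moebius_mu d * ln (real N / real d)"
  have "(\<Sum>n=1..N. \<Sum>d | d dvd n. (chi d * of_real (?g d) / of_nat d) * (chi (n div d) / of_nat (n div d)))
     = (\<Sum>n=1..N. chi n * mangoldt n / of_nat n + (if n = 1 then of_real (ln (real N)) else 0))"
  proof (intro sum.cong refl)
    fix n assume n: "n \<in> {1..N}"
    have "(\<Sum>d | d dvd n. (chi d * of_real (?g d) / of_nat d) * (chi (n div d) / of_nat (n div d)))
        = (\<Sum>d | d dvd n. chi n / of_nat n * of_real (?g d))"
      by (intro sum.cong refl) (auto simp: mult elim!: dvdE)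
    also have "\<dots> = chi n / of_nat n * of_real (\<Sum>d | d dvd n. ?g d)"
      by (simp add: sum_distrib_left)
    also have "(\<Sum>d | d dvd n. ?g d) = (\<Sum>d | d dvd n. moebius_mu d * ln (real N) - moebius_mu d * ln (real d))"
      using n N by (intro sum.cong refl) (auto simp: ln_div algebra_simps dest: dvd_imp_le intro!: Nat.gr0I)
    also have "\<dots> = ln (real N) * (\<Sum>d | d dvd n. moebius_mu d) + mangoldt n"
      using n sum_moebius_mu_ln[of n] by (simp add: sum_subtractf sum_distrib_left mult.commute)
    also have "(\<Sum>d | d dvd n. moebius_mu d) = (if n = 1 then 1 else 0)"
      using n by (intro sum_moebius_mu_divisors) auto
    finally show "(\<Sum>d | d dvd n. (chi d * of_real (?g d) / of_nat d) * (chi (n div d) / of_nat (n div d)))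
       = chi n * mangoldt n / of_nat n + (if n = 1 then of_real (ln (real N)) else 0)"
      by (simp add: algebra_simps)
  qed
  also have "\<dots> = Lambda_sum N + of_real (ln (real N))"
    using N by (simp add: sum.distrib Lambda_sum_def)
  finally have "Lambda_sum N + of_real (ln (real N))
     = (\<Sum>n=1..N. \<Sum>d | d dvd n. (chi d * of_real (?g d) / of_nat d) * (chi (n div d) / of_nat (n div d)))" ..
  also have "\<dots> = (\<Sum>d=1..N. \<Sum>e=1..N div d. (chi d * of_real (?g d) / of_nat d) * (chi e / of_nat e))"
    by (rule sum_divisors_eq_sum_multiples)
  also have "\<dots> = (\<Sum>d=1..N. (chi d * of_real (?g d) / of_nat d) * Lsum (N div d))"
    by (simp add: Lsum_def sum_distrib_left)
  also have "norm \<dots> \<le> (\<Sum>d=1..N. (ln (real N) - ln (real d)) * (2 * real Q / real N))"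
  proof (rule order.trans[OF norm_sum], intro sum_mono)
    fix d assume d: "d \<in> {1..N}"
    have ln: "ln (real N / real d) \<ge> 0" "ln (real N / real d) = ln (real N) - ln (real d)"
      using d by (auto simp: ln_div)
    have "norm ((chi d * of_real (?g d) / of_nat d) * Lsum (N div d))
      \<le> (1 * (1 * ln (real N / real d)) / real d) * (2 * real Q * real d / real N)"
      unfolding norm_mult norm_divide norm_of_nat norm_of_real abs_mult using d Lsum_div_error[OF d] L ln
      by (intro mult_mono divide_right_mono norm_le_1) (auto simp: abs_moebius_mu_le)
    also have "\<dots> = (ln (real N) - ln (real d)) * (2 * real Q / real N)" using d ln by simp
    finally show "norm ((chi d * of_real (?g d) / of_nat d) * Lsum (N div d)) \<le> \<dots>" .
  qed
  also have "\<dots> = (real N * ln (real N) - ln (fact N)) * (2 * real Q / real N)"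
  proof -
    have "ln (fact N :: real) = (\<Sum>d=1..N. ln (real d))"
      by (subst fact_prod, subst of_nat_prod, subst ln_prod) auto
    hence "real N * ln (real N) - ln (fact N) = (\<Sum>d=1..N. ln (real N) - ln (real d))"
      by (simp add: sum_subtractf)
    thus ?thesis by (simp only: sum_distrib_right)
  qed
  also have "\<dots> \<le> real N * (2 * real Q / real N)"
    using ln_fact_ge[of N] by (intro mult_right_mono) auto
  also have "\<dots> = 2 * real Q" using N by simp
  finally show ?thesis .
qed

text \<open>By Mertens' theorem \<open>Lambda_sum N\<close> is asymptotic to \<open>\<theta> * ln N\<close>, whereas it is bounded if
  \<open>L1\<close> is nonzero and asymptotic to \<open>- ln N\<close> otherwise.\<close>

lemma constant_on_primes:
  assumes E: "summable (\<lambda>p. if prime p \<and> p \<in> E then 1 / real p else 0)"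
    and th: "\<And>p. prime p \<Longrightarrow> p \<notin> E \<Longrightarrow> chi p = \<theta>" "norm \<theta> = 1"
  shows "\<theta> = -1 \<and> L1 = 0"
proof -
  obtain K where K: "K \<ge> 0" "\<And>N. (\<Sum>n\<in>{n\<in>{1..N}. \<not> prime n}. mangoldt n / real n) \<le> K"
    using nonprime_mangoldt_bounded by blast
  let ?a = "\<lambda>p. if prime p \<and> p \<in> E then 1 / real p else 0"
  define e where "e N = (\<Sum>n=1..N. ?a n * ln (real n))" for N
  \<comment> \<open>Replacing \<open>chi\<close> by \<open>\<theta>\<close> changes only the
    exceptional primes, collected in \<open>e N\<close>, and the proper prime powers, bounded by
    \<open>K\<close>; the \<open>4\<close> is Mertens' error.\<close>
  have bound: "norm (Lambda_sum N - \<theta> * of_real (ln (real N))) \<le> 2 * e N + (2 * K + 4)" if N: "N \<ge> 1" for N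
  proof -
    let ?M = "\<Sum>n=1..N. mangoldt n / real n :: real"
    have "norm (Lambda_sum N - \<theta> * of_real ?M) = norm (\<Sum>n=1..N. (chi n - \<theta>) * of_real (mangoldt n / real n))"
      unfolding Lambda_sum_def of_real_sum sum_distrib_left sum_subtractf[symmetric]
      by (intro arg_cong[of _ _ norm] sum.cong refl) (simp add: left_diff_distrib diff_divide_distrib)
    also have "\<dots> \<le> (\<Sum>n=1..N. 2 * (?a n * ln (real n)) + (if prime n then 0 else 2 * (mangoldt n / real n)))"
    proof (rule order.trans[OF norm_sum], intro sum_mono)
      fix n assume n: "n \<in> {1..N}"
      have le2: "norm (chi n - \<theta>) \<le> 2"
        using norm_triangle_ineq4[of "chi n" \<theta>] norm_le_1[of n] th(2) by linarith
      have nn: "mangoldt n / real n \<ge> (0::real)" by (simp add: mangoldt_nonneg)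
      have "norm ((chi n - \<theta>) * of_real (mangoldt n / real n)) = norm (chi n - \<theta>) * (mangoldt n / real n)"
        unfolding norm_mult norm_of_real using nn by simp
      also have "\<dots> \<le> 2 * (?a n * ln (real n)) + (if prime n then 0 else 2 * (mangoldt n / real n))"
      proof (cases "prime n \<and> n \<notin> E")
        case True
        thus ?thesis using th by simp
      next
        case False
        have "norm (chi n - \<theta>) * (mangoldt n / real n) \<le> 2 * (mangoldt n / real n)"
          using le2 nn by (rule mult_right_mono)
        thus ?thesis using False by (auto split: if_splits)
      qed
      finally show "norm ((chi n - \<theta>) * of_real (mangoldt n / real n)) \<le> \<dots>" .
    qed
    also have "\<dots> = 2 * e N + 2 * (\<Sum>n=1..N. if \<not> prime n then mangoldt n / real n else 0)"
      unfolding e_def sum.distrib sum_distrib_left by (intro arg_cong2[of _ _ _ _ "(+)"] sum.cong refl) auto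
    also have "(\<Sum>n=1..N. if \<not> prime n then mangoldt n / real n else 0) = (\<Sum>n\<in>{n\<in>{1..N}. \<not> prime n}. mangoldt n / real n)"
      by (rule sum.inter_filter[symmetric]) auto
    finally have 1: "norm (Lambda_sum N - \<theta> * of_real ?M) \<le> 2 * e N + 2 * K" using K(2)[of N] by linarith
    have "norm (\<theta> * of_real ?M - \<theta> * of_real (ln (real N))) = \<bar>?M - ln (real N)\<bar>"
      unfolding right_diff_distrib[symmetric] of_real_diff[symmetric] norm_mult norm_of_real th(2) by simp
    with mertens_mangoldt[OF N] have 2: "norm (\<theta> * of_real ?M - \<theta> * of_real (ln (real N))) \<le> 4" by simp
    show ?thesis using 1 2 norm_triangle_ineq[of "Lambda_sum N - \<theta> * of_real ?M" "\<theta> * of_real ?M - \<theta> * of_real (ln (real N))"]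
      by simp
  qed
  have e0: "(\<lambda>N. e N / ln (real N)) \<longlonglongrightarrow> 0"
    unfolding e_def by (rule summable_imp_ln_weighted_sum_small) (use E in auto)
  have lim: "(\<lambda>N. Lambda_sum N / of_real (ln (real N))) \<longlonglongrightarrow> \<theta>"
  proof (rule Lim_null[THEN iffD2], rule Lim_null_comparison)
    show "eventually (\<lambda>N. norm (Lambda_sum N / of_real (ln (real N)) - \<theta>) \<le> 2 * (e N / ln (real N)) + (2 * K + 4) / ln (real N)) sequentially"
      using eventually_ge_at_top[of 2]
    proof eventually_elim
      case (elim N)
      hence ln: "ln (real N) > 0" by simp
      have "Lambda_sum N / of_real (ln (real N)) - \<theta> = (Lambda_sum N - \<theta> * of_real (ln (real N))) / of_real (ln (real N))"
        using ln by (simp add: field_simps)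
      also have "norm \<dots> \<le> (2 * e N + (2 * K + 4)) / ln (real N)"
        using bound[of N] elim ln unfolding norm_divide norm_of_real by (auto intro!: divide_right_mono)
      finally show ?case by (simp add: add_divide_distrib)
    qed
    have "(\<lambda>N::nat. (2 * K + 4) / ln (real N)) \<longlonglongrightarrow> 0" by real_asymp
    from tendsto_add[OF tendsto_mult_left[OF e0, of 2] this]
    show "(\<lambda>N. 2 * (e N / ln (real N)) + (2 * K + 4) / ln (real N)) \<longlonglongrightarrow> 0" by simp
  qed
  have L: "L1 = 0"
  proof (rule ccontr)
    assume L: "L1 \<noteq> 0"
    obtain K' where K': "\<And>N. norm (L1 * Lambda_sum N) \<le> K'" using L1_times_Lambda_sum_bounded by blast
    have "(\<lambda>N. L1 * (Lambda_sum N / of_real (ln (real N)))) \<longlonglongrightarrow> 0"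
    proof (rule Lim_null_comparison)
      show "eventually (\<lambda>N. norm (L1 * (Lambda_sum N / of_real (ln (real N)))) \<le> K' / ln (real N)) sequentially"
        using eventually_ge_at_top[of 2]
      proof eventually_elim
        case (elim N)
        hence ln: "ln (real N) > 0" by simp
        have "norm (L1 * (Lambda_sum N / of_real (ln (real N)))) = norm (L1 * Lambda_sum N) / ln (real N)"
          using ln by (simp add: norm_mult norm_divide)
        also have "\<dots> \<le> K' / ln (real N)" using ln K' by (intro divide_right_mono) auto
        finally show ?case .
      qed
      show "(\<lambda>N. K' / ln (real N)) \<longlonglongrightarrow> 0" by real_asymp
    qed
    moreover have "(\<lambda>N. L1 * (Lambda_sum N / of_real (ln (real N)))) \<longlonglongrightarrow> L1 * \<theta>"
      by (intro tendsto_intros lim)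
    ultimately have "L1 * \<theta> = 0" using LIMSEQ_unique by blast
    with L th(2) show False by auto
  qed
  have "(\<lambda>N. Lambda_sum N / of_real (ln (real N))) \<longlonglongrightarrow> -1"
  proof (rule Lim_null[THEN iffD2], rule Lim_null_comparison)
    show "eventually (\<lambda>N. norm (Lambda_sum N / of_real (ln (real N)) - (- 1)) \<le> 2 * real Q / ln (real N)) sequentially"
      using eventually_ge_at_top[of 2]
    proof eventually_elim
      case (elim N)
      hence ln: "ln (real N) > 0" by simp
      have "Lambda_sum N / of_real (ln (real N)) - (-1) = (Lambda_sum N + of_real (ln (real N))) / of_real (ln (real N))"
        using ln by (simp add: field_simps)
      also have "norm \<dots> \<le> 2 * real Q / ln (real N)"
        using Lambda_sum_if_L1_eq_0[OF L, of N] elim ln unfolding norm_divide norm_of_real by (auto intro!: divide_right_mono)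
      finally show ?case .
    qed
    show "(\<lambda>N. 2 * real Q / ln (real N)) \<longlonglongrightarrow> 0" by real_asymp
  qed
  with lim have "\<theta> = -1" using LIMSEQ_unique by blast
  with L show ?thesis by simp
qed

end

text \<open>A divisor of \<open>p ^ Suc a * m\<close> either divides \<open>p ^ a * m\<close> or is
  \<open>p ^ Suc a\<close> times a divisor of \<open>m\<close>; both cannot happen.\<close>

lemma sum_divisors_prime_power_mult:
  fixes g :: "nat \<Rightarrow> real"
  assumes g: "\<And>m n. g (m * n) = g m * g n" and p: "prime p" "\<not> p dvd m" "m > 0"
  shows "(\<Sum>d | d dvd p ^ a * m. g d) = (\<Sum>i\<le>a. g p ^ i) * (\<Sum>d | d dvd m. g d)"
proof (induction a)
  case (Suc a)
  have gpow: "g (p ^ i * d) = g p ^ i * g d" for i d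
    by (induction i) (simp_all add: g mult.assoc)
  have p0: "p > 0" using p(1) prime_gt_0_nat by blast
  have eq: "{d. d dvd p ^ Suc a * m} = {d. d dvd p ^ a * m} \<union> (\<lambda>d. p ^ Suc a * d) ` {d. d dvd m}"
  proof (intro equalityI subsetI)
    fix d assume "d \<in> {d. d dvd p ^ Suc a * m}"
    then obtain b c where bc: "d = b * c" "b dvd p ^ Suc a" "c dvd m"
      using division_decomp[of d "p ^ Suc a" m] by auto
    then obtain i where i: "i \<le> Suc a" "b = p ^ i" using divides_primepow_nat[OF p(1)] by blast
    show "d \<in> {d. d dvd p ^ a * m} \<union> (\<lambda>d. p ^ Suc a * d) ` {d. d dvd m}"
    proof (cases "i = Suc a")
      case True
      thus ?thesis using bc i by auto
    next
      case False
      hence "b dvd p ^ a" using i by (auto intro: le_imp_power_dvd)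
      thus ?thesis using bc by (auto intro: mult_dvd_mono)
    qed
  next
    fix d assume "d \<in> {d. d dvd p ^ a * m} \<union> (\<lambda>d. p ^ Suc a * d) ` {d. d dvd m}"
    thus "d \<in> {d. d dvd p ^ Suc a * m}"
      by (auto intro: mult_dvd_mono dvd_mult simp: mult.assoc)
  qed
  have disj: "{d. d dvd p ^ a * m} \<inter> (\<lambda>d. p ^ Suc a * d) ` {d. d dvd m} = {}"
  proof -
    have False if "p ^ Suc a * e dvd p ^ a * m" for e
    proof -
      have "p ^ a * (p * e) dvd p ^ a * m" using that by (simp add: mult_ac)
      hence "p * e dvd m" using p0 by (simp only: nat_mult_dvd_cancel1 zero_less_power)
      thus False using p(2) by (auto dest: dvd_mult_left)
    qed
    thus ?thesis by blast
  qed
  have "(\<Sum>d | d dvd p ^ Suc a * m. g d) = (\<Sum>d | d dvd p ^ a * m. g d) + (\<Sum>d\<in>(\<lambda>d. p ^ Suc a * d) ` {d. d dvd m}. g d)"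
    unfolding eq by (rule sum.union_disjoint) (use disj p0 p(3) in auto)
  also have "(\<Sum>d\<in>(\<lambda>d. p ^ Suc a * d) ` {d. d dvd m}. g d) = (\<Sum>d | d dvd m. g (p ^ Suc a * d))"
    using p0 by (subst sum.reindex) (auto simp: inj_on_def)
  also have "\<dots> = g p ^ Suc a * (\<Sum>d | d dvd m. g d)"
    by (simp only: gpow sum_distrib_left)
  finally show ?case using Suc by (simp add: algebra_simps)
qed simp

text \<open>The sum is a product of local factors \<open>\<Sum>i\<le>a. g p ^ i\<close>. For
  \<open>g p\<close> equal to \<open>1\<close>, \<open>0\<close>, \<open>-1\<close> such a factor is
  \<open>a + 1\<close>, \<open>1\<close>, and \<open>1\<close> or \<open>0\<close> by the parity of
  \<open>a\<close>; in a square all exponents are even.\<close>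

lemma sum_divisors_real_character:
  fixes g :: "nat \<Rightarrow> real"
  assumes g: "\<And>m n. g (m * n) = g m * g n" "g 1 = 1" "\<And>n. g n \<in> {-1, 0, 1}"
  assumes n: "n > 0"
  shows "(\<Sum>d | d dvd n. g d) \<ge> 0 \<and> (is_square n \<longrightarrow> (\<Sum>d | d dvd n. g d) \<ge> 1)"
  using n
proof (induction n rule: less_induct)
  case (less n)
  show ?case
  proof (cases "n = 1")
    case True
    thus ?thesis using g by simp
  next
    case False
    then obtain p where p: "prime p" "p dvd n" using prime_factor_nat by blast
    define a where "a = multiplicity p n"
    obtain m where m: "n = p ^ a * m" "\<not> p dvd m"
      using multiplicity_decompose'[of n p] less.prems p(1) unfolding a_def
      by (metis not_prime_unit gr0_conv_Suc nat.simps(3))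
    have a0: "a > 0" using p less.prems m by (cases a) auto
    have m0: "m > 0" using m less.prems by (auto intro!: Nat.gr0I)
    have "1 < p ^ a" using p(1) a0 by (intro one_less_power prime_gt_1_nat)
    hence "m < n" using m m0 by simp
    with less.IH m0 have IH: "(\<Sum>d | d dvd m. g d) \<ge> 0" "is_square m \<Longrightarrow> (\<Sum>d | d dvd m. g d) \<ge> 1" by auto
    have eq: "(\<Sum>d | d dvd n. g d) = (\<Sum>i\<le>a. g p ^ i) * (\<Sum>d | d dvd m. g d)"
      unfolding m(1) by (rule sum_divisors_prime_power_mult) (use g p m m0 in auto)
    have s1: "(\<Sum>i\<le>a. (-1::real) ^ i) = (if even a then 1 else 0)" for a :: nat
      by (induction a) auto
    have s0: "(\<Sum>i\<le>a. (0::real) ^ i) = 1" for a :: nat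
      by (induction a) auto
    have geo: "(\<Sum>i\<le>a. g p ^ i) \<ge> 0" "even a \<Longrightarrow> (\<Sum>i\<le>a. g p ^ i) \<ge> 1"
      using g(3)[of p] by (auto simp: s1 s0)
    have "(\<Sum>d | d dvd n. g d) \<ge> 1" if sq: "is_square n"
    proof -
      have "is_square (p ^ a) \<and> is_square m"
      proof -
        have "coprime (p ^ a) m" using p(1) m(2) by (simp add: prime_imp_coprime)
        thus ?thesis using sq m(1) is_nth_power_mult_coprime_natD[of "p ^ a" m 2] m0 p(1) 
          by (auto simp: prime_gt_0_nat)
      qed
      moreover have "even a" if "is_square (p ^ a)"
        using that is_nth_power_prime_power_nat_iff[OF p(1), of 2 a] by (simp add: prime_imp_prime_elem)
      ultimately have "even a" "is_square m" by auto
      thus ?thesis unfolding eq using geo IH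
        by (metis mult_mono mult_1 zero_le_one order.trans)
    qed
    thus ?thesis unfolding eq using geo IH by auto
  qed
qed

text \<open>The difference decreases in \<open>m\<close>, with decrements at most those of
  \<open>1 / sqrt m\<close>, so it converges with that rate. The constant is the value of the zeta
  function at \<open>1/2\<close>.\<close>

lemma sum_inverse_sqrt_asymp:
  "\<exists>c. \<forall>m\<ge>1. \<bar>(\<Sum>n=1..m. 1 / sqrt (real n)) - 2 * sqrt (real m) - c\<bar> \<le> 1 / sqrt (real m)"
proof -
  define u where "u m = (\<Sum>n=1..m. 1 / sqrt (real n)) - 2 * sqrt (real m)" for m
  have step: "u (Suc m) \<le> u m \<and> u m - u (Suc m) \<le> 1 / sqrt (real m) - 1 / sqrt (real (Suc m))" if "m \<ge> 1" for m
  proof -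
    define s t where "s = sqrt (real m)" and "t = sqrt (real (Suc m))"
    have st: "0 < s" "s < t" "t\<^sup>2 = s\<^sup>2 + 1" using that by (auto simp: s_def t_def)
    have diff: "(t - s) * (t + s) = 1" using st(3) by (simp add: algebra_simps power2_eq_square)
    hence d: "t - s = 1 / (t + s)" using st by (simp add: field_simps)
    have u: "u m - u (Suc m) = 2 * (t - s) - 1 / t" unfolding u_def s_def t_def by simp
    have "1 / t \<le> 2 / (t + s)" using st by (simp add: field_simps)
    moreover have "2 / (t + s) \<le> 2 / (2 * s)" using st by (intro divide_left_mono) auto
    ultimately show ?thesis using u d unfolding s_def[symmetric] t_def[symmetric] by simp
  qed
  have "norm (u N - u M) \<le> 1 / sqrt (real M)" if "1 \<le> M" "M \<le> N" for M N
  proof -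
    have "u N \<le> u M \<and> u M - u N \<le> 1 / sqrt (real M) - 1 / sqrt (real N)"
      using that(2)
    proof (induction N rule: dec_induct)
      case (step n)
      thus ?case using that(1) \<open>\<And>m. 1 \<le> m \<Longrightarrow> u (Suc m) \<le> u m \<and> _ m\<close>[of n] by auto
    qed simp
    moreover have "1 / sqrt (real N) \<ge> 0" by simp
    ultimately show ?thesis unfolding real_norm_def by linarith
  qed
  moreover have "(\<lambda>M. 1 / sqrt (real M)) \<longlonglongrightarrow> 0" by real_asymp
  ultimately obtain c where "\<forall>m\<ge>1. norm (u m - c) \<le> 1 / sqrt (real m)"
    using tail_bound_imp_limit[of 1 u "\<lambda>M. 1 / sqrt (real M)"] by auto
  thus ?thesis unfolding u_def real_norm_def by blast
qed

section \<open>Nonvanishing at \<open>1\<close> for real characters\<close>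

context nonprincipal_char
begin

text \<open>The divisor sums \<open>r n\<close> of the character are nonnegative and at least
  \<open>1\<close> on squares, so \<open>r n / sqrt n\<close> summed up to \<open>M^2\<close> is at
  least the harmonic sum up to \<open>M\<close>. The hyperbola method evaluates the same sum as
  \<open>2 * M * L1 + O(1)\<close>, which stays bounded if \<open>L1 = 0\<close>.\<close>

theorem L1_nonzero_if_real:
  assumes real: "\<And>n. chi n \<in> {-1, 0, 1}"
  shows "L1 \<noteq> 0"
proof
  assume L: "L1 = 0"
  define g where "g n = Re (chi n)" for n
  have chi_g: "chi n = of_real (g n)" for n using real[of n] by (auto simp: g_def)
  have g: "g (m * n) = g m * g n" "g 1 = 1" "g n \<in> {-1, 0, 1}" for m n
    using mult[of m n] real[of m] real[of n] by (auto simp: g_def)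
  define r where "r n = (\<Sum>d | d dvd n. g d)" for n
  have r: "r n \<ge> 0" "is_square n \<Longrightarrow> r n \<ge> 1" if "n > 0" for n
    using sum_divisors_real_character[of g, OF g that] unfolding r_def by auto
  obtain c where c: "\<And>m. m \<ge> 1 \<Longrightarrow> \<bar>(\<Sum>n=1..m. 1 / sqrt (real n)) - 2 * sqrt (real m) - c\<bar> \<le> 1 / sqrt (real m)"
    using sum_inverse_sqrt_asymp by blast
  define G where "G m = (\<Sum>n=1..m. 1 / sqrt (real n))" for m :: nat
  have tail: "\<bar>\<Sum>d\<in>{M<..N}. g d / sqrt (real d)\<bar> \<le> 2 * real Q / sqrt (real (Suc M))" for M N
  proof -
    have "norm (\<Sum>d\<in>{M<..N}. of_real (1 / sqrt (real d)) * chi d) \<le> 2 * real Q * (1 / sqrt (real (Suc M)))"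
      by (rule norm_weighted_sum_le) (auto intro!: divide_left_mono)
    also have "(\<Sum>d\<in>{M<..N}. of_real (1 / sqrt (real d)) * chi d) = of_real (\<Sum>d\<in>{M<..N}. g d / sqrt (real d))"
      by (simp add: chi_g)
    finally show ?thesis by (simp only: norm_of_real) simp
  qed
  have bound: "ln (real (Suc M)) \<le> 12 * real Q + \<bar>c\<bar> * (2 * real Q) + 4" if M: "M \<ge> 1" for M
  proof -
    \<comment> \<open>With \<open>N\<close> a square the hyperbola \<open>d * e \<le> N\<close> is
      cut at \<open>d = M\<close>, and beyond the cut necessarily \<open>e \<le> M\<close>.\<close>
    define N where "N = M * M"
    have sqN: "sqrt (real N) = real M" by (simp add: N_def)
    have MN: "M \<le> N" using M by (simp add: N_def)
    have "ln (real (Suc M)) \<le> harm M" using ln_le_harm[of M] by (simp add: add_ac)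
    also have "\<dots> = (\<Sum>k=1..M. 1 / sqrt (real (k^2)))" by (simp add: harm_def divide_inverse)
    also have "\<dots> = (\<Sum>n\<in>(\<lambda>k. k^2)`{1..M}. 1 / sqrt (real n))"
      by (subst sum.reindex) (auto simp: inj_on_def)
    also have "\<dots> \<le> (\<Sum>n\<in>(\<lambda>k. k^2)`{1..M}. r n / sqrt (real n))"
      by (intro sum_mono divide_right_mono r) (auto simp: is_nth_power_def)
    also have "\<dots> \<le> (\<Sum>n\<in>{1..N}. r n / sqrt (real n))"
      by (intro sum_mono2) (auto simp: N_def power2_eq_square intro!: divide_nonneg_nonneg r mult_le_mono)
    also have "\<dots> = (\<Sum>n=1..N. \<Sum>d | d dvd n. (g d / sqrt (real d)) * (1 / sqrt (real (n div d))))"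
    proof (intro sum.cong refl)
      fix n assume n: "n \<in> {1..N}"
      have "r n / sqrt (real n) = (\<Sum>d | d dvd n. g d / sqrt (real n))"
        by (simp add: r_def sum_divide_distrib)
      also have "\<dots> = (\<Sum>d | d dvd n. (g d / sqrt (real d)) * (1 / sqrt (real (n div d))))"
        using n by (intro sum.cong refl) (auto simp: real_sqrt_mult elim!: dvdE)
      finally show "r n / sqrt (real n) = \<dots>" .
    qed
    also have "\<dots> = (\<Sum>d=1..N. \<Sum>e=1..N div d. (g d / sqrt (real d)) * (1 / sqrt (real e)))"
      by (rule sum_divisors_eq_sum_multiples)
    also have "\<dots> = (\<Sum>d\<in>{1..M} \<union> {M<..N}. \<Sum>e=1..N div d. (g d / sqrt (real d)) * (1 / sqrt (real e)))"
      by (rule sum.cong) (use MN in auto)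
    also have "\<dots> = (\<Sum>d\<in>{1..M}. \<Sum>e=1..N div d. (g d / sqrt (real d)) * (1 / sqrt (real e)))
                 + (\<Sum>d\<in>{M<..N}. \<Sum>e=1..N div d. (g d / sqrt (real d)) * (1 / sqrt (real e)))"
      by (rule sum.union_disjoint) auto
    finally have main: "ln (real (Suc M)) \<le> (\<Sum>d\<in>{1..M}. \<Sum>e=1..N div d. (g d / sqrt (real d)) * (1 / sqrt (real e))) + (\<Sum>d\<in>{M<..N}. \<Sum>e=1..N div d. (g d / sqrt (real d)) * (1 / sqrt (real e)))" .
    \<comment> \<open>Here \<open>e\<close> becomes the outer variable: the character sum over
      \<open>d > M\<close> is \<open>O(1 / sqrt M)\<close>, and the sum of \<open>1 / sqrt e\<close>
      over \<open>e \<le> M\<close> is at most \<open>2 * sqrt M\<close>.\<close>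
    have S2: "(\<Sum>d\<in>{M<..N}. \<Sum>e=1..N div d. (g d / sqrt (real d)) * (1 / sqrt (real e))) \<le> 4 * real Q"
    proof -
      have "(\<Sum>d\<in>{M<..N}. \<Sum>e=1..N div d. (g d / sqrt (real d)) * (1 / sqrt (real e)))
          = (\<Sum>d\<in>{M<..N}. \<Sum>e | e \<in> {1..M} \<and> d \<le> N div e. (g d / sqrt (real d)) * (1 / sqrt (real e)))"
      proof (intro sum.cong refl)
        fix d assume d: "d \<in> {M<..N}"
        have "e \<le> M" if "e * d \<le> N" for e
        proof (rule ccontr)
          assume "\<not> e \<le> M"
          hence "M * M < e * d" using d by (intro mult_strict_mono) auto
          thus False using that N_def by simp
        qed
        thus "{1..N div d} = {e \<in> {1..M}. d \<le> N div e}"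
          using d by (auto simp: less_eq_div_iff_mult_less_eq mult.commute)
      qed
      also have "\<dots> = (\<Sum>e\<in>{1..M}. \<Sum>d | d \<in> {M<..N} \<and> d \<le> N div e. (g d / sqrt (real d)) * (1 / sqrt (real e)))"
        by (rule sum.swap_restrict) auto
      also have "\<dots> = (\<Sum>e\<in>{1..M}. (1 / sqrt (real e)) * (\<Sum>d\<in>{M<..N div e}. g d / sqrt (real d)))"
      proof (intro sum.cong refl)
        fix e assume "e \<in> {1..M}"
        have "N div e \<le> N" by simp
        hence "{d \<in> {M<..N}. d \<le> N div e} = {M<..N div e}" using le_trans[of _ "N div e" N] by auto
        thus "(\<Sum>d | d \<in> {M<..N} \<and> d \<le> N div e. (g d / sqrt (real d)) * (1 / sqrt (real e)))
           = (1 / sqrt (real e)) * (\<Sum>d\<in>{M<..N div e}. g d / sqrt (real d))"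
          by (simp only: sum_distrib_left mult.commute)
      qed
      also have "\<dots> \<le> (\<Sum>e\<in>{1..M}. (1 / sqrt (real e)) * (2 * real Q / sqrt (real M)))"
      proof (intro sum_mono mult_left_mono)
        fix e
        have "2 * real Q / sqrt (real (Suc M)) \<le> 2 * real Q / sqrt (real M)"
          using M by (intro divide_left_mono) auto
        thus "(\<Sum>d\<in>{M<..N div e}. g d / sqrt (real d)) \<le> 2 * real Q / sqrt (real M)"
          using tail[of M "N div e"] by linarith
      qed auto
      also have "\<dots> = G M * (2 * real Q / sqrt (real M))" unfolding G_def by (simp only: sum_distrib_right)
      also have "G M \<le> 2 * sqrt (real M)"
        unfolding G_def
      proof (induction M)
        case (Suc M)
        have "1 / sqrt (real (Suc M)) \<le> 2 * (sqrt (real (Suc M)) - sqrt (real M))"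
        proof -
          define s t where "s = sqrt (real M)" and "t = sqrt (real (Suc M))"
          have st: "0 \<le> s" "s < t" "t\<^sup>2 = s\<^sup>2 + 1" by (auto simp: s_def t_def)
          have "(t - s) * (t + s) = 1" using st(3) by (simp add: algebra_simps power2_eq_square)
          hence "t - s = 1 / (t + s)" using st by (simp add: field_simps)
          moreover have "1 / t \<le> 2 * (1 / (t + s))" using st by (simp add: field_simps)
          ultimately show ?thesis unfolding s_def t_def by simp
        qed
        thus ?case using Suc by simp
      qed simp
      hence "G M * (2 * real Q / sqrt (real M)) \<le> (2 * sqrt (real M)) * (2 * real Q / sqrt (real M))"
        by (intro mult_right_mono) auto
      also have "\<dots> = 4 * real Q" using M by simp
      finally show ?thesis by simp
    qed
    \<comment> \<open>The inner sum is \<open>2 * M / sqrt d + c\<close> with error at most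
      \<open>4 * sqrt d / M\<close>; after weighting by \<open>1 / sqrt d\<close> the errors of the
      \<open>M\<close> terms add up to \<open>4\<close>.\<close>
    have S1: "(\<Sum>d\<in>{1..M}. \<Sum>e=1..N div d. (g d / sqrt (real d)) * (1 / sqrt (real e)))
        \<le> 2 * real M * (\<Sum>d\<in>{1..M}. g d / real d) + c * (\<Sum>d\<in>{1..M}. g d / sqrt (real d)) + 4"
    proof -
      have "(\<Sum>d\<in>{1..M}. \<Sum>e=1..N div d. (g d / sqrt (real d)) * (1 / sqrt (real e)))
          = (\<Sum>d\<in>{1..M}. (g d / sqrt (real d)) * G (N div d))"
        unfolding G_def by (simp only: sum_distrib_left)
      also have "\<dots> \<le> (\<Sum>d\<in>{1..M}. 2 * real M * (g d / real d) + c * (g d / sqrt (real d)) + 4 / real M)"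
      proof (rule sum_mono)
        fix d assume d: "d \<in> {1..M}"
        define x where "x = real N / real d"
        define m where "m = N div d"
        have m1: "m \<ge> 1" using d MN by (auto simp: m_def less_eq_div_iff_mult_less_eq)
        have mx: "real m \<le> x" "x \<le> real m + 1"
          unfolding m_def x_def using nat_div_le_real_div[of N d] real_div_le_nat_div[of N d] by auto
        define s t where "s = sqrt (real m)" and "t = sqrt x"
        have x1: "x \<ge> 1" using mx m1 by linarith
        have st: "1 \<le> s" "s \<le> t" "t\<^sup>2 \<le> s\<^sup>2 + 1" using mx m1 x1 by (auto simp: s_def t_def)
        have "(t - s) * (t + s) \<le> 1" using st(3) by (simp add: algebra_simps power2_eq_square)
        hence "t - s \<le> 1 / (t + s)" using st by (simp add: field_simps)
        also have "1 / (t + s) \<le> 1 / t" using st by (intro divide_left_mono) auto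
        finally have ts: "t - s \<le> 1 / t" .
        have "t \<le> 2 * s"
        proof -
          have "t\<^sup>2 \<le> (2 * s)\<^sup>2" using st(3) one_le_power[OF st(1), of 2] by simp
          thus ?thesis by (rule power2_le_imp_le) (use st in auto)
        qed
        hence "1 / s \<le> 2 / t" using st by (simp add: field_simps)
        hence "\<bar>G m - 2 * t - c\<bar> \<le> 4 / t"
          using c[OF m1] ts st(2) unfolding G_def[symmetric] s_def[symmetric] by (simp add: abs_le_iff)
        moreover have "1 / t = sqrt (real d) / real M"
          unfolding t_def x_def real_sqrt_divide sqN by simp
        ultimately have G: "\<bar>G m - 2 * t - c\<bar> \<le> 4 * sqrt (real d) / real M" by simp
        have t: "t = real M / sqrt (real d)" unfolding t_def x_def real_sqrt_divide sqN by simp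
        have d0: "sqrt (real d) > 0" using d by simp
        have "\<bar>g d / sqrt (real d)\<bar> \<le> 1 / sqrt (real d)"
          using g(3)[of d] d0 by (auto simp: abs_divide)
        hence "\<bar>(g d / sqrt (real d)) * (G m - 2 * t - c)\<bar> \<le> (1 / sqrt (real d)) * (4 * sqrt (real d) / real M)"
          unfolding abs_mult using G by (intro mult_mono) auto
        also have "\<dots> = 4 / real M" using d0 by simp
        finally have "(g d / sqrt (real d)) * (G m - 2 * t - c) \<le> 4 / real M" by linarith
        moreover have "(g d / sqrt (real d)) * (2 * t) = 2 * real M * (g d / real d)"
          using d0 unfolding t by (simp add: field_simps)
        ultimately show "(g d / sqrt (real d)) * G (N div d) \<le> 2 * real M * (g d / real d) + c * (g d / sqrt (real d)) + 4 / real M"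
          unfolding m_def by (simp add: right_diff_distrib mult.commute)
      qed
      also have "\<dots> = 2 * real M * (\<Sum>d\<in>{1..M}. g d / real d) + c * (\<Sum>d\<in>{1..M}. g d / sqrt (real d)) + 4"
        using M by (simp only: sum.distrib sum_distrib_left) simp
      finally show ?thesis .
    qed
    have "(\<Sum>d\<in>{1..M}. g d / real d) \<le> 2 * real Q / real M"
    proof -
      have "\<bar>\<Sum>d\<in>{1..M}. g d / real d\<bar> = norm (Lsum M)"
      proof -
        have "Lsum M = of_real (\<Sum>d\<in>{1..M}. g d / real d)" by (simp add: Lsum_def chi_g)
        thus ?thesis by (simp only: norm_of_real)
      qed
      also have "\<dots> \<le> 2 * real Q / real (Suc M)" using Lsum_error[of M] L by simp
      also have "\<dots> \<le> 2 * real Q / real M" using M by (intro divide_left_mono) auto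
      finally show ?thesis by linarith
    qed
    hence "2 * real M * (\<Sum>d\<in>{1..M}. g d / real d) \<le> 2 * real M * (2 * real Q / real M)"
      by (intro mult_left_mono) auto
    also have "\<dots> = 4 * real Q" using M by simp
    finally have a: "2 * real M * (\<Sum>d\<in>{1..M}. g d / real d) \<le> 4 * real Q" .
    have "{0<..M} = {1..M}" by auto
    hence "\<bar>c * (\<Sum>d\<in>{1..M}. g d / sqrt (real d))\<bar> \<le> \<bar>c\<bar> * (2 * real Q)"
      unfolding abs_mult using tail[of 0 M] by (intro mult_left_mono) auto
    hence b: "c * (\<Sum>d\<in>{1..M}. g d / sqrt (real d)) \<le> \<bar>c\<bar> * (2 * real Q)" by linarith
    have "real Q \<ge> 0" by simp
    thus ?thesis using main S1 S2 a b by linarith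
  qed
  have "filterlim (\<lambda>M. ln (real (Suc M))) at_top sequentially" by real_asymp
  hence "eventually (\<lambda>M. ln (real (Suc M)) > 12 * real Q + \<bar>c\<bar> * (2 * real Q) + 4) sequentially"
    by (simp add: filterlim_at_top_dense)
  hence "eventually (\<lambda>M. ln (real (Suc M)) > 12 * real Q + \<bar>c\<bar> * (2 * real Q) + 4 \<and> M \<ge> 1) sequentially"
    using eventually_ge_at_top[of 1] by eventually_elim auto
  then obtain M where "ln (real (Suc M)) > 12 * real Q + \<bar>c\<bar> * (2 * real Q) + 4" "M \<ge> 1"
    using eventually_happens by force
  thus False using bound[of M] by linarith
qed

end

section \<open>Cosets containing almost all primes\<close>

text \<open>Subgroups of the unit group modulo \<open>Q\<close>, given by their least
  representatives. Inverses come from finiteness, see \<open>subgroup_cancel\<close>. The neutral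
  element is written \<open>1 mod Q\<close> because it is \<open>0\<close> for
  \<open>Q = 1\<close>.\<close>

definition residue_subgroup :: "nat \<Rightarrow> nat set \<Rightarrow> bool" where
  "residue_subgroup Q M \<longleftrightarrow> M \<subseteq> {n. n < Q \<and> coprime n Q} \<and> 1 mod Q \<in> M \<and> (\<forall>a\<in>M. \<forall>b\<in>M. a * b mod Q \<in> M)"

context
  fixes Q :: nat and M :: "nat set"
  assumes Q: "Q > 0" and M: "residue_subgroup Q M"
begin

lemma subgroup_coprime: "a mod Q \<in> M \<Longrightarrow> coprime a Q"
  using M Q by (auto simp: residue_subgroup_def coprime_mod_left_iff)

lemma subgroup_mult: "a mod Q \<in> M \<Longrightarrow> b mod Q \<in> M \<Longrightarrow> a * b mod Q \<in> M"
  using M by (metis mod_mult_eq residue_subgroup_def)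

lemma subgroup_power: "a mod Q \<in> M \<Longrightarrow> a ^ k mod Q \<in> M"
proof (induction k)
  case 0
  thus ?case using M by (simp add: residue_subgroup_def)
next
  case (Suc k)
  thus ?case using subgroup_mult[of a "a ^ k"] by simp
qed

text \<open>By Euler's theorem \<open>a ^ (totient Q - 1)\<close> is an inverse of \<open>a\<close>
  modulo \<open>Q\<close>, and it is a power of \<open>a\<close>.\<close>

lemma subgroup_cancel:
  assumes "a mod Q \<in> M" "a * b mod Q \<in> M"
  shows "b mod Q \<in> M"
proof -
  have t: "totient Q > 0" using Q by simp
  have "a ^ (totient Q - 1) * (a * b) = a ^ totient Q * b"
    using t by (metis Suc_diff_1 mult.assoc power_Suc2)
  moreover have "[a ^ totient Q * b = 1 * b] (mod Q)"
    using euler_theorem[OF subgroup_coprime[OF assms(1)]] by (rule cong_scalar_right)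
  moreover have "a ^ (totient Q - 1) * (a * b) mod Q \<in> M"
    by (intro subgroup_mult subgroup_power assms)
  ultimately show ?thesis unfolding cong_def by (metis mult_1)
qed

text \<open>If \<open>l\<close> is the order of \<open>x\<close> modulo \<open>M\<close> and
  \<open>w\<close> a primitive \<open>l\<close>-th root of unity, the character sends
  \<open>x ^ i * m\<close> to \<open>w ^ i\<close>. Two such representations have exponents that
  differ by a multiple of \<open>l\<close>; and \<open>l \<noteq> 1\<close> since \<open>x\<close>
  lies outside \<open>M\<close>.\<close>

lemma character_of_cyclic_quotient:
  assumes x: "coprime x Q" "x mod Q \<notin> M"
    and gen: "\<And>n. coprime n Q \<Longrightarrow> \<exists>i m. m mod Q \<in> M \<and> [n = x ^ i * m] (mod Q)"
  shows "\<exists>chi. dirichlet_char Q chi \<and> (\<forall>n. n mod Q \<in> M \<longrightarrow> chi n = 1) \<and> chi x \<noteq> 1"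
proof -
  have one: "1 mod Q \<in> M" using M by (simp add: residue_subgroup_def)
  define l where "l = (LEAST l. l > 0 \<and> x ^ l mod Q \<in> M)"
  have "totient Q > 0 \<and> x ^ totient Q mod Q \<in> M"
    using euler_theorem[OF x(1)] one Q by (simp add: cong_def)
  hence l: "l > 0" "x ^ l mod Q \<in> M" unfolding l_def by (metis (mono_tags, lifting) LeastI)+
  have ldvd: "l dvd i" if "x ^ i mod Q \<in> M" for i
  proof -
    have "x ^ i = (x ^ l) ^ (i div l) * x ^ (i mod l)"
      by (simp flip: power_mult power_add)
    hence "x ^ (i mod l) mod Q \<in> M"
      using that subgroup_cancel[OF subgroup_power[OF l(2), of "i div l"]] by simp
    moreover have "i mod l < l" using l by simp
    ultimately have "i mod l = 0" using not_less_Least[of "i mod l" "\<lambda>l. l > 0 \<and> x ^ l mod Q \<in> M"]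
      unfolding l_def by (meson neq0_conv)
    thus ?thesis by blast
  qed
  have l1: "\<not> l dvd 1" using x(2) l by auto
  define w where "w = exp (2 * of_real pi * \<i> * of_nat 1 / of_nat l)"
  have w: "w ^ l = 1" "w \<noteq> 1"
    using complex_root_unity[of l 1] complex_root_unity_eq_1[of l 1] l l1 unfolding w_def by auto
  have "norm w ^ l = 1 ^ l" using w(1) by (metis norm_one norm_power power_one)
  hence normw: "norm w = 1" using l by (intro power_eq_imp_eq_base[of "norm w" l 1]) auto
  have well_le: "w ^ i = w ^ j" if "i \<le> j" "m mod Q \<in> M" "m' mod Q \<in> M" "[x ^ i * m = x ^ j * m'] (mod Q)" for i j m m'
  proof -
    have "x ^ j = x ^ i * x ^ (j - i)" using that(1) by (simp flip: power_add)
    hence "[x ^ i * m = x ^ i * (x ^ (j - i) * m')] (mod Q)" using that(4) by (simp add: mult.assoc)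
    hence "[m = x ^ (j - i) * m'] (mod Q)"
      using x(1) by (subst (asm) cong_mult_lcancel_nat) auto
    hence "m' * x ^ (j - i) mod Q \<in> M" using that(2) by (simp add: cong_def mult.commute)
    hence "l dvd j - i" using subgroup_cancel[OF that(3)] ldvd by blast
    then obtain k where "j - i = l * k" by (elim dvdE)
    hence "j = i + l * k" using that(1) by simp
    thus ?thesis using w by (simp add: power_add power_mult)
  qed
  have well: "w ^ i = w ^ j" if "m mod Q \<in> M" "m' mod Q \<in> M" "[n = x ^ i * m] (mod Q)" "[n = x ^ j * m'] (mod Q)" for i j m m' n
  proof -
    have "[x ^ i * m = x ^ j * m'] (mod Q)" "[x ^ j * m' = x ^ i * m] (mod Q)"
      using that by (auto simp: cong_def)
    thus ?thesis
      using well_le[OF _ that(1,2), of i j] well_le[OF _ that(2,1), of j i] by (metis nat_le_linear)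
  qed
  \<comment> \<open>The exponent is determined only modulo \<open>l\<close>, which is all that
    \<open>w ^ i\<close> sees; \<open>rep\<close> shows that the choice is immaterial.\<close>
  define chi where "chi n = (if coprime n Q then w ^ (SOME i. \<exists>m. m mod Q \<in> M \<and> [n = x ^ i * m] (mod Q)) else 0)" for n
  have rep: "chi n = w ^ i" if "m mod Q \<in> M" "[n = x ^ i * m] (mod Q)" for n i m
  proof -
    have cop: "coprime n Q"
    proof -
      have "coprime (x ^ i * m) Q" using x(1) subgroup_coprime[OF that(1)] by simp
      thus ?thesis using that(2) by (metis cong_imp_coprime cong_sym)
    qed
    have "\<exists>m'. m' mod Q \<in> M \<and> [n = x ^ (SOME i. \<exists>m. m mod Q \<in> M \<and> [n = x ^ i * m] (mod Q)) * m'] (mod Q)"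
      using that by (intro someI_ex[of "\<lambda>i. \<exists>m'. m' mod Q \<in> M \<and> [n = x ^ i * m'] (mod Q)"]) blast
    then obtain m' where m': "m' mod Q \<in> M"
      "[n = x ^ (SOME i. \<exists>m. m mod Q \<in> M \<and> [n = x ^ i * m] (mod Q)) * m'] (mod Q)" by blast
    show ?thesis unfolding chi_def using cop well[OF m'(1) that(1) m'(2) that(2)] by (simp only: if_True)
  qed
  have "dirichlet_char Q chi"
  proof
    show "Q > 0" by (rule Q)
    show "chi n = 0" if "\<not> coprime n Q" for n using that by (simp add: chi_def)
    show "norm (chi n) = 1" if "coprime n Q" for n using that normw by (simp add: chi_def norm_power)
    show "chi (n + Q) = chi n" for n
    proof -
      have "coprime (n + Q) Q \<longleftrightarrow> coprime n Q"
        using coprime_mod_left_iff[of Q "n + Q"] coprime_mod_left_iff[of Q n] Q by simp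
      thus ?thesis by (simp add: chi_def cong_def)
    qed
    show "chi (m * n) = chi m * chi n" for m n
    proof (cases "coprime m Q \<and> coprime n Q")
      case True
      then obtain i a j b where ij: "a mod Q \<in> M" "[m = x ^ i * a] (mod Q)" "b mod Q \<in> M" "[n = x ^ j * b] (mod Q)"
        using gen by meson
      have "[m * n = (x ^ i * a) * (x ^ j * b)] (mod Q)" using ij by (intro cong_mult)
      hence "[m * n = x ^ (i + j) * (a * b)] (mod Q)" by (simp add: power_add mult_ac)
      hence "chi (m * n) = w ^ (i + j)" using ij subgroup_mult by (intro rep[of "a * b"]) auto
      thus ?thesis using rep[OF ij(1,2)] rep[OF ij(3,4)] by (simp add: power_add)
    qed (auto simp: chi_def)
  qed
  moreover have "chi n = 1" if "n mod Q \<in> M" for n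
    using rep[OF that, of n 0] by simp
  moreover have "chi x = w" using rep[OF one, of x 1] by simp
  ultimately show ?thesis using w by auto
qed

end

text \<open>Otherwise enlarge \<open>H\<close> to a maximal proper subgroup. The quotient is cyclic, so it has a
  nontrivial character; this character is constant on almost all primes, hence equal to \<open>-1\<close> there.
  Its square must then be principal, so it is real, which contradicts \<open>L1_nonzero_if_real\<close>.\<close>

lemma coset_of_almost_all_primes_trivial:
  assumes Q: "Q > 0" and H: "residue_subgroup Q H" and c: "coprime c Q"
    and E: "summable (\<lambda>p. if prime p \<and> p \<in> E then 1 / real p else 0)"
    and p: "\<And>p. prime p \<Longrightarrow> p \<notin> E \<Longrightarrow> \<exists>h. h mod Q \<in> H \<and> [p = c * h] (mod Q)"
  shows "c mod Q \<in> H"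
proof (rule ccontr)
  assume cH: "c mod Q \<notin> H"
  define U where "U = {n. n < Q \<and> coprime n Q}"
  define F where "F = {M. residue_subgroup Q M \<and> H \<subseteq> M \<and> M \<noteq> U}"
  have "F \<subseteq> Pow {..<Q}" by (auto simp: F_def residue_subgroup_def)
  hence "finite F" by (rule finite_subset) auto
  moreover have "H \<in> F"
    using H cH c Q by (auto simp: F_def U_def coprime_mod_left_iff)
  ultimately obtain M where M: "M \<in> F" "\<And>M'. M' \<in> F \<Longrightarrow> M \<subseteq> M' \<Longrightarrow> M = M'"
    using finite_has_maximal2[of F H] by auto
  have sM: "residue_subgroup Q M" and HM: "H \<subseteq> M" and MU: "M \<noteq> U" using M by (auto simp: F_def)
  have "M \<subseteq> U" using sM by (auto simp: residue_subgroup_def U_def)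
  then obtain x where x: "x \<in> U" "x \<notin> M" using MU by auto
  have xQ: "coprime x Q" "x mod Q = x" using x by (auto simp: U_def)
  \<comment> \<open>The subgroup generated by \<open>M\<close> and \<open>x\<close>. By maximality
    it is the whole unit group, so the quotient by \<open>M\<close> is cyclic.\<close>
  define M' where "M' = {n\<in>U. \<exists>i m. m mod Q \<in> M \<and> [n = x ^ i * m] (mod Q)}"
  have one: "1 mod Q \<in> M" using sM by (simp add: residue_subgroup_def)
  have MM': "M \<subseteq> M'"
  proof
    fix m assume m: "m \<in> M"
    hence "m mod Q \<in> M \<and> [m = x ^ 0 * m] (mod Q)" using \<open>M \<subseteq> U\<close> by (auto simp: U_def)
    thus "m \<in> M'" unfolding M'_def using m \<open>M \<subseteq> U\<close> by blast
  qed
  have "1 mod Q \<in> M \<and> [x = x ^ 1 * 1] (mod Q)" using one by simp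
  hence xM': "x \<in> M'" unfolding M'_def using x(1) by blast
  have "residue_subgroup Q M'"
    unfolding residue_subgroup_def
  proof (intro conjI ballI)
    show "M' \<subseteq> {n. n < Q \<and> coprime n Q}" by (auto simp: M'_def U_def)
    show "1 mod Q \<in> M'" using one MM' by blast
    fix a b assume ab: "a \<in> M'" "b \<in> M'"
    obtain i m j n where ij: "m mod Q \<in> M" "[a = x ^ i * m] (mod Q)" "n mod Q \<in> M" "[b = x ^ j * n] (mod Q)"
      using ab unfolding M'_def by blast
    have "[a * b = (x ^ i * m) * (x ^ j * n)] (mod Q)" using ij by (intro cong_mult)
    hence "[a * b mod Q = x ^ (i + j) * (m * n)] (mod Q)" by (simp add: power_add mult_ac)
    moreover have "m * n mod Q \<in> M" using subgroup_mult[OF Q sM] ij by blast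
    moreover have "a * b mod Q \<in> U" using ab Q by (auto simp: M'_def U_def coprime_mod_left_iff)
    ultimately show "a * b mod Q \<in> M'" unfolding M'_def by blast
  qed
  hence "M' = U" using M(2)[of M'] MM' xM' x(2) HM by (auto simp: F_def)
  have gen: "\<exists>i m. m mod Q \<in> M \<and> [n = x ^ i * m] (mod Q)" if "coprime n Q" for n
  proof -
    have "n mod Q \<in> M'" using that Q unfolding \<open>M' = U\<close> by (auto simp: U_def coprime_mod_left_iff)
    thus ?thesis unfolding M'_def by (auto simp: cong_def)
  qed
  obtain chi where chi: "dirichlet_char Q chi" "\<And>n. n mod Q \<in> M \<Longrightarrow> chi n = 1" "chi x \<noteq> 1"
    using character_of_cyclic_quotient[OF Q sM xQ(1) _ gen] x(2) xQ(2) by auto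
  interpret dirichlet_char Q chi by (rule chi)
  interpret nonprincipal_char Q chi
    by standard (use chi xQ in blast)
  have chip: "chi p = chi c" if pE: "prime p" "p \<notin> E" for p
  proof -
    obtain h where h: "h mod Q \<in> H" "[p = c * h] (mod Q)" using p[OF pE] by blast
    have "chi p = chi (c * h)" using h(2) by (rule cong_eq)
    also have "\<dots> = chi c" using h(1) HM chi(2) by (auto simp: mult)
    finally show ?thesis .
  qed
  have m1: "chi c = -1" and L: "L1 = 0"
    using constant_on_primes[OF E chip] unit[OF c] by auto
  interpret sq: dirichlet_char Q "\<lambda>n. chi n ^ 2"
    by standard (use Q_pos period in \<open>auto simp: mult power_mult_distrib norm_power unit zero\<close>)
  show False
  proof (cases "\<forall>n. coprime n Q \<longrightarrow> chi n ^ 2 = 1")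
    case True
    have "chi n \<in> {-1, 0, 1}" for n
      using True zero[of n] by (cases "coprime n Q") (auto simp: power2_eq_1_iff)
    thus False using L1_nonzero_if_real L by blast
  next
    case False
    then interpret sq: nonprincipal_char Q "\<lambda>n. chi n ^ 2" by unfold_locales blast
    \<comment> \<open>The square takes the value \<open>(-1)^2 = 1\<close> on almost all primes,
      while \<open>constant_on_primes\<close> allows only \<open>-1\<close>.\<close>
    have "(1::complex) = -1 \<and> sq.L1 = 0"
      by (rule sq.constant_on_primes[OF E]) (auto simp: chip m1)
    thus False by simp
  qed
qed

section \<open>The Turan-Kubilius inequality\<close>

text \<open>Normalised by \<open>x\<close> itself rather than by its integer part, so that a sum
  over the multiples of \<open>p\<close> is exactly \<open>x / p\<close> times the average at
  \<open>x / p\<close>.\<close>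

definition avg :: "(nat \<Rightarrow> complex) \<Rightarrow> real \<Rightarrow> complex" where
  "avg h x = (\<Sum>n=1..nat \<lfloor>x\<rfloor>. h n) / of_real x"

lemma norm_sum_le_card:
  fixes h :: "nat \<Rightarrow> complex"
  assumes "\<And>n. norm (h n) \<le> 1"
  shows "norm (\<Sum>n\<in>A. h n) \<le> real (card A)"
  using order.trans[OF norm_sum sum_mono[of A "\<lambda>n. norm (h n)" "\<lambda>_. 1"]] assms by simp

lemma norm_avg_diff_le:
  assumes h: "\<And>n. norm (h n) \<le> 1" and xy: "0 < y" "y \<le> x"
  shows "norm (avg h x - avg h y) \<le> 2 * (1 - y / x) + 1 / x"
proof -
  define S where "S z = (\<Sum>n=1..nat \<lfloor>z\<rfloor>. h n)" for z :: real
  have fl: "nat \<lfloor>y\<rfloor> \<le> nat \<lfloor>x\<rfloor>" using xy by (intro nat_mono floor_mono) auto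
  have "S x - S y = (\<Sum>n\<in>{nat \<lfloor>y\<rfloor><..nat \<lfloor>x\<rfloor>}. h n)"
    unfolding S_def using fl by (subst sum_diff[symmetric]) (auto intro!: sum.cong)
  also have "norm \<dots> \<le> real (card {nat \<lfloor>y\<rfloor><..nat \<lfloor>x\<rfloor>})" by (rule norm_sum_le_card[OF h])
  also have "\<dots> = real (nat \<lfloor>x\<rfloor>) - real (nat \<lfloor>y\<rfloor>)" using fl by simp
  also have "\<dots> \<le> x - y + 1" using xy by (auto simp: of_nat_floor) linarith
  finally have 1: "norm (S x - S y) \<le> x - y + 1" .
  have "norm (S y) \<le> real (card {1..nat \<lfloor>y\<rfloor>})" unfolding S_def by (rule norm_sum_le_card[OF h])
  also have "\<dots> \<le> y" using xy by (simp add: of_nat_floor)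
  finally have 2: "norm (S y) \<le> y" .
  have "avg h x - avg h y = (S x - S y) / of_real x - S y * of_real (1 / y - 1 / x)"
    using xy by (simp add: avg_def S_def field_simps)
  also have "norm \<dots> \<le> norm ((S x - S y) / of_real x) + norm (S y * of_real (1 / y - 1 / x))"
    by (rule norm_triangle_ineq4)
  also have "norm ((S x - S y) / of_real x) \<le> (x - y + 1) / x"
    using 1 xy by (simp add: norm_divide divide_right_mono)
  also have "norm (S y * of_real (1 / y - 1 / x)) \<le> y * (1 / y - 1 / x)"
  proof -
    have "1 / x \<le> 1 / y" using xy by (intro divide_left_mono) auto
    hence "norm (of_real (1 / y - 1 / x) :: complex) = 1 / y - 1 / x" unfolding norm_of_real by simp
    thus ?thesis unfolding norm_mult using 2 \<open>1 / x \<le> 1 / y\<close> by (simp add: mult_right_mono)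
  qed
  also have "(x - y + 1) / x + y * (1 / y - 1 / x) = 2 * (1 - y / x) + 1 / x"
    using xy by (simp add: field_simps)
  finally show ?thesis by simp
qed

lemma norm_avg_diff_exp_le:
  assumes h: "\<And>n. norm (h n) \<le> 1" and xy: "0 < y" "y \<le> x" "x \<le> y * exp s"
  shows "norm (avg h x - avg h y) \<le> 2 * s + 1 / x"
proof -
  have x: "x > 0" using xy by linarith
  have "exp (-s) \<le> y / x" using xy x by (simp add: exp_minus field_simps)
  moreover have "1 - s \<le> exp (-s)" using exp_ge_add_one_self[of "-s"] by simp
  ultimately have "1 - y / x \<le> s" by linarith
  hence "2 * (1 - y / x) + 1 / x \<le> 2 * s + 1 / x" by (intro add_right_mono mult_left_mono) auto
  thus ?thesis using norm_avg_diff_le[of h y x, OF h xy(1,2)] by (rule order.trans[rotated])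
qed

lemma card_common_multiples_le:
  assumes "prime p" "prime q" "p \<noteq> q"
  shows "card {n\<in>{1..N}. p dvd n \<and> q dvd n} = N div (p * q)"
proof -
  have "coprime p q" using assms by (simp add: primes_coprime)
  hence "{n\<in>{1..N}. p dvd n \<and> q dvd n} = {n\<in>{1..N}. p * q dvd n}"
    by (auto intro: divides_mult dest: dvd_mult_left dvd_mult_right)
  also have "\<dots> = (\<lambda>k. p * q * k) ` {1..N div (p * q)}"
    using assms by (auto simp: image_iff less_eq_div_iff_mult_less_eq prime_gt_0_nat mult_ac Suc_le_eq elim!: dvdE)
  finally show ?thesis using assms by (simp add: card_image inj_on_def prime_gt_0_nat)
qed

lemma multiples_eq_image: "p > 0 \<Longrightarrow> {n\<in>{1..N}. p dvd n} = (\<lambda>m. p * m) ` {1..N div p}"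
  for p :: nat
  by (auto simp: image_iff less_eq_div_iff_mult_less_eq mult_ac Suc_le_eq elim!: dvdE)

lemma nat_floor_divide: "nat \<lfloor>x / real p\<rfloor> = nat \<lfloor>x\<rfloor> div p" if "x \<ge> 0"
proof -
  have "\<lfloor>x / real p\<rfloor> = \<lfloor>x\<rfloor> div int p" using floor_divide_real_eq_div[of "int p" x] by simp
  thus ?thesis using that by (simp add: nat_div_distrib)
qed

text \<open>Let \<open>om n\<close> be the sum of \<open>w p\<close> over \<open>p\<close> in
  \<open>P\<close> dividing \<open>n\<close>. Its mean is about \<open>H\<close> and its second
  moment about \<open>H\<close> is at most \<open>2 * H\<close>; the condition
  \<open>x \<ge> 2 * card P\<close> absorbs the rounding errors. Summing \<open>om n * h n\<close>
  over \<open>n\<close> produces the weighted mean over primes, and Cauchy-Schwarz allows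
  \<open>om n\<close> to be replaced by \<open>H\<close>.\<close>

theorem weighted_turan_kubilius:
  assumes P: "finite P" "\<And>p. p \<in> P \<Longrightarrow> prime p"
    and w: "\<And>p. p \<in> P \<Longrightarrow> 0 \<le> w p" "\<And>p. p \<in> P \<Longrightarrow> w p \<le> 1"
    and H: "H = (\<Sum>p\<in>P. w p / real p)" "H > 0"
    and h: "\<And>n. norm (h n) \<le> 1"
    and x: "x > 0" "x \<ge> 2 * real (card P)"
  shows "norm (avg h x - (\<Sum>p\<in>P. of_real (w p / real p) * avg (\<lambda>m. h (p * m)) (x / real p)) / of_real H) \<le> sqrt (2 / H)"
proof -
  define N where "N = nat \<lfloor>x\<rfloor>"
  define om where "om n = (\<Sum>p\<in>P. if p dvd n then w p else 0)" for n
  have Nx: "real N \<le> x" "x < real N + 1" using x unfolding N_def by (auto simp: of_nat_floor)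
  have p0: "p > 0" if "p \<in> P" for p using P(2)[OF that] by (rule prime_gt_0_nat)
  have S1: "(\<Sum>n=1..N. of_real (om n) * h n) = of_real x * (\<Sum>p\<in>P. of_real (w p / real p) * avg (\<lambda>m. h (p * m)) (x / real p))"
  proof -
    have "(\<Sum>n=1..N. of_real (om n) * h n) = (\<Sum>n=1..N. \<Sum>p\<in>P. if p dvd n then of_real (w p) * h n else 0)"
      unfolding om_def of_real_sum sum_distrib_right by (intro sum.cong refl) auto
    also have "\<dots> = (\<Sum>p\<in>P. \<Sum>n=1..N. if p dvd n then of_real (w p) * h n else 0)" by (rule sum.swap)
    also have "\<dots> = (\<Sum>p\<in>P. of_real (w p) * (\<Sum>m=1..N div p. h (p * m)))"
    proof (rule sum.cong[OF refl])
      fix p assume p: "p \<in> P"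
      have "(\<Sum>n=1..N. if p dvd n then of_real (w p) * h n else 0) = (\<Sum>n\<in>{n\<in>{1..N}. p dvd n}. of_real (w p) * h n)"
        by (rule sum.inter_filter[symmetric]) auto
      also have "\<dots> = (\<Sum>m=1..N div p. of_real (w p) * h (p * m))"
        unfolding multiples_eq_image[OF p0[OF p]] by (subst sum.reindex) (use p0[OF p] in \<open>auto simp: inj_on_def\<close>)
      finally show "(\<Sum>n=1..N. if p dvd n then of_real (w p) * h n else 0) = of_real (w p) * (\<Sum>m=1..N div p. h (p * m))"
        by (simp only: sum_distrib_left)
    qed
    also have "\<dots> = (\<Sum>p\<in>P. of_real x * (of_real (w p / real p) * avg (\<lambda>m. h (p * m)) (x / real p)))"
      using p0 x by (intro sum.cong refl) (simp add: avg_def nat_floor_divide N_def)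
    finally show ?thesis by (simp only: sum_distrib_left)
  qed
  have S2: "(\<Sum>n=1..N. h n) = of_real x * avg h x" using x by (simp add: avg_def N_def)
  have om1: "(\<Sum>n=1..N. om n) \<ge> x * H - real (card P)"
  proof -
    have "(\<Sum>n=1..N. om n) = (\<Sum>p\<in>P. \<Sum>n=1..N. if p dvd n then w p else 0)"
      unfolding om_def by (rule sum.swap)
    also have "\<dots> = (\<Sum>p\<in>P. w p * real (N div p))"
    proof (rule sum.cong[OF refl])
      fix p assume p: "p \<in> P"
      have "(\<Sum>n=1..N. if p dvd n then w p else 0) = (\<Sum>n\<in>{n\<in>{1..N}. p dvd n}. w p)"
        by (rule sum.inter_filter[symmetric]) auto
      thus "(\<Sum>n=1..N. if p dvd n then w p else 0) = w p * real (N div p)"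
        unfolding multiples_eq_image[OF p0[OF p]] using p0[OF p] by (simp add: card_image inj_on_def)
    qed
    also have "\<dots> \<ge> (\<Sum>p\<in>P. x * (w p / real p) - 1)"
    proof (rule sum_mono)
      fix p assume p: "p \<in> P"
      have "x / real p \<le> real (N div p) + 1"
        unfolding N_def nat_floor_divide[of x p, OF less_imp_le[OF x(1)], symmetric] by linarith
      hence "w p * (x / real p) \<le> w p * (real (N div p) + 1)" using w(1)[OF p] by (rule mult_left_mono)
      thus "x * (w p / real p) - 1 \<le> w p * real (N div p)" using w(2)[OF p] by (simp add: algebra_simps)
    qed
    also have "(\<Sum>p\<in>P. x * (w p / real p) - 1) = x * H - real (card P)"
      unfolding H(1) sum_subtractf sum_distrib_left by simp
    finally show ?thesis .
  qed
  have om2: "(\<Sum>n=1..N. om n ^ 2) \<le> x * H\<^sup>2 + x * H"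
  proof -
    have "(\<Sum>n=1..N. om n ^ 2) = (\<Sum>n=1..N. \<Sum>p\<in>P. \<Sum>q\<in>P. if p dvd n \<and> q dvd n then w p * w q else 0)"
      unfolding om_def power2_eq_square sum_product by (intro sum.cong refl) auto
    also have "\<dots> = (\<Sum>p\<in>P. \<Sum>q\<in>P. \<Sum>n=1..N. if p dvd n \<and> q dvd n then w p * w q else 0)"
      by (rule trans[OF sum.swap], rule sum.cong[OF refl], rule sum.swap)
    also have "\<dots> = (\<Sum>p\<in>P. \<Sum>q\<in>P. w p * w q * real (card {n\<in>{1..N}. p dvd n \<and> q dvd n}))"
      by (intro sum.cong refl, subst sum.inter_filter[symmetric]) auto
    \<comment> \<open>Distinct primes are independent up to rounding; the diagonal adds only
      \<open>x * H\<close> because \<open>w p * w p \<le> w p\<close>.\<close>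
    also have "\<dots> \<le> (\<Sum>p\<in>P. \<Sum>q\<in>P. x * ((w p / real p) * (w q / real q)) + (if p = q then x * (w p / real p) else 0))"
    proof (intro sum_mono)
      fix p q assume pq: "p \<in> P" "q \<in> P"
      show "w p * w q * real (card {n\<in>{1..N}. p dvd n \<and> q dvd n})
        \<le> x * ((w p / real p) * (w q / real q)) + (if p = q then x * (w p / real p) else 0)"
      proof (cases "p = q")
        case False
        have "real (card {n\<in>{1..N}. p dvd n \<and> q dvd n}) = real (N div (p * q))"
          using card_common_multiples_le[of p q N] P(2) pq False by simp
        also have "\<dots> \<le> real N / real (p * q)" by (rule nat_div_le_real_div)
        also have "\<dots> \<le> x / real (p * q)" using Nx by (intro divide_right_mono) auto
        finally have "w p * w q * real (card {n\<in>{1..N}. p dvd n \<and> q dvd n}) \<le> w p * w q * (x / real (p * q))"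
          using w(1)[OF pq(1)] w(1)[OF pq(2)] by (intro mult_left_mono) auto
        thus ?thesis using False by (simp add: field_simps)
      next
        case True
        have "real (card {n\<in>{1..N}. p dvd n \<and> q dvd n}) = real (N div p)"
          using multiples_eq_image[OF p0[OF pq(1)], of N] p0[OF pq(1)] unfolding True[symmetric]
          by (simp add: card_image inj_on_def)
        also have "\<dots> \<le> real N / real p" by (rule nat_div_le_real_div)
        also have "\<dots> \<le> x / real p" using Nx by (intro divide_right_mono) auto
        finally have "w p * w q * real (card {n\<in>{1..N}. p dvd n \<and> q dvd n}) \<le> (w p * 1) * (x / real p)"
          using w(1)[OF pq(1)] w[OF pq(2)] by (intro mult_mono) auto
        moreover have "x * ((w p / real p) * (w q / real q)) \<ge> 0"
          using w(1)[OF pq(1)] w(1)[OF pq(2)] x by (intro mult_nonneg_nonneg) auto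
        ultimately show ?thesis using True by (simp add: mult.commute)
      qed
    qed
    also have "\<dots> = (\<Sum>p\<in>P. \<Sum>q\<in>P. x * ((w p / real p) * (w q / real q))) + (\<Sum>p\<in>P. x * (w p / real p))"
      using P(1) by (simp add: sum.distrib)
    also have "(\<Sum>p\<in>P. \<Sum>q\<in>P. x * ((w p / real p) * (w q / real q))) = x * (H * H)"
      unfolding H(1) by (subst sum_product) (simp only: sum_distrib_left)
    also have "(\<Sum>p\<in>P. x * (w p / real p)) = x * H" unfolding H(1) by (simp only: sum_distrib_left)
    finally show ?thesis by (simp add: power2_eq_square)
  qed
  have var: "(\<Sum>n=1..N. (H - om n)\<^sup>2) \<le> 2 * x * H"
  proof -
    have "(\<Sum>n=1..N. (H - om n)\<^sup>2) = real N * H\<^sup>2 - 2 * H * (\<Sum>n=1..N. om n) + (\<Sum>n=1..N. om n ^ 2)"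
      by (simp add: power2_diff sum.distrib sum_subtractf sum_distrib_left)
    also have "\<dots> \<le> x * H\<^sup>2 - 2 * H * (x * H - real (card P)) + (x * H\<^sup>2 + x * H)"
      using om1 om2 Nx H(2) by (intro add_mono diff_mono mult_right_mono mult_left_mono) auto
    also have "\<dots> = H * (2 * real (card P)) + x * H" by (simp add: algebra_simps power2_eq_square)
    also have "\<dots> \<le> H * x + x * H" using x(2) H(2) by (intro add_mono mult_left_mono) auto
    finally show ?thesis by (simp add: mult.commute)
  qed
  have "(\<Sum>n=1..N. \<bar>H - om n\<bar>)\<^sup>2 \<le> (\<Sum>n=1..N. \<bar>H - om n\<bar>\<^sup>2) * real (card {1..N})"
    by (rule sum_squared_le_sum_of_squares)
  also have "\<dots> = (\<Sum>n=1..N. (H - om n)\<^sup>2) * real N" by simp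
  also have "\<dots> \<le> (2 * x * H) * x" using var Nx x H by (intro mult_mono) auto
  also have "\<dots> = x\<^sup>2 * (2 * H)" by (simp add: power2_eq_square)
  finally have "(\<Sum>n=1..N. \<bar>H - om n\<bar>) \<le> sqrt (x\<^sup>2 * (2 * H))" by (rule real_le_rsqrt)
  also have "\<dots> = x * sqrt (2 * H)" using x by (simp add: real_sqrt_mult)
  finally have l1: "(\<Sum>n=1..N. \<bar>H - om n\<bar>) \<le> x * sqrt (2 * H)" .
  let ?A = "\<Sum>p\<in>P. of_real (w p / real p) * avg (\<lambda>m. h (p * m)) (x / real p)"
  have "avg h x - ?A / of_real H = (of_real H * (of_real x * avg h x) - of_real x * ?A) / of_real (H * x)"
    using H(2) x by (simp add: field_simps)
  also have "of_real H * (of_real x * avg h x) - of_real x * ?A = (\<Sum>n=1..N. of_real (H - om n) * h n)"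
    unfolding S1[symmetric] S2[symmetric]
    unfolding sum_distrib_left sum_subtractf[symmetric]
    by (intro sum.cong refl) (simp add: algebra_simps)
  also have "norm ((\<Sum>n=1..N. of_real (H - om n) * h n) / of_real (H * x)) \<le> x * sqrt (2 * H) / (H * x)"
  proof -
    have "norm (\<Sum>n=1..N. of_real (H - om n) * h n) \<le> (\<Sum>n=1..N. \<bar>H - om n\<bar>)"
    proof (rule order.trans[OF norm_sum], intro sum_mono)
      fix n
      have "\<bar>H - om n\<bar> * norm (h n) \<le> \<bar>H - om n\<bar> * 1" by (intro mult_left_mono h) auto
      thus "norm (of_real (H - om n) * h n) \<le> \<bar>H - om n\<bar>" unfolding norm_mult norm_of_real by simp
    qed
    hence "norm (\<Sum>n=1..N. of_real (H - om n) * h n) \<le> x * sqrt (2 * H)" using l1 by linarith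
    hence "norm (\<Sum>n=1..N. of_real (H - om n) * h n) / (H * x) \<le> x * sqrt (2 * H) / (H * x)"
      using x H(2) by (intro divide_right_mono) auto
    moreover have "\<bar>H * x\<bar> = H * x" using x H(2) by simp
    ultimately show ?thesis unfolding norm_divide norm_of_real by (simp only:)
  qed
  also have "x * sqrt (2 * H) / (H * x) = sqrt (2 / H)"
  proof -
    have "sqrt (2 * H) / H = sqrt (2 * H) / sqrt (H\<^sup>2)" using H(2) by simp
    also have "\<dots> = sqrt (2 * H / H\<^sup>2)" by (rule real_sqrt_divide[symmetric])
    also have "2 * H / H\<^sup>2 = 2 / H" by (simp add: power2_eq_square)
    finally have "sqrt (2 * H) / H = sqrt (2 / H)" .
    thus ?thesis using x H(2) by simp
  qed
  finally show ?thesis .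
qed

section \<open>Scale invariance of the averages\<close>

text \<open>Cells have equal length \<open>e\<close> on the logarithmic scale, so moving from cell
  \<open>j\<close> to cell \<open>j + s\<close> multiplies primes by \<open>exp (s * e)\<close> up
  to a factor between \<open>exp (-e)\<close> and \<open>exp e\<close>.\<close>

definition prime_cell :: "real \<Rightarrow> nat \<Rightarrow> nat \<Rightarrow> nat \<Rightarrow> nat set" where
  "prime_cell e Q c j = {p. prime p \<and> real j * e < ln (real p) \<and> ln (real p) \<le> real (Suc j) * e \<and> p mod Q = c}"

lemma prime_cell_bounds:
  assumes "p \<in> prime_cell e Q c j"
  shows "exp (real j * e) < real p" "real p \<le> exp (real j * e) * exp e" "prime p" "p mod Q = c"
proof -
  have p: "prime p" "real j * e < ln (real p)" "ln (real p) \<le> real (Suc j) * e" "p mod Q = c"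
    using assms by (auto simp: prime_cell_def)
  have p0: "real p > 0" using p(1) by (simp add: prime_gt_0_nat)
  show "prime p" "p mod Q = c" by fact+
  show "exp (real j * e) < real p" using p(2) p0 by (metis exp_less_mono exp_ln)
  have "real p \<le> exp (real (Suc j) * e)" using p(3) p0 by (metis exp_le_cancel_iff exp_ln)
  moreover have "real (Suc j) * e = real j * e + e" by (simp add: algebra_simps)
  ultimately show "real p \<le> exp (real j * e) * exp e" by (simp only: exp_add)
qed

lemma finite_prime_cell [simp]: "finite (prime_cell e Q c j)"
proof (rule finite_subset)
  show "prime_cell e Q c j \<subseteq> {..nat \<lfloor>exp (real j * e) * exp e\<rfloor>}"
    using prime_cell_bounds(2) by (auto simp: le_nat_floor)
qed auto

lemma prime_cell_disjoint:
  assumes "e > 0" "j \<noteq> j'"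
  shows "prime_cell e Q c j \<inter> prime_cell e Q c' j' = {}"
proof -
  have *: False if "i < i'" "real i' * e < r" "r \<le> real (Suc i) * e" for i i' :: nat and r
  proof -
    have "real (Suc i) * e \<le> real i' * e" using that assms by (intro mult_right_mono) auto
    thus False using that by linarith
  qed
  show ?thesis
    using assms(2) *[of j j'] *[of j' j] by (auto simp: prime_cell_def neq_iff)
qed

definition cell_mass :: "real \<Rightarrow> nat \<Rightarrow> nat \<Rightarrow> nat \<Rightarrow> real" where
  "cell_mass e Q c j = (\<Sum>p\<in>prime_cell e Q c j. ln (real p) / real p)"

lemma cell_mass_nonneg: "cell_mass e Q c j \<ge> 0"
  unfolding cell_mass_def
  by (intro sum_nonneg divide_nonneg_nonneg) (auto simp: prime_cell_def prime_gt_0_nat Suc_le_eq intro!: ln_ge_zero)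

lemma sum_cell_mass_le:
  assumes "e > 0" "finite J"
    and P: "(\<Union>j\<in>J. prime_cell e Q c j) \<subseteq> P" and bd: "\<And>A. A \<subseteq> P \<Longrightarrow> (\<Sum>p\<in>A. ln (real p) / real p) \<le> B"
  shows "(\<Sum>j\<in>J. cell_mass e Q c j) \<le> B"
proof -
  have "(\<Sum>j\<in>J. cell_mass e Q c j) = (\<Sum>p\<in>(\<Union>j\<in>J. prime_cell e Q c j). ln (real p) / real p)"
    unfolding cell_mass_def
    by (rule sum.UNION_disjoint[symmetric]) (use assms prime_cell_disjoint[OF assms(1)] in auto)
  also have "\<dots> \<le> B" using P by (rule bd)
  finally show ?thesis .
qed

lemma window_mass_ge:
  assumes "Q > 0" and e: "e > 0" and K: "K \<ge> 0" "\<And>M N. 1 \<le> M \<Longrightarrow> M \<le> N \<Longrightarrow>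
      \<bar>(\<Sum>p\<in>{p\<in>{M<..N}. prime p}. ln (real p) / real p) - (ln (real N) - ln (real M))\<bar> \<le> K"
    and n: "real n * e \<ge> 1"
  shows "(\<Sum>j\<in>{b..<b+n}. \<Sum>c<Q. cell_mass e Q c j) \<ge> real n * e - K - 1"
proof -
  define y z where "y = exp (real b * e)" and "z = exp (real (b + n) * e)"
  define A B where "A = nat \<lfloor>y\<rfloor>" and "B = nat \<lfloor>z\<rfloor>"
  have y1: "y \<ge> 1" unfolding y_def using e by simp
  have zy: "z = y * exp (real n * e)" unfolding y_def z_def by (simp add: distrib_right exp_add)
  have "exp (real n * e) \<ge> 2" using exp_ge_add_one_self[of "real n * e"] n by linarith
  hence z2: "z \<ge> 2 * y" unfolding zy using y1 by simp
  have A1: "A \<ge> 1" unfolding A_def using y1 by (simp add: le_nat_floor)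
  have AB: "A \<le> B" unfolding A_def B_def using z2 y1 by (intro nat_mono floor_mono) auto
  have Ay: "real A \<le> y" unfolding A_def using y1 by (simp add: of_nat_floor)
  have Bz: "real B \<ge> z / 2"
  proof -
    have "real B > z - 1" unfolding B_def using z2 y1 by (auto simp: of_nat_floor)
    thus ?thesis using z2 y1 by linarith
  qed
  have "ln (z / 2) \<le> ln (real B)" using Bz z2 y1 by (subst ln_le_cancel_iff) auto
  moreover have "ln (z / 2) = real (b + n) * e - ln 2" unfolding z_def by (subst ln_div) auto
  moreover have "ln (real A) \<le> ln y" using Ay A1 y1 by (subst ln_le_cancel_iff) auto
  moreover have "ln y = real b * e" unfolding y_def by simp
  ultimately have "ln (real B) - ln (real A) \<ge> real n * e - 1"
    using ln_2_less_1 by (simp add: distrib_right)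
  hence "real n * e - K - 1 \<le> (\<Sum>p\<in>{p\<in>{A<..B}. prime p}. ln (real p) / real p)"
    using K(2)[OF A1 AB] by linarith
  also have "\<dots> \<le> (\<Sum>p\<in>(\<Union>(j,c)\<in>{b..<b+n}\<times>{..<Q}. prime_cell e Q c j). ln (real p) / real p)"
  proof (rule sum_mono2)
    show "{p\<in>{A<..B}. prime p} \<subseteq> (\<Union>(j,c)\<in>{b..<b+n}\<times>{..<Q}. prime_cell e Q c j)"
    proof
      fix p assume "p \<in> {p\<in>{A<..B}. prime p}"
      hence p: "prime p" "A < p" "p \<le> B" by auto
      have p0: "real p > 0" using p by (simp add: prime_gt_0_nat)
      have py: "real p > y" using p(2) unfolding A_def by (metis floor_less_iff le_less_trans nat_less_iff not_less of_int_of_nat_eq of_nat_0_le_iff zless_nat_conj nat_int floor_of_nat nat_mono floor_mono)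
      have pz: "real p \<le> z" using p(3) z2 y1 unfolding B_def by (simp add: le_nat_floor le_floor_iff nat_le_iff le_nat_iff)
      have l1: "real b * e < ln (real p)" using py p0 unfolding y_def by (metis ln_exp ln_less_cancel_iff exp_gt_zero)
      have l2: "ln (real p) \<le> real (b + n) * e" using pz p0 unfolding z_def by (metis ln_exp ln_le_cancel_iff exp_gt_zero)
      \<comment> \<open>Cells are open on the left and closed on the right, hence the ceiling minus
        one.\<close>
      define j where "j = nat (\<lceil>ln (real p) / e\<rceil> - 1)"
      have t: "real b < ln (real p) / e" "ln (real p) / e \<le> real (b + n)"
        using l1 l2 e by (auto simp: field_simps)
      have c1: "\<lceil>ln (real p) / e\<rceil> \<ge> int b + 1" using t(1) by linarith
      have c2: "\<lceil>ln (real p) / e\<rceil> \<le> int (b + n)" using t(2) by linarith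
      have j: "real j = of_int \<lceil>ln (real p) / e\<rceil> - 1" unfolding j_def using c1 by simp
      have "real j < ln (real p) / e" "ln (real p) / e \<le> real j + 1" using j by linarith+
      hence "real j * e < ln (real p)" "ln (real p) \<le> real (Suc j) * e" using e by (auto simp: field_simps)
      hence "p \<in> prime_cell e Q (p mod Q) j" using p by (simp add: prime_cell_def)
      moreover have "j \<in> {b..<b+n}" using c1 c2 unfolding j_def by auto
      moreover have "p mod Q \<in> {..<Q}" using assms(1) by simp
      ultimately show "p \<in> (\<Union>(j,c)\<in>{b..<b+n}\<times>{..<Q}. prime_cell e Q c j)" by blast
    qed
  next
    fix p assume "p \<in> (\<Union>(j,c)\<in>{b..<b+n}\<times>{..<Q}. prime_cell e Q c j) - {p\<in>{A<..B}. prime p}"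
    hence "prime p" by (auto simp: prime_cell_def)
    thus "ln (real p) / real p \<ge> 0" by (simp add: prime_gt_0_nat Suc_le_eq)
  qed auto
  also have "\<dots> = (\<Sum>jc\<in>{b..<b+n}\<times>{..<Q}. \<Sum>p\<in>(case jc of (j,c) \<Rightarrow> prime_cell e Q c j). ln (real p) / real p)"
  proof (rule sum.UNION_disjoint)
    show "\<forall>i\<in>{b..<b+n}\<times>{..<Q}. \<forall>i'\<in>{b..<b+n}\<times>{..<Q}. i \<noteq> i' \<longrightarrow>
       (case i of (j,c) \<Rightarrow> prime_cell e Q c j) \<inter> (case i' of (j,c) \<Rightarrow> prime_cell e Q c j) = {}"
    proof (intro ballI impI)
      fix i i' :: "nat \<times> nat" assume ne: "i \<noteq> i'"
      obtain j c j' c' where i: "i = (j,c)" "i' = (j',c')" by (cases i, cases i')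
      show "(case i of (j,c) \<Rightarrow> prime_cell e Q c j) \<inter> (case i' of (j,c) \<Rightarrow> prime_cell e Q c j) = {}"
        using prime_cell_disjoint[OF e, of j j' Q c c'] ne i by (auto simp: prime_cell_def)
    qed
  qed auto
  also have "\<dots> = (\<Sum>jc\<in>{b..<b+n}\<times>{..<Q}. case jc of (j,c) \<Rightarrow> cell_mass e Q c j)"
    by (intro sum.cong refl) (auto simp: cell_mass_def)
  also have "\<dots> = (\<Sum>j\<in>{b..<b+n}. \<Sum>c<Q. cell_mass e Q c j)"
    by (simp add: sum.cartesian_product case_prod_unfold)
  finally show ?thesis .
qed

text \<open>The sieve forbids that the mass of a window concentrates on few consecutive cells; this bounds
  the distance \<open>s\<close> of the two heavy cells from below.\<close>

lemma heavy_cells_in_window: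
  assumes Q: "Q > 0" and R: "R = 800 * Q" and d: "0 < d" "d \<le> 1" and L: "L > 0"
    and e: "e = d / real (L * R)"
    and K: "K \<ge> 0" "\<And>M N. 1 \<le> M \<Longrightarrow> M \<le> N \<Longrightarrow>
      \<bar>(\<Sum>p\<in>{p\<in>{M<..N}. prime p}. ln (real p) / real p) - (ln (real N) - ln (real M))\<bar> \<le> K"
    and G: "real G * d \<ge> 2 * (K + 1)"
  shows "eventually (\<lambda>k. \<exists>c<Q. \<exists>s\<in>{L..<L*R}. \<exists>j\<in>{k*(G*(L*R))..<Suc k*(G*(L*R))}. j + s < Suc k*(G*(L*R)) \<and>
      d / (8 * real Q * real (L * R)) \<le> cell_mass e Q c j \<and>
      d / (8 * real Q * real (L * R)) \<le> cell_mass e Q c (j + s)) sequentially"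
proof -
  define M where "M = L * R"
  have R0: "R > 0" using R Q by simp
  have M0: "M > 0" using L R0 by (simp add: M_def)
  have e0: "e > 0" using e d M0 by (simp add: M_def)
  have Me: "real M * e = d" using e M0 by (simp add: M_def)
  have Le: "real L * e = d / real R" using e L R0 by (simp add: field_simps)
  have G0: "G > 0" using G d K(1) by (cases G) auto
  have dR: "0 < d / real R" "d / real R \<le> 1" using d R0 by (auto simp: field_simps)
  obtain y0 where y0: "\<And>y P. y \<ge> y0 \<Longrightarrow> P \<subseteq> {p. prime p \<and> y < real p \<and> real p \<le> y * exp (d / real R)} \<Longrightarrow>
           (\<Sum>p\<in>P. ln (real p) / real p) \<le> 100 * (d / real R)"
    using prime_mass_short_interval[OF dR] unfolding eventually_at_top_linorder by blast
  have "filterlim (\<lambda>k. exp (real (k * (G * M)) * e)) at_top sequentially"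
    using e0 G0 M0 by real_asymp
  hence "eventually (\<lambda>k. exp (real (k * (G * M)) * e) \<ge> y0) sequentially"
    by (simp add: filterlim_at_top)
  thus ?thesis
  proof eventually_elim
    case (elim k)
    define b where "b = k * (G * M)"
    define mu where "mu = d / (8 * real Q * real M)"
    have sieve: "(\<Sum>j\<in>{j0..<j0+L}. cell_mass e Q c j) \<le> d / (8 * real Q)" if "j0 \<ge> b" for j0 c
    proof -
      have "real b * e \<le> real j0 * e" using that e0 by simp
      hence y: "exp (real j0 * e) \<ge> y0" using elim by (simp add: b_def order.trans)
      have "(\<Sum>j\<in>{j0..<j0+L}. cell_mass e Q c j) \<le> 100 * (d / real R)"
      proof (rule sum_cell_mass_le[OF e0])
        show "(\<Union>j\<in>{j0..<j0+L}. prime_cell e Q c j) \<subseteq> {p. prime p \<and> exp (real j0 * e) < real p \<and> real p \<le> exp (real j0 * e) * exp (d / real R)}"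
        proof safe
          fix j p assume j: "j \<in> {j0..<j0+L}" and p: "p \<in> prime_cell e Q c j"
          note b = prime_cell_bounds[OF p]
          show "prime p" by (rule b)
          have "real j0 * e \<le> real j * e" using j e0 by simp
          hence "exp (real j0 * e) \<le> exp (real j * e)" by simp
          thus "exp (real j0 * e) < real p" using b(1) by linarith
          have "real (Suc j) * e \<le> real (j0 + L) * e" using j e0 by (intro mult_right_mono of_nat_mono) auto
          hence "exp (real j * e) * exp e \<le> exp (real j0 * e) * exp (d / real R)"
            unfolding Le[symmetric] by (simp add: distrib_right flip: exp_add)
          thus "real p \<le> exp (real j0 * e) * exp (d / real R)" using b(2) by linarith
        qed
        show "(\<Sum>p\<in>A. ln (real p) / real p) \<le> 100 * (d / real R)"
          if "A \<subseteq> {p. prime p \<and> exp (real j0 * e) < real p \<and> real p \<le> exp (real j0 * e) * exp (d / real R)}" for A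
          using y0[OF y that] .
      qed auto
      \<comment> \<open>This fixes \<open>R = 800 * Q\<close>: any \<open>L\<close> consecutive
        cells then carry at most a quarter of the mass \<open>d / (2 * Q)\<close> that the
        pigeonhole principle will provide.\<close>
      also have "100 * (d / real R) = d / (8 * real Q)" using R by simp
      finally show ?thesis .
    qed
    have GM: "real (G * M) * e = real G * d" using Me by (simp add: mult.assoc)
    have "1 \<le> 2 * (K + 1)" using K(1) by simp
    hence "1 \<le> real G * d" using G by (rule order.trans)
    hence "real G * d - K - 1 \<le> (\<Sum>j\<in>{b..<b+G*M}. \<Sum>c<Q. cell_mass e Q c j)"
      using window_mass_ge[OF Q e0 K, of "G * M" b] by (simp only: GM)
    \<comment> \<open>The window consists of \<open>G\<close> blocks of logarithmic length
      \<open>d\<close>, with \<open>G\<close> so large that Mertens' error is at most half of its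
      total mass.\<close>
    moreover have "real G * d / 2 \<le> real G * d - K - 1" using G by (simp add: field_simps)
    ultimately have W: "(\<Sum>j\<in>{b..<b+G*M}. \<Sum>c<Q. cell_mass e Q c j) \<ge> real G * d / 2"
      by (rule order.trans[rotated])
    \<comment> \<open>Pigeonhole over the \<open>G\<close> blocks and the \<open>Q\<close> residue
      classes.\<close>
    have "\<exists>g<G. \<exists>c<Q. (\<Sum>r<M. cell_mass e Q c (b + g * M + r)) \<ge> d / (2 * real Q)"
    proof (rule ccontr)
      assume "\<not> ?thesis"
      hence lt: "(\<Sum>r<M. cell_mass e Q c (b + g * M + r)) < d / (2 * real Q)" if "g < G" "c < Q" for g c
        using that by (meson not_le)
      have "(\<Sum>j\<in>{b..<b+G*M}. \<Sum>c<Q. cell_mass e Q c j) = (\<Sum>i<G*M. \<Sum>c<Q. cell_mass e Q c (b + i))"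
        by (rule sum.reindex_bij_witness[where i = "\<lambda>i. b + i" and j = "\<lambda>j. j - b"]) auto
      also have "\<dots> = (\<Sum>g<G. \<Sum>i\<in>{g*M..<g*M+M}. \<Sum>c<Q. cell_mass e Q c (b + i))"
        by (rule sum.nat_group[symmetric])
      also have "\<dots> = (\<Sum>g<G. \<Sum>r<M. \<Sum>c<Q. cell_mass e Q c (b + g * M + r))"
      proof (rule sum.cong[OF refl])
        fix g
        show "(\<Sum>i\<in>{g*M..<g*M+M}. \<Sum>c<Q. cell_mass e Q c (b + i)) = (\<Sum>r<M. \<Sum>c<Q. cell_mass e Q c (b + g * M + r))"
          by (rule sum.reindex_bij_witness[where i = "\<lambda>r. g * M + r" and j = "\<lambda>i. i - g * M"]) (auto simp: add.assoc)
      qed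
      also have "\<dots> = (\<Sum>g<G. \<Sum>c<Q. \<Sum>r<M. cell_mass e Q c (b + g * M + r))"
        by (rule sum.cong[OF refl], rule sum.swap)
      also have "\<dots> < (\<Sum>g<G. \<Sum>c<Q. d / (2 * real Q))"
        using lt G0 Q by (intro sum_strict_mono) auto
      also have "\<dots> = real G * d / 2" using Q by simp
      finally show False using W by linarith
    qed
    then obtain g c where gc: "g < G" "c < Q" "(\<Sum>r<M. cell_mass e Q c (b + g * M + r)) \<ge> d / (2 * real Q)" by blast
    define b' where "b' = b + g * M"
    define u where "u r = cell_mass e Q c (b' + r)" for r
    define Hv where "Hv = {r\<in>{..<M}. mu \<le> u r}"
    have tot: "(\<Sum>r<M. u r) \<ge> d / (2 * real Q)" using gc(3) by (simp add: u_def b'_def)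
    have light: "(\<Sum>r\<in>{..<M} - Hv. u r) \<le> d / (8 * real Q)"
    proof -
      have "(\<Sum>r\<in>{..<M} - Hv. u r) \<le> (\<Sum>r\<in>{..<M} - Hv. mu)"
        by (intro sum_mono) (auto simp: Hv_def)
      also have "\<dots> = real (card ({..<M} - Hv)) * mu" by simp
      also have "\<dots> \<le> real (card {..<M}) * mu"
        using d by (intro mult_right_mono of_nat_mono card_mono) (auto simp: mu_def)
      also have "\<dots> = d / (8 * real Q)" using M0 by (simp add: mu_def)
      finally show ?thesis .
    qed
    have HvM: "Hv \<subseteq> {..<M}" by (auto simp: Hv_def)
    have finH: "finite Hv" using HvM by (rule finite_subset) auto
    have split: "(\<Sum>r<M. u r) = (\<Sum>r\<in>{..<M} - Hv. u r) + (\<Sum>r\<in>Hv. u r)"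
      using HvM by (intro sum.subset_diff) auto
    have dQ: "d / (2 * real Q) = 4 * (d / (8 * real Q))" "d / (8 * real Q) > 0" using d Q by auto
    have "Hv \<noteq> {}" using split light tot dQ by (auto simp del: times_divide_eq_right)
    define r1 where "r1 = Min Hv"
    have r1: "r1 \<in> Hv" "\<And>r. r \<in> Hv \<Longrightarrow> r1 \<le> r" using \<open>Hv \<noteq> {}\<close> finH by (auto simp: r1_def)
    \<comment> \<open>Light cells contribute at most \<open>d / (8 * Q)\<close>. If all heavy cells
      lay within \<open>L\<close> consecutive ones they would contribute at most as much again,
      short of \<open>d / (2 * Q)\<close>.\<close>
    have "\<exists>r2\<in>Hv. r2 \<ge> r1 + L"
    proof (rule ccontr)
      assume "\<not> ?thesis"
      hence "Hv \<subseteq> {r1..<r1+L}" using r1(2) by (auto simp: not_le)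
      hence "(\<Sum>r\<in>Hv. u r) \<le> (\<Sum>r\<in>{r1..<r1+L}. u r)"
        by (intro sum_mono2) (auto simp: u_def cell_mass_nonneg)
      also have "\<dots> = (\<Sum>j\<in>{b'+r1..<b'+r1+L}. cell_mass e Q c j)" unfolding u_def
        by (rule sum.reindex_bij_witness[where j = "\<lambda>i. b' + i" and i = "\<lambda>j. j - b'"]) auto
      also have "\<dots> \<le> d / (8 * real Q)" by (rule sieve) (simp add: b'_def)
      finally show False using split light tot dQ by linarith
    qed
    then obtain r2 where r2: "r2 \<in> Hv" "r2 \<ge> r1 + L" by blast
    have r2M: "r2 < M" using r2(1) HvM by auto
    have "b' + M \<le> Suc k * (G * M)"
    proof -
      have "g * M + M \<le> G * M" using gc(1) by (metis Suc_leI mult_Suc mult_le_mono1 add.commute)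
      thus ?thesis by (simp add: b'_def b_def)
    qed
    moreover have "mu \<le> cell_mass e Q c (b' + r1)" "mu \<le> cell_mass e Q c (b' + r1 + (r2 - r1))"
      using r1(1) r2 by (auto simp: Hv_def u_def add.assoc)
    ultimately show ?case using gc(2) r2 r2M unfolding M_def[symmetric] mu_def[symmetric]
      by (intro exI[of _ c] conjI bexI[of _ "r2 - r1"] bexI[of _ "b' + r1"]) (auto simp: b'_def b_def)
  qed
qed

lemma cell_mass_imp_reciprocal_sum:
  assumes "e > 0"
  shows "cell_mass e Q c j \<le> real (Suc j) * e * (\<Sum>p\<in>prime_cell e Q c j. 1 / real p)"
  unfolding cell_mass_def sum_distrib_left
  by (intro sum_mono) (auto simp: prime_cell_def intro!: divide_right_mono)

text \<open>A heavy cell in window \<open>k\<close> has reciprocal sum at least a constant over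
  \<open>k + 1\<close>. By divergence of the harmonic series these bounds have arbitrarily large
  sum, and since there are only finitely many pairs \<open>(c, s)\<close>, some pair keeps a large
  share. The bound itself serves as common weight \<open>t j\<close> of both matched cells.\<close>

lemma matched_prime_cells:
  assumes Q: "Q > 0" and R: "R = 800 * Q" and d: "0 < d" "d \<le> 1" and L: "L > 0"
    and e: "e = d / real (L * R)"
  shows "\<exists>c s J t. s \<in> {L..<L*R} \<and> finite J \<and> 
      (\<forall>j\<in>J. 0 < t j \<and> t j \<le> (\<Sum>p\<in>prime_cell e Q c j. 1 / real p)
                 \<and> t j \<le> (\<Sum>p\<in>prime_cell e Q c (j + s). 1 / real p)) \<and> (B::real) \<le> (\<Sum>j\<in>J. t j)"
proof -
  obtain K0 where K0: "\<And>M N. 1 \<le> M \<Longrightarrow> M \<le> N \<Longrightarrow>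
      \<bar>(\<Sum>p\<in>{p\<in>{M<..N}. prime p}. ln (real p) / real p) - (ln (real N) - ln (real M))\<bar> \<le> K0"
    using mertens_primes by blast
  have K0': "K0 \<ge> 0" using K0[of 1 1] by simp
  obtain G :: nat where "real G \<ge> 2 * (K0 + 1) / d" using real_arch_simple by blast
  hence G: "real G * d \<ge> 2 * (K0 + 1)" using d by (simp add: field_simps)
  define M where "M = L * R"
  define W where "W = G * M"
  have M0: "M > 0" using L R Q by (simp add: M_def)
  have G0: "G > 0" using G d K0' by (cases G) auto
  have W0: "W > 0" using M0 G0 by (simp add: W_def)
  have e0: "e > 0" using e d M0 by (simp add: M_def)
  define mu where "mu = d / (8 * real Q * real M)"
  have mu0: "mu > 0" using d Q M0 by (simp add: mu_def)
  let ?good = "\<lambda>k c s j. c < Q \<and> s \<in> {L..<M} \<and> j \<in> {k*W..<Suc k*W} \<and> j + s < Suc k*W \<and>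
      mu \<le> cell_mass e Q c j \<and> mu \<le> cell_mass e Q c (j + s)"
  have "eventually (\<lambda>k. \<exists>c<Q. \<exists>s\<in>{L..<L*R}. \<exists>j\<in>{k*(G*(L*R))..<Suc k*(G*(L*R))}. j + s < Suc k*(G*(L*R)) \<and>
      d / (8 * real Q * real (L * R)) \<le> cell_mass e Q c j \<and>
      d / (8 * real Q * real (L * R)) \<le> cell_mass e Q c (j + s)) sequentially"
    by (rule heavy_cells_in_window[OF Q R d L e K0' _ G]) (rule K0)
  hence "eventually (\<lambda>k. \<exists>c s j. ?good k c s j) sequentially"
    unfolding M_def[symmetric] W_def[symmetric] mu_def[symmetric]
    by (rule eventually_mono) blast
  then obtain k0 where "\<And>k. k \<ge> k0 \<Longrightarrow> \<exists>c s j. ?good k c s j"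
    unfolding eventually_sequentially by blast
  then obtain c s j where csj: "\<And>k. k \<ge> k0 \<Longrightarrow> ?good k (c k) (s k) (j k)"
    by metis
  define tau where "tau k = mu / (real W * e) / real (Suc k)" for k
  have tau0: "tau k > 0" for k unfolding tau_def using mu0 W0 e0 by simp
  have tau_le: "tau k \<le> (\<Sum>p\<in>prime_cell e Q c i. 1 / real p)"
    if "mu \<le> cell_mass e Q c i" "i < Suc k * W" for k c i
  proof -
    let ?S = "\<Sum>p\<in>prime_cell e Q c i. 1 / real p"
    have S0: "?S \<ge> 0" by (intro sum_nonneg) auto
    have "mu \<le> real (Suc i) * e * ?S" using that(1) cell_mass_imp_reciprocal_sum[OF e0] by (rule order.trans)
    also have "\<dots> \<le> real (Suc k * W) * e * ?S"
      using that(2) S0 e0 by (intro mult_right_mono of_nat_mono) auto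
    finally have "mu \<le> (real W * e * real (Suc k)) * ?S" by (simp only: of_nat_mult mult_ac)
    thus ?thesis unfolding tau_def using W0 e0 by (simp add: field_simps del: of_nat_Suc)
  qed
  have "\<exists>K. B * real (Q * M) \<le> (\<Sum>k<K. tau (k0 + k))"
  proof (rule ccontr)
    assume no: "\<not> ?thesis"
    have ns: "\<not> summable (\<lambda>k. tau (k0 + k))"
    proof
      assume "summable (\<lambda>k. tau (k0 + k))"
      hence "summable (\<lambda>k. tau (k + k0))" by (simp add: add.commute)
      hence "summable tau" by (subst (asm) summable_iff_shift)
      hence "summable (\<lambda>k. (real W * e / mu) * tau k)" by (rule summable_mult)
      hence "summable (\<lambda>k. 1 / real (Suc k))" unfolding tau_def using mu0 W0 e0 by (simp del: of_nat_Suc)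
      hence "summable (\<lambda>k. inverse (real k))"
        by (subst (asm) inverse_eq_divide[symmetric], subst (asm) summable_Suc_iff)
      thus False using not_summable_harmonic by blast
    qed
    have "summable (\<lambda>k. tau (k0 + k))"
    proof (rule bounded_imp_summable)
      show "(\<Sum>k\<le>n. tau (k0 + k)) \<le> B * real (Q * M)" for n
        using no by (metis lessThan_Suc_atMost linear)
    qed (use tau0 in \<open>auto intro: less_imp_le\<close>)
    with ns show False by blast
  qed
  then obtain K where K: "(\<Sum>k<K. tau (k0 + k)) \<ge> B * real (Q * M)" by blast
  define A where "A = {k0..<k0+K}"
  have sumA: "(\<Sum>k\<in>A. tau k) \<ge> B * real (Q * M)"
  proof -
    have "(\<Sum>k\<in>A. tau k) = (\<Sum>k<K. tau (k0 + k))" unfolding A_def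
      by (rule sum.reindex_bij_witness[where i = "\<lambda>k. k0 + k" and j = "\<lambda>k. k - k0"]) auto
    thus ?thesis using K by simp
  qed
  have good: "?good k (c k) (s k) (j k)" if "k \<in> A" for k using csj that by (auto simp: A_def)
  have "\<exists>l\<in>{..<Q} \<times> {..<M}. B \<le> (\<Sum>k\<in>{k\<in>A. (c k, s k) = l}. tau k)"
  proof (rule ccontr)
    assume "\<not> ?thesis"
    hence lt: "\<And>l. l \<in> {..<Q} \<times> {..<M} \<Longrightarrow> (\<Sum>k\<in>{k\<in>A. (c k, s k) = l}. tau k) < B" by (meson not_le)
    have "(\<Sum>k\<in>A. tau k) = (\<Sum>l\<in>{..<Q} \<times> {..<M}. \<Sum>k\<in>{k\<in>A. (c k, s k) = l}. tau k)"
      by (rule sum.group[symmetric]) (use good in \<open>auto simp: A_def\<close>)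
    also have "\<dots> < (\<Sum>l\<in>{..<Q} \<times> {..<M}. B)"
      by (rule sum_strict_mono) (use lt Q M0 in auto)
    also have "\<dots> = B * real (Q * M)" by simp
    finally show False using sumA by linarith
  qed
  then obtain c0 s0 where cs: "c0 < Q" "s0 < M" "B \<le> (\<Sum>k\<in>{k\<in>A. (c k, s k) = (c0, s0)}. tau k)" by auto
  define A' where "A' = {k\<in>A. (c k, s k) = (c0, s0)}"
  \<comment> \<open>The window index can be read off from the cell, so different windows give
    different cells and the weight becomes a function of the cell alone.\<close>
  have jdiv: "j k div W = k" if "k \<in> A'" for k
  proof -
    have "k * W \<le> j k" "j k < Suc k * W" using good[of k] that by (auto simp: A'_def)
    thus ?thesis using W0 by (metis div_nat_eqI mult.commute)
  qed
  have inj: "inj_on j A'" using jdiv by (metis inj_onI)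
  show ?thesis
  proof (cases "A' = {}")
    case True
    hence "B \<le> 0" using cs(3) unfolding A'_def[symmetric] by simp
    moreover have "L \<in> {L..<L*R}" using L R Q by simp
    ultimately show ?thesis by (intro exI[of _ 0] exI[of _ L] exI[of _ "{}"]) auto
  next
    case False
    then obtain k where "k \<in> A'" by blast
    hence s0: "s0 \<in> {L..<L*R}" using good[of k] by (auto simp: A'_def M_def)
    show ?thesis
    proof (intro exI conjI ballI)
      show "s0 \<in> {L..<L*R}" by (rule s0)
      show "finite (j ` A')" by (auto simp: A'_def A_def)
      have "(\<Sum>i\<in>j ` A'. tau (i div W)) = (\<Sum>k\<in>A'. tau (j k div W))"
        using inj by (subst sum.reindex) auto
      also have "\<dots> = (\<Sum>k\<in>A'. tau k)" using jdiv by (intro sum.cong) auto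
      finally show "B \<le> (\<Sum>i\<in>j ` A'. tau (i div W))" using cs(3) by (simp add: A'_def)
      fix i assume "i \<in> j ` A'"
      then obtain k where k: "k \<in> A'" "i = j k" by blast
      have g: "?good k c0 s0 i" using good[of k] k by (auto simp: A'_def)
      show "0 < tau (i div W)" by (rule tau0)
      show "tau (i div W) \<le> (\<Sum>p\<in>prime_cell e Q c0 i. 1 / real p)"
        using g unfolding k(2) jdiv[OF k(1)] by (intro tau_le) auto
      show "tau (i div W) \<le> (\<Sum>p\<in>prime_cell e Q c0 (i + s0). 1 / real p)"
        using g unfolding k(2) jdiv[OF k(1)] by (intro tau_le) auto
    qed
  qed
qed

text \<open>This lets one prime \<open>q\<close> represent all primes of its class, so that averages
  for different cells involve the same function.\<close>

definition class_invariant :: "nat \<Rightarrow> (nat \<Rightarrow> complex) \<Rightarrow> bool" where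
  "class_invariant Q h \<longleftrightarrow> (\<forall>p q m. prime p \<longrightarrow> prime q \<longrightarrow> p mod Q = q mod Q \<longrightarrow> m > 0 \<longrightarrow> h (p * m) = h (q * m))"

lemma avg_cong: "(\<And>n. n > 0 \<Longrightarrow> h n = h' n) \<Longrightarrow> avg h x = avg h' x"
  unfolding avg_def by (intro arg_cong2[of _ _ _ _ "(/)"] sum.cong) auto

text \<open>The term \<open>sqrt (2 / T)\<close>, with \<open>T\<close> the sum of the
  \<open>t j\<close>, is the Turan-Kubilius error. The term \<open>3 * e\<close> comes from
  replacing every prime of a cell by the left end of the cell. The resulting mean depends on
  \<open>s\<close> only through the scales.\<close>

lemma avg_via_cells:
  assumes e: "e > 0" and J: "finite J"
    and t: "\<And>j. j \<in> J \<Longrightarrow> 0 < t j" "\<And>j. j \<in> J \<Longrightarrow> t j \<le> (\<Sum>p\<in>prime_cell e Q c (j + s). 1 / real p)"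
    and B: "(\<Sum>j\<in>J. t j) > 0"
    and h: "\<And>n. norm (h n) \<le> 1" and inv: "class_invariant Q h"
    and q: "prime q" "q mod Q = c"
  shows "eventually (\<lambda>x. norm (avg h x - (\<Sum>j\<in>J. of_real (t j) * avg (\<lambda>m. h (q * m)) (x / exp (real (j + s) * e))) / of_real (\<Sum>j\<in>J. t j))
            \<le> sqrt (2 / (\<Sum>j\<in>J. t j)) + 3 * e) at_top"
proof -
  define C where "C j = prime_cell e Q c (j + s)" for j
  define m where "m j = (\<Sum>p\<in>C j. 1 / real p)" for j
  define B where "B = (\<Sum>j\<in>J. t j)"
  define P where "P = (\<Union>j\<in>J. C j)"
  \<comment> \<open>With this weight cell \<open>j\<close> has reciprocal mass exactly
    \<open>t j\<close>, whatever its true mass \<open>m j \<ge> t j\<close> is.\<close>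
  define w where "w p = (\<Sum>j\<in>J. if p \<in> C j then t j / m j else 0)" for p
  define y where "y j = exp (real (j + s) * e)" for j
  define h' where "h' = (\<lambda>m. h (q * m))"
  have h': "norm (h' n) \<le> 1" for n by (simp add: h'_def h)
  have Cb: "y j < real p" "real p \<le> y j * exp e" "prime p" "p mod Q = c" if "p \<in> C j" for p j
    using prime_cell_bounds[OF that[unfolded C_def]] by (auto simp: y_def)
  have finC: "finite (C j)" for j by (simp add: C_def)
  have disj: "j = j'" if "p \<in> C j" "p \<in> C j'" for p j j'
    using that prime_cell_disjoint[OF e, of "j + s" "j' + s" Q c c] by (auto simp: C_def)
  have m: "0 < m j" "t j \<le> m j" if "j \<in> J" for j
    using t[OF that] by (auto simp: m_def C_def)
  have w_eq: "w p = t j / m j" if "j \<in> J" "p \<in> C j" for p j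
  proof -
    have "w p = (\<Sum>i\<in>J. if i = j then t j / m j else 0)"
      unfolding w_def using disj that by (intro sum.cong) auto
    thus ?thesis using that J by simp
  qed
  have sumP: "(\<Sum>p\<in>P. F p) = (\<Sum>j\<in>J. \<Sum>p\<in>C j. F p)" for F :: "nat \<Rightarrow> 'b::comm_monoid_add"
    unfolding P_def by (rule sum.UNION_disjoint) (use J finC disj in blast)+
  have finP: "finite P" using J finC by (auto simp: P_def)
  have BH: "B = (\<Sum>p\<in>P. w p / real p)"
  proof -
    have "(\<Sum>p\<in>P. w p / real p) = (\<Sum>j\<in>J. \<Sum>p\<in>C j. t j / m j * (1 / real p))"
      unfolding sumP by (intro sum.cong refl) (simp add: w_eq)
    also have "\<dots> = (\<Sum>j\<in>J. t j / m j * m j)" unfolding m_def by (simp only: sum_distrib_left)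
    also have "\<dots> = B" unfolding B_def using m by (intro sum.cong refl) (simp add: less_imp_neq[symmetric])
    finally show ?thesis ..
  qed
  have w01: "0 \<le> w p" "w p \<le> 1" if pP: "p \<in> P" for p
  proof -
    obtain j where j: "j \<in> J" "p \<in> C j" using pP by (auto simp: P_def)
    show "0 \<le> w p" "w p \<le> 1" using t(1)[OF j(1)] m[OF j(1)] by (auto simp: w_eq[OF j])
  qed
  have primeP: "prime p" if "p \<in> P" for p using that Cb(3) by (auto simp: P_def)
  have "eventually (\<lambda>x. \<forall>j\<in>J. x \<ge> y j / e) at_top"
    using J by (auto intro!: eventually_ball_finite eventually_ge_at_top)
  moreover have "eventually (\<lambda>x. x \<ge> 2 * real (card P)) at_top" by (rule eventually_ge_at_top)
  moreover have "eventually (\<lambda>x::real. x > 0) at_top" by (rule eventually_gt_at_top)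
  ultimately show ?thesis
  proof eventually_elim
    case (elim x)
    have B0: "B > 0" using B by (simp add: B_def)
    have 1: "norm (avg h x - (\<Sum>p\<in>P. of_real (w p / real p) * avg (\<lambda>m. h (p * m)) (x / real p)) / of_real B) \<le> sqrt (2 / B)"
      by (rule weighted_turan_kubilius[OF finP primeP w01 BH B0 h]) (use elim in auto)
    have 2: "norm ((\<Sum>p\<in>P. of_real (w p / real p) * avg (\<lambda>m. h (p * m)) (x / real p)) - (\<Sum>j\<in>J. of_real (t j) * avg h' (x / y j))) \<le> B * (3 * e)"
    proof -
      have "(\<Sum>j\<in>J. of_real (t j) * avg h' (x / y j)) = (\<Sum>j\<in>J. \<Sum>p\<in>C j. of_real (w p / real p) * avg h' (x / y j))"
      proof (rule sum.cong[OF refl])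
        fix j assume j: "j \<in> J"
        have "(\<Sum>p\<in>C j. of_real (w p / real p) * avg h' (x / y j)) = of_real (\<Sum>p\<in>C j. t j / m j * (1 / real p)) * avg h' (x / y j)"
          unfolding of_real_sum sum_distrib_right by (intro sum.cong refl) (simp add: w_eq[OF j])
        also have "(\<Sum>p\<in>C j. t j / m j * (1 / real p)) = t j / m j * m j" unfolding m_def by (simp only: sum_distrib_left)
        also have "\<dots> = t j" using m[OF j] by simp
        finally show "of_real (t j) * avg h' (x / y j) = (\<Sum>p\<in>C j. of_real (w p / real p) * avg h' (x / y j))" ..
      qed
      hence "norm ((\<Sum>p\<in>P. of_real (w p / real p) * avg (\<lambda>m. h (p * m)) (x / real p)) - (\<Sum>j\<in>J. of_real (t j) * avg h' (x / y j)))
         = norm (\<Sum>j\<in>J. \<Sum>p\<in>C j. of_real (w p / real p) * (avg (\<lambda>m. h (p * m)) (x / real p) - avg h' (x / y j)))"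
        unfolding sumP by (simp only: sum_subtractf right_diff_distrib)
      also have "\<dots> \<le> (\<Sum>j\<in>J. \<Sum>p\<in>C j. w p / real p * (3 * e))"
      proof (intro order.trans[OF norm_sum] sum_mono)
        fix j p assume j: "j \<in> J" and p: "p \<in> C j"
        have pP: "p \<in> P" using j p by (auto simp: P_def)
        have pos: "real p > 0" "y j > 0" using Cb(3)[OF p] by (auto simp: y_def prime_gt_0_nat)
        have "avg (\<lambda>m. h (p * m)) (x / real p) = avg h' (x / real p)"
        proof (rule avg_cong)
          fix n :: nat assume "n > 0"
          thus "h (p * n) = h' n" using inv q Cb[OF p] unfolding class_invariant_def h'_def by metis
        qed
        moreover have "norm (avg h' (x / y j) - avg h' (x / real p)) \<le> 2 * e + 1 / (x / y j)"
        proof (rule norm_avg_diff_exp_le[OF h'])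
          show "0 < x / real p" using elim pos by simp
          show "x / real p \<le> x / y j" using elim pos Cb(1)[OF p] by (intro divide_left_mono) auto
          have "x * real p \<le> x * (y j * exp e)" using elim Cb(2)[OF p] by (intro mult_left_mono) auto
          thus "x / y j \<le> x / real p * exp e" using pos by (simp add: field_simps)
        qed
        moreover have "1 / (x / y j) \<le> e"
        proof -
          have "y j / e \<le> x" using elim j by blast
          thus ?thesis using elim e by (simp add: field_simps)
        qed
        ultimately have "norm (avg (\<lambda>m. h (p * m)) (x / real p) - avg h' (x / y j)) \<le> 3 * e"
          by (simp add: norm_minus_commute)
        hence "(w p / real p) * norm (avg (\<lambda>m. h (p * m)) (x / real p) - avg h' (x / y j)) \<le> w p / real p * (3 * e)"
          using w01(1)[OF pP] pos by (intro mult_left_mono) auto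
        moreover have "\<bar>w p / real p\<bar> = w p / real p" using w01(1)[OF pP] by simp
        ultimately show "norm (of_real (w p / real p) * (avg (\<lambda>m. h (p * m)) (x / real p) - avg h' (x / y j))) \<le> w p / real p * (3 * e)"
          unfolding norm_mult norm_of_real by (simp only:)
      qed
      also have "\<dots> = B * (3 * e)" unfolding BH sumP by (simp only: sum_distrib_right)
      finally show ?thesis .
    qed
    let ?X = "\<Sum>p\<in>P. of_real (w p / real p) * avg (\<lambda>m. h (p * m)) (x / real p)"
    let ?Y = "\<Sum>j\<in>J. of_real (t j) * avg h' (x / y j)"
    have "norm (?X / of_real B - ?Y / of_real B) \<le> 3 * e"
    proof -
      have "norm (?X / of_real B - ?Y / of_real B) = norm (?X - ?Y) / B"
        unfolding diff_divide_distrib[symmetric] norm_divide using B0 by simp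
      also have "\<dots> \<le> B * (3 * e) / B" using 2 B0 by (intro divide_right_mono) auto
      finally show ?thesis using B0 by simp
    qed
    with 1 have "norm (avg h x - ?Y / of_real B) \<le> sqrt (2 / B) + 3 * e"
      by (rule norm_diff_triangle_le)
    thus ?case unfolding B_def y_def h'_def .
  qed
qed

text \<open>Both matched families express the average at \<open>x\<close> through one functional
  \<open>F\<close>, evaluated at \<open>x\<close> for the cells \<open>j\<close> and at
  \<open>x * exp (-\<sigma>)\<close> for the cells \<open>j + s\<close>. Applying the first
  expression also at \<open>x * exp (-\<sigma>)\<close> compares the two averages.\<close>

lemma shift_invariance:
  assumes Q: "Q > 0" and R: "R = 800 * Q" and d: "0 < d" "d \<le> 1" and eta: "eta > 0"
    and h: "\<And>n. norm (h n) \<le> 1" and inv: "class_invariant Q h"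
  shows "\<exists>\<sigma>\<ge>d / real R. \<sigma> \<le> d \<and> eventually (\<lambda>x. norm (avg h x - avg h (x * exp (-\<sigma>))) \<le> eta) at_top"
proof -
  \<comment> \<open>This makes \<open>3 * e \<le> eta / 4\<close>. The mass
    \<open>32 / eta^2\<close> required below makes the Turan-Kubilius error at most
    \<open>eta / 4\<close> as well, and the pair of errors occurs twice.\<close>
  obtain L :: nat where "real L \<ge> 12 * d / eta + 1" using real_arch_simple by blast
  moreover have "12 * d / eta > 0" using d eta by simp
  ultimately have Lr: "real L \<ge> 12 * d / eta" "real L > 0" by linarith+
  have L0: "L > 0" using Lr by simp
  define e where "e = d / real (L * R)"
  have R1: "real R \<ge> 1" using R Q by simp
  have e0: "e > 0" using d L0 R1 by (simp add: e_def)
  have e_le: "e \<le> eta / 12"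
  proof -
    have "e \<le> d / real L" unfolding e_def using d L0 R1 by (intro divide_left_mono) auto
    also have "\<dots> \<le> eta / 12" using Lr eta by (simp add: field_simps)
    finally show ?thesis .
  qed
  obtain c s J t where s: "s \<in> {L..<L*R}" and J: "finite J" and
    t: "\<And>j. j \<in> J \<Longrightarrow> 0 < t j" "\<And>j. j \<in> J \<Longrightarrow> t j \<le> (\<Sum>p\<in>prime_cell e Q c j. 1 / real p)"
       "\<And>j. j \<in> J \<Longrightarrow> t j \<le> (\<Sum>p\<in>prime_cell e Q c (j + s). 1 / real p)" and
    B: "32 / eta\<^sup>2 \<le> (\<Sum>j\<in>J. t j)"
    using matched_prime_cells[OF Q R d L0 e_def, of "32 / eta\<^sup>2"] by blast
  define T where "T = (\<Sum>j\<in>J. t j)"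
  have B0: "32 / eta\<^sup>2 > 0" using eta by simp
  have T0: "T > 0" using B B0 unfolding T_def by linarith
  have sq: "sqrt (2 / T) \<le> eta / 4"
  proof -
    have "2 / T \<le> 2 / (32 / eta\<^sup>2)" using B B0 T0 unfolding T_def by (intro divide_left_mono) auto
    also have "\<dots> = (eta / 4)\<^sup>2" using eta by (simp add: power2_eq_square)
    finally show ?thesis using eta by (intro real_le_lsqrt) auto
  qed
  have "J \<noteq> {}" using T0 by (auto simp: T_def)
  then obtain j0 where j0: "j0 \<in> J" by blast
  have "prime_cell e Q c j0 \<noteq> {}" using t(1)[OF j0] t(2)[OF j0] by auto
  then obtain q where "q \<in> prime_cell e Q c j0" by blast
  hence q: "prime q" "q mod Q = c" using prime_cell_bounds by blast+
  define F where "F x = (\<Sum>j\<in>J. of_real (t j) * avg (\<lambda>m. h (q * m)) (x / exp (real j * e))) / of_real T" for x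
  define \<sigma> where "\<sigma> = real s * e"
  have "eventually (\<lambda>x. norm (avg h x - (\<Sum>j\<in>J. of_real (t j) * avg (\<lambda>m. h (q * m)) (x / exp (real (j + 0) * e))) / of_real T) \<le> sqrt (2 / T) + 3 * e) at_top"
    unfolding T_def by (rule avg_via_cells[OF e0 J t(1) _ _ h inv q]) (use T0 t(2) in \<open>auto simp: T_def\<close>)
  hence ev1: "eventually (\<lambda>x. norm (avg h x - F x) \<le> sqrt (2 / T) + 3 * e) at_top"
    unfolding F_def by simp
  have "eventually (\<lambda>x. norm (avg h x - (\<Sum>j\<in>J. of_real (t j) * avg (\<lambda>m. h (q * m)) (x / exp (real (j + s) * e))) / of_real T) \<le> sqrt (2 / T) + 3 * e) at_top"
    unfolding T_def by (rule avg_via_cells[OF e0 J t(1) t(3) _ h inv q]) (use T0 in \<open>auto simp: T_def\<close>)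
  hence ev2: "eventually (\<lambda>x. norm (avg h x - F (x * exp (-\<sigma>))) \<le> sqrt (2 / T) + 3 * e) at_top"
  proof (rule eventually_mono)
    fix x
    have "x / exp (real (j + s) * e) = x * exp (-\<sigma>) / exp (real j * e)" for j
      unfolding \<sigma>_def by (simp add: distrib_right exp_add exp_minus field_simps)
    thus "norm (avg h x - F (x * exp (-\<sigma>))) \<le> sqrt (2 / T) + 3 * e"
      if "norm (avg h x - (\<Sum>j\<in>J. of_real (t j) * avg (\<lambda>m. h (q * m)) (x / exp (real (j + s) * e))) / of_real T) \<le> sqrt (2 / T) + 3 * e"
      using that unfolding F_def by (simp only:)
  qed
  have "filterlim (\<lambda>x. x * exp (-\<sigma>)) at_top at_top"
    by (rule filterlim_at_top_mult_tendsto_pos[OF tendsto_const]) (auto intro: filterlim_ident)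
  hence "eventually (\<lambda>x. norm (avg h (x * exp (-\<sigma>)) - F (x * exp (-\<sigma>))) \<le> sqrt (2 / T) + 3 * e) at_top"
    by (rule eventually_compose_filterlim[OF ev1])
  with ev2 have "eventually (\<lambda>x. norm (avg h x - avg h (x * exp (-\<sigma>))) \<le> eta) at_top"
  proof eventually_elim
    case (elim x)
    have "norm (avg h x - avg h (x * exp (-\<sigma>))) \<le> (sqrt (2 / T) + 3 * e) + (sqrt (2 / T) + 3 * e)"
      by (rule norm_diff_triangle_le[OF elim(1)]) (use elim(2) in \<open>simp add: norm_minus_commute\<close>)
    thus ?case using sq e_le by linarith
  qed
  moreover have "d / real R \<le> \<sigma>"
  proof -
    have "d / real R = real L * e" using L0 by (simp add: e_def)
    also have "\<dots> \<le> \<sigma>" unfolding \<sigma>_def using s e0 by (intro mult_right_mono) auto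
    finally show ?thesis .
  qed
  moreover have "\<sigma> \<le> d"
  proof -
    have "\<sigma> \<le> real (L * R) * e" unfolding \<sigma>_def using s e0 by (intro mult_right_mono of_nat_mono) auto
    also have "\<dots> = d" using L0 R1 by (simp add: e_def)
    finally show ?thesis .
  qed
  ultimately show ?thesis by blast
qed

text \<open>Iterate the step by \<open>exp (-\<sigma>)\<close> down to the last scale not below
  \<open>y\<close>; the remaining factor is at most \<open>exp \<sigma>\<close> and is bridged
  trivially at cost \<open>2 * \<sigma>\<close> plus a vanishing term.\<close>

theorem scale_invariance:
  assumes Q: "Q > 0" and h: "\<And>n. norm (h n) \<le> 1" and inv: "class_invariant Q h"
    and eps: "eps > 0" and W: "W \<ge> 0"
  shows "eventually (\<lambda>x. \<forall>y. x * exp (-W) \<le> y \<and> y \<le> x \<longrightarrow> norm (avg h x - avg h y) \<le> eps) at_top"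
proof -
  define d where "d = min 1 (eps / 8)"
  have d: "0 < d" "d \<le> 1" "d \<le> eps / 8" using eps by (auto simp: d_def)
  define R where "R = 800 * Q"
  have R0: "real R > 0" using Q by (simp add: R_def)
  \<comment> \<open>A bound on the number of steps that uses only
    \<open>\<sigma> \<ge> d / R\<close>; hence \<open>eta\<close> may depend on it although
    \<open>\<sigma>\<close> depends on \<open>eta\<close>.\<close>
  define m where "m = nat \<lceil>W * real R / d\<rceil>"
  define eta where "eta = eps / (4 * (real m + 1))"
  have eta: "eta > 0" using eps by (simp add: eta_def)
  obtain \<sigma> where \<sigma>: "d / real R \<le> \<sigma>" "\<sigma> \<le> d"
    and ev: "eventually (\<lambda>x. norm (avg h x - avg h (x * exp (-\<sigma>))) \<le> eta) at_top"
    using shift_invariance[OF Q R_def d(1,2) eta h inv] by blast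
  obtain x1 where x1: "\<And>x. x \<ge> x1 \<Longrightarrow> norm (avg h x - avg h (x * exp (-\<sigma>))) \<le> eta"
    using ev unfolding eventually_at_top_linorder by blast
  have "d / real R > 0" using d R0 by simp
  hence \<sigma>0: "\<sigma> > 0" using \<sigma> by linarith
  have "filterlim (\<lambda>x. x * exp (-W)) at_top at_top"
    by (rule filterlim_at_top_mult_tendsto_pos[OF tendsto_const]) (auto intro: filterlim_ident)
  hence "eventually (\<lambda>x. x * exp (-W) \<ge> max x1 (4 / eps)) at_top"
    unfolding filterlim_at_top by blast
  thus ?thesis
  proof eventually_elim
    case (elim x)
    show ?case
    proof (intro allI impI)
      fix y assume y: "x * exp (-W) \<le> y \<and> y \<le> x"
      have yx1: "y \<ge> x1" "y \<ge> 4 / eps" using elim y by auto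
      have "4 / eps > 0" using eps by simp
      hence y0: "y > 0" using yx1 by linarith
      have x0: "x > 0" using y0 y by linarith
      define l where "l = ln (x / y)"
      have l: "0 \<le> l" "l \<le> W"
      proof -
        show "0 \<le> l" unfolding l_def using y y0 x0 by simp
        have "x / y \<le> exp W" using y y0 by (simp add: exp_minus field_simps)
        hence "l \<le> ln (exp W)" unfolding l_def using x0 y0 by (subst ln_le_cancel_iff) auto
        thus "l \<le> W" by simp
      qed
      define i where "i = nat \<lfloor>l / \<sigma>\<rfloor>"
      have i: "real i \<le> l / \<sigma>" "l / \<sigma> < real i + 1"
      proof -
        have "l / \<sigma> \<ge> 0" using l \<sigma>0 by simp
        thus "real i \<le> l / \<sigma>" "l / \<sigma> < real i + 1" unfolding i_def by (auto simp: of_nat_floor)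
      qed
      have il: "real i * \<sigma> \<le> l" "l \<le> real i * \<sigma> + \<sigma>" using i \<sigma>0 by (auto simp: field_simps)
      have im: "real i \<le> real m"
      proof -
        have "l / \<sigma> \<le> W / (d / real R)" using l \<sigma> \<open>d / real R > 0\<close> by (intro frac_le) auto
        also have "\<dots> = W * real R / d" by simp
        also have "\<dots> \<le> real m" unfolding m_def by linarith
        finally show ?thesis using i by linarith
      qed
      have xy: "x = y * exp l" using x0 y0 by (simp add: l_def)
      have ge: "x * exp (- (real k * \<sigma>)) \<ge> y" if "k \<le> i" for k
      proof -
        have "real k * \<sigma> \<le> real i * \<sigma>" using that \<sigma>0 by simp
        hence "exp (l - real k * \<sigma>) \<ge> 1" using il by simp
        hence "y * 1 \<le> y * exp (l - real k * \<sigma>)" using y0 by (intro mult_left_mono) auto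
        thus ?thesis unfolding xy by (simp add: exp_diff exp_minus field_simps)
      qed
      have step: "norm (avg h x - avg h (x * exp (- (real k * \<sigma>)))) \<le> real k * eta" if "k \<le> i" for k
        using that
      proof (induction k)
        case (Suc k)
        let ?z = "x * exp (- (real k * \<sigma>))"
        have "?z \<ge> x1" using ge[of k] Suc.prems yx1 by simp
        moreover have "?z * exp (-\<sigma>) = x * exp (- (real (Suc k) * \<sigma>))"
        proof -
          have "- (real (Suc k) * \<sigma>) = - (real k * \<sigma>) + - \<sigma>" by (simp add: algebra_simps)
          thus ?thesis by (simp only: exp_add mult.assoc)
        qed
        ultimately have "norm (avg h ?z - avg h (x * exp (- (real (Suc k) * \<sigma>)))) \<le> eta"
          using x1[of ?z] by (simp only:)
        moreover have "norm (avg h x - avg h ?z) \<le> real k * eta" using Suc by simp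
        ultimately have "norm (avg h x - avg h (x * exp (- (real (Suc k) * \<sigma>)))) \<le> real k * eta + eta"
          by (rule norm_diff_triangle_le[rotated])
        thus ?case by (simp add: algebra_simps)
      qed simp
      define z where "z = x * exp (- (real i * \<sigma>))"
      have zy: "z \<ge> y" unfolding z_def by (rule ge) simp
      have "norm (avg h x - avg h z) \<le> real i * eta" unfolding z_def by (rule step) simp
      also have "\<dots> \<le> (real m + 1) * eta" using im eta by (intro mult_right_mono) auto
      also have "\<dots> = eps / 4"
      proof -
        have "a * (eps / (4 * a)) = eps / 4" if "a \<noteq> 0" for a :: real using that by simp
        moreover have "real m + 1 \<noteq> 0" by linarith
        ultimately show ?thesis unfolding eta_def by blast
      qed
      finally have 1: "norm (avg h x - avg h z) \<le> eps / 4" .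
      have "norm (avg h z - avg h y) \<le> 2 * \<sigma> + 1 / z"
      proof (rule norm_avg_diff_exp_le[OF h y0 zy])
        have "exp (l - real i * \<sigma>) \<le> exp \<sigma>" using il by simp
        hence "y * exp (l - real i * \<sigma>) \<le> y * exp \<sigma>" using y0 by (intro mult_left_mono) auto
        thus "z \<le> y * exp \<sigma>" unfolding z_def xy by (simp add: exp_diff exp_minus field_simps)
      qed
      moreover have "1 / z \<le> eps / 4"
      proof -
        have "1 / z \<le> 1 / (4 / eps)" using zy yx1 \<open>4 / eps > 0\<close> y0 by (intro divide_left_mono) auto
        thus ?thesis by simp
      qed
      ultimately have 2: "norm (avg h z - avg h y) \<le> eps / 2" using \<sigma> d by linarith
      have "norm (avg h x - avg h y) \<le> eps / 4 + eps / 2" by (rule norm_diff_triangle_le[OF 1 2])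
      thus "norm (avg h x - avg h y) \<le> eps" using eps by linarith
    qed
  qed
qed

section \<open>Shift invariance\<close>

lemma big_omega_prime_mult: "prime p \<Longrightarrow> m > 0 \<Longrightarrow> big_omega (p * m) = Suc (big_omega m)"
  unfolding big_omega_def by (subst prime_factorization_mult) (auto simp: prime_factorization_prime)

text \<open>Otherwise the sum of \<open>ln p / p\<close> up to \<open>N\<close> would be
  \<open>o(ln N)\<close>, against Mertens.\<close>

lemma not_summable_prime_reciprocals: "\<not> summable (\<lambda>p::nat. if prime p then 1 / real p else 0)"
proof
  assume "summable (\<lambda>p::nat. if prime p then 1 / real p else 0)"
  hence lim: "(\<lambda>N. (\<Sum>n=1..N. (if prime n then 1 / real n else 0) * ln (real n)) / ln (real N)) \<longlonglongrightarrow> 0"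
    by (intro summable_imp_ln_weighted_sum_small) auto
  obtain K where K: "\<And>M N. 1 \<le> M \<Longrightarrow> M \<le> N \<Longrightarrow>
    \<bar>(\<Sum>p\<in>{p\<in>{M<..N}. prime p}. ln (real p) / real p) - (ln (real N) - ln (real M))\<bar> \<le> K"
    using mertens_primes by blast
  have "eventually (\<lambda>N. 1 - K / ln (real N) \<le> (\<Sum>n=1..N. (if prime n then 1 / real n else 0) * ln (real n)) / ln (real N)) sequentially"
    using eventually_ge_at_top[of 2]
  proof eventually_elim
    case (elim N)
    hence ln: "ln (real N) > 0" by simp
    have "ln (real N) - K \<le> (\<Sum>p\<in>{p\<in>{1<..N}. prime p}. ln (real p) / real p)"
      using K[of 1 N] elim by simp
    also have "\<dots> \<le> (\<Sum>p\<in>{p\<in>{1..N}. prime p}. ln (real p) / real p)"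
      by (intro sum_mono2) auto
    also have "\<dots> = (\<Sum>n=1..N. if prime n then ln (real n) / real n else 0)"
      by (rule sum.inter_filter) auto
    also have "\<dots> = (\<Sum>n=1..N. (if prime n then 1 / real n else 0) * ln (real n))"
      by (intro sum.cong) auto
    finally have "(ln (real N) - K) / ln (real N) \<le> (\<Sum>n=1..N. (if prime n then 1 / real n else 0) * ln (real n)) / ln (real N)"
      using ln by (intro divide_right_mono) auto
    thus ?case using ln by (simp add: diff_divide_distrib)
  qed
  moreover have "(\<lambda>N. 1 - K / ln (real N)) \<longlonglongrightarrow> 1" by real_asymp
  ultimately have "(1::real) \<le> 0" using lim by (intro tendsto_le[OF sequentially_bot lim]) auto
  thus False by simp
qed

text \<open>The word unit refers to the bound \<open>1\<close> on the norm, not to units modulo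
  \<open>Q\<close>.\<close>

definition unit_periodic :: "nat \<Rightarrow> (nat \<Rightarrow> complex) \<Rightarrow> bool" where
  "unit_periodic Q \<phi> \<longleftrightarrow> (\<forall>n. \<phi> (n + Q) = \<phi> n) \<and> (\<forall>n. norm (\<phi> n) \<le> 1)"

lemma periodic_cong:
  assumes "\<And>n. \<phi> (n + Q) = \<phi> n" "[m = n] (mod Q)"
  shows "\<phi> m = \<phi> (n::nat)"
proof -
  have *: "\<phi> (n + k * Q) = \<phi> n" for k n
  proof (induction k)
    case (Suc k)
    have "\<phi> (n + Suc k * Q) = \<phi> ((n + k * Q) + Q)" by (simp add: algebra_simps)
    thus ?case using Suc assms(1) by simp
  qed simp
  have "\<phi> n = \<phi> (n mod Q)" for n using *[of "n mod Q" "n div Q"] by (simp add: add.commute)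
  thus ?thesis using assms(2) unfolding cong_def by metis
qed

lemma unit_periodic_mult: "unit_periodic Q \<phi> \<Longrightarrow> unit_periodic Q (\<lambda>n. \<phi> (y * n))"
proof -
  assume p: "unit_periodic Q \<phi>"
  have "\<phi> (y * (n + Q)) = \<phi> (y * n)" for n
    by (rule periodic_cong[where Q = Q]) (use p in \<open>auto simp: unit_periodic_def cong_def distrib_left\<close>)
  thus ?thesis using p by (simp add: unit_periodic_def)
qed

lemma class_invariant_omega:
  assumes "unit_periodic Q \<phi>"
  shows "class_invariant Q (\<lambda>n. \<phi> n * a (big_omega n))"
  unfolding class_invariant_def
proof (intro allI impI)
  fix p q m :: nat assume pq: "prime p" "prime q" "p mod Q = q mod Q" "m > 0"
  have "\<phi> (p * m) = \<phi> (q * m)"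
    by (rule periodic_cong[where Q = Q])
       (use assms pq in \<open>auto simp: unit_periodic_def intro: cong_scalar_right simp flip: cong_def\<close>)
  thus "\<phi> (p * m) * a (big_omega (p * m)) = \<phi> (q * m) * a (big_omega (q * m))"
    using pq by (simp add: big_omega_prime_mult)
qed

text \<open>A pair \<open>(y, l)\<close> stands for multiplying \<open>n\<close> by a product of
  \<open>l\<close> primes that is congruent to \<open>y\<close>. Quantifying over all
  \<open>\<phi>\<close> and \<open>a\<close> lets these relations compose: \<open>y\<close>
  multiplies while \<open>l\<close> adds.\<close>

definition shift_rel :: "nat \<Rightarrow> nat \<Rightarrow> nat \<Rightarrow> bool" where
  "shift_rel Q y l \<longleftrightarrow> (\<forall>\<phi> a. unit_periodic Q \<phi> \<longrightarrow> (\<forall>k. norm (a k) \<le> 1) \<longrightarrow>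
     ((\<lambda>x. avg (\<lambda>n. \<phi> n * a (big_omega n)) x - avg (\<lambda>n. \<phi> (y * n) * a (big_omega n + l)) x) \<longlongrightarrow> 0) at_top)"

lemma shift_relD:
  assumes "shift_rel Q y l" "unit_periodic Q \<phi>" "\<And>k. norm (a k) \<le> 1"
  shows "((\<lambda>x. avg (\<lambda>n. \<phi> n * a (big_omega n)) x - avg (\<lambda>n. \<phi> (y * n) * a (big_omega n + l)) x) \<longlongrightarrow> 0) at_top"
  using assms unfolding shift_rel_def by simp

lemma shift_rel_one: "shift_rel Q 1 0"
  by (simp add: shift_rel_def)

lemma shift_rel_cong: "[y = y'] (mod Q) \<Longrightarrow> shift_rel Q y l \<Longrightarrow> shift_rel Q y' l"
proof -
  assume y: "[y = y'] (mod Q)" and r: "shift_rel Q y l"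
  show ?thesis
    unfolding shift_rel_def
  proof (intro allI impI)
    fix \<phi> a assume p: "unit_periodic Q \<phi>" and a: "\<forall>k::nat. norm (a k :: complex) \<le> 1"
    have "\<phi> (y * n) = \<phi> (y' * n)" for n
      by (rule periodic_cong[where Q = Q]) (use p y in \<open>auto simp: unit_periodic_def intro: cong_scalar_right\<close>)
    hence "(\<lambda>n. \<phi> (y' * n) * a (big_omega n + l)) = (\<lambda>n. \<phi> (y * n) * a (big_omega n + l))" by simp
    thus "((\<lambda>x. avg (\<lambda>n. \<phi> n * a (big_omega n)) x - avg (\<lambda>n. \<phi> (y' * n) * a (big_omega n + l)) x) \<longlongrightarrow> 0) at_top"
      using r p a unfolding shift_rel_def by simp
  qed
qed

lemma shift_rel_mult:
  assumes "shift_rel Q y l" "shift_rel Q y' l'"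
  shows "shift_rel Q (y * y') (l + l')"
  unfolding shift_rel_def
proof (intro allI impI)
  fix \<phi> a assume p: "unit_periodic Q \<phi>" and a: "\<forall>k::nat. norm (a k :: complex) \<le> 1"
  have 1: "((\<lambda>x. avg (\<lambda>n. \<phi> n * a (big_omega n)) x - avg (\<lambda>n. \<phi> (y * n) * a (big_omega n + l)) x) \<longlongrightarrow> 0) at_top"
    by (rule shift_relD[OF assms(1) p]) (use a in blast)
  have "((\<lambda>x. avg (\<lambda>n. \<phi> (y * n) * a (big_omega n + l)) x
     - avg (\<lambda>n. \<phi> (y * (y' * n)) * a (big_omega n + l' + l)) x) \<longlongrightarrow> 0) at_top"
    by (rule shift_relD[OF assms(2) unit_periodic_mult[OF p], of "\<lambda>k. a (k + l)"]) (use a in blast)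
  from tendsto_add[OF 1 this]
  show "((\<lambda>x. avg (\<lambda>n. \<phi> n * a (big_omega n)) x - avg (\<lambda>n. \<phi> (y * y' * n) * a (big_omega n + (l + l'))) x) \<longlongrightarrow> 0) at_top"
    by (simp add: mult.assoc add_ac)
qed

text \<open>The pair \<open>(1, e)\<close>, applied to \<open>a\<close> shifted by \<open>l\<close>,
  identifies the averages with shifts \<open>l\<close> and \<open>l + e\<close>. This replaces
  subtraction in the second component.\<close>

lemma shift_rel_cancel:
  assumes "shift_rel Q 1 e" "shift_rel Q y (l + e)"
  shows "shift_rel Q y l"
  unfolding shift_rel_def
proof (intro allI impI)
  fix \<phi> a assume p: "unit_periodic Q \<phi>" and a: "\<forall>k::nat. norm (a k :: complex) \<le> 1"
  have 1: "((\<lambda>x. avg (\<lambda>n. \<phi> n * a (big_omega n)) x - avg (\<lambda>n. \<phi> (y * n) * a (big_omega n + (l + e))) x) \<longlongrightarrow> 0) at_top"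
    by (rule shift_relD[OF assms(2) p]) (use a in blast)
  have "((\<lambda>x. avg (\<lambda>n. \<phi> (y * n) * a (big_omega n + l)) x
     - avg (\<lambda>n. \<phi> (y * (1 * n)) * a (big_omega n + e + l)) x) \<longlongrightarrow> 0) at_top"
    by (rule shift_relD[OF assms(1) unit_periodic_mult[OF p], of "\<lambda>k. a (k + l)"]) (use a in blast)
  from tendsto_diff[OF 1 this]
  show "((\<lambda>x. avg (\<lambda>n. \<phi> n * a (big_omega n)) x - avg (\<lambda>n. \<phi> (y * n) * a (big_omega n + l)) x) \<longlongrightarrow> 0) at_top"
    by (simp add: add_ac)
qed

lemma shift_rel_power: "shift_rel Q y l \<Longrightarrow> shift_rel Q (y ^ k) (k * l)"
proof (induction k)
  case (Suc k)
  from shift_rel_mult[OF Suc.prems Suc.IH[OF Suc.prems]] show ?case by simp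
qed (simp add: shift_rel_one[simplified])

text \<open>Turan-Kubilius with weights \<open>1\<close> over finitely many primes of the class, of
  reciprocal sum at least \<open>32 / eps^2\<close>, reaches averages at \<open>x / p\<close>;
  \<open>scale_invariance\<close> moves these back to \<open>x\<close>.\<close>

lemma shift_rel_class:
  assumes Q: "Q > 0" and c: "\<not> summable (\<lambda>p. if prime p \<and> p mod Q = c then 1 / real p else 0)"
  shows "shift_rel Q c 1"
  unfolding shift_rel_def
proof (intro allI impI)
  fix \<phi> a assume p: "unit_periodic Q \<phi>" and a: "\<forall>k::nat. norm (a k :: complex) \<le> 1"
  define h where "h n = \<phi> n * a (big_omega n)" for n
  define h' where "h' n = \<phi> (c * n) * a (big_omega n + 1)" for n
  have hb: "norm (h n) \<le> 1" "norm (h' n) \<le> 1" for n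
    using p a by (auto simp: h_def h'_def norm_mult unit_periodic_def intro!: mult_le_one)
  have inv': "class_invariant Q h'"
    using class_invariant_omega[OF unit_periodic_mult[OF p, of c], of "\<lambda>k. a (k + 1)"] unfolding h'_def by simp
  have "((\<lambda>x. avg h x - avg h' x) \<longlongrightarrow> 0) at_top"
  proof (rule tendstoI)
    fix eps :: real assume eps: "eps > 0"
    define s where "s p = (if prime p \<and> p mod Q = c then 1 / real p else 0)" for p :: nat
    have "\<exists>N. 32 / eps\<^sup>2 \<le> (\<Sum>p\<le>N. s p)"
    proof (rule ccontr)
      assume no: "\<not> ?thesis"
      have "summable s"
        by (rule bounded_imp_summable[where B = "32 / eps\<^sup>2"]) (use no in \<open>auto simp: s_def not_le intro: less_imp_le\<close>)
      thus False using c unfolding s_def by simp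
    qed
    then obtain N where N: "32 / eps\<^sup>2 \<le> (\<Sum>p\<le>N. s p)" by blast
    define P where "P = {p\<in>{..N}. prime p \<and> p mod Q = c}"
    define H where "H = (\<Sum>p\<in>P. 1 / real p)"
    have "(\<Sum>p\<le>N. s p) = H" unfolding H_def P_def s_def by (rule sum.inter_filter[symmetric]) simp
    hence H: "32 / eps\<^sup>2 \<le> H" using N by simp
    have "32 / eps\<^sup>2 > 0" using eps by simp
    hence H0: "H > 0" using H by linarith
    have sq: "sqrt (2 / H) \<le> eps / 4"
    proof -
      have "2 / H \<le> 2 / (32 / eps\<^sup>2)" by (intro divide_left_mono mult_pos_pos H H0 \<open>32 / eps\<^sup>2 > 0\<close>) auto
      also have "\<dots> = (eps / 4)\<^sup>2" using eps by (simp add: power2_eq_square)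
      finally show ?thesis using eps by (intro real_le_lsqrt) auto
    qed
    \<comment> \<open>The scale range for \<open>scale_invariance\<close>: all primes used are at
      most \<open>N\<close>, so \<open>x / p \<ge> x / (N + 1)\<close>.\<close>
    have "ln (real (Suc N)) \<ge> 0" by simp
    from scale_invariance[OF Q hb(2) inv' _ this, of "eps / 4"] eps
    have "eventually (\<lambda>x. \<forall>y. x * exp (- ln (real (Suc N))) \<le> y \<and> y \<le> x \<longrightarrow> norm (avg h' x - avg h' y) \<le> eps / 4) at_top"
      by simp
    moreover have "eventually (\<lambda>x. x \<ge> 2 * real (card P)) at_top" by (rule eventually_ge_at_top)
    moreover have "eventually (\<lambda>x::real. x > 0) at_top" by (rule eventually_gt_at_top)
    ultimately show "eventually (\<lambda>x. dist (avg h x - avg h' x) 0 < eps) at_top"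
    proof eventually_elim
      case (elim x)
      let ?X = "\<Sum>p\<in>P. of_real (1 / real p) * avg (\<lambda>m. h (p * m)) (x / real p)"
      have 1: "norm (avg h x - ?X / of_real H) \<le> sqrt (2 / H)"
        by (rule weighted_turan_kubilius[where w = "\<lambda>_. 1"]) (use elim H0 hb in \<open>auto simp: P_def H_def\<close>)
      have "?X - of_real H * avg h' x = (\<Sum>p\<in>P. of_real (1 / real p) * (avg (\<lambda>m. h (p * m)) (x / real p) - avg h' x))"
        unfolding H_def of_real_sum sum_distrib_right by (simp only: sum_subtractf right_diff_distrib)
      also have "norm \<dots> \<le> (\<Sum>p\<in>P. 1 / real p * (eps / 4))"
      proof (rule order.trans[OF norm_sum], intro sum_mono)
        fix p assume p': "p \<in> P"
        hence pp: "prime p" "p mod Q = c" "p \<le> N" by (auto simp: P_def)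
        have p0: "real p \<ge> 1" using pp(1) by (simp add: prime_gt_0_nat Suc_le_eq)
        have "avg (\<lambda>m. h (p * m)) (x / real p) = avg h' (x / real p)"
        proof (rule avg_cong)
          fix n :: nat assume n: "n > 0"
          have "\<phi> (p * n) = \<phi> (c * n)"
            by (rule periodic_cong[where Q = Q]) (use p pp in \<open>auto simp: unit_periodic_def cong_def mod_mult_left_eq\<close>)
          thus "h (p * n) = h' n" using n pp by (simp add: h_def h'_def big_omega_prime_mult)
        qed
        moreover have "norm (avg h' x - avg h' (x / real p)) \<le> eps / 4"
        proof -
          have "x * exp (- ln (real (Suc N))) = x / real (Suc N)" by (simp add: exp_minus field_simps)
          also have "\<dots> \<le> x / real p" using pp p0 elim by (intro divide_left_mono) auto
          finally have "x * exp (- ln (real (Suc N))) \<le> x / real p" .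
          moreover have "x / real p \<le> x" using p0 elim by (simp add: field_simps)
          ultimately show ?thesis using elim(1) by blast
        qed
        ultimately have "norm (avg (\<lambda>m. h (p * m)) (x / real p) - avg h' x) \<le> eps / 4"
          by (simp add: norm_minus_commute)
        hence "1 / real p * norm (avg (\<lambda>m. h (p * m)) (x / real p) - avg h' x) \<le> 1 / real p * (eps / 4)"
          by (intro mult_left_mono) auto
        moreover have "\<bar>1 / real p\<bar> = 1 / real p" by simp
        ultimately show "norm (of_real (1 / real p) * (avg (\<lambda>m. h (p * m)) (x / real p) - avg h' x)) \<le> 1 / real p * (eps / 4)"
          unfolding norm_mult norm_of_real by (simp only:)
      qed
      also have "\<dots> = H * (eps / 4)" unfolding H_def by (simp only: sum_distrib_right)
      finally have 2: "norm (?X - of_real H * avg h' x) \<le> H * (eps / 4)" .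
      have "?X / of_real H - avg h' x = (?X - of_real H * avg h' x) / of_real H"
        using H0 by (simp add: diff_divide_distrib)
      hence "norm (?X / of_real H - avg h' x) = norm (?X - of_real H * avg h' x) / H"
        using H0 by (simp add: norm_divide)
      also have "\<dots> \<le> H * (eps / 4) / H" using 2 H0 by (intro divide_right_mono) auto
      also have "\<dots> = eps / 4" using H0 by simp
      finally have "norm (avg h x - avg h' x) \<le> sqrt (2 / H) + eps / 4"
        by (rule norm_diff_triangle_le[OF 1])
      thus ?case using sq eps by (simp add: dist_norm)
    qed
  qed
  thus "((\<lambda>x. avg (\<lambda>n. \<phi> n * a (big_omega n)) x - avg (\<lambda>n. \<phi> (c * n) * a (big_omega n + 1)) x) \<longlongrightarrow> 0) at_top"
    unfolding h_def h'_def .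
qed

text \<open>Classes with divergent reciprocal sum give pairs \<open>(c, 1)\<close>, and Euler's
  theorem gives \<open>(1, e)\<close> with \<open>e = totient Q\<close>. The \<open>y\<close> with
  pair \<open>(y, 0)\<close> form a subgroup \<open>H\<close>, and all nonexceptional primes lie in
  one coset of it, which must be \<open>H\<close> itself. Then \<open>(c, 0)\<close> and
  \<open>(c, 1)\<close> combine to \<open>(1, 1)\<close>.\<close>

theorem shift_rel_one_one:
  assumes Q: "Q > 0"
  shows "shift_rel Q 1 1"
proof -
  define s where "s c = (\<lambda>p. if prime p \<and> p mod Q = c then 1 / real p else 0)" for c :: nat
  define S where "S = {c\<in>{..<Q}. \<not> summable (s c)}"
  define E where "E = {p. p mod Q \<notin> S}"
  define e where "e = totient Q"
  have e0: "e > 0" using Q by (simp add: e_def)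
  have sumE: "summable (\<lambda>p. if prime p \<and> p \<in> E then 1 / real p else 0)"
  proof -
    have "summable (\<lambda>p. \<Sum>c\<in>{..<Q} - S. s c p)" by (intro summable_sum) (auto simp: S_def)
    also have "(\<lambda>p. \<Sum>c\<in>{..<Q} - S. s c p) = (\<lambda>p. if prime p \<and> p \<in> E then 1 / real p else 0)"
    proof
      fix p
      have "(\<Sum>c\<in>{..<Q} - S. s c p) = (\<Sum>c\<in>{..<Q} - S. if c = p mod Q then (if prime p then 1 / real p else 0) else 0)"
        by (intro sum.cong) (auto simp: s_def)
      also have "\<dots> = (if prime p \<and> p \<in> E then 1 / real p else 0)"
        using Q by (auto simp: E_def)
      finally show "(\<Sum>c\<in>{..<Q} - S. s c p) = (if prime p \<and> p \<in> E then 1 / real p else 0)" .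
    qed
    finally show ?thesis .
  qed
  have "S \<noteq> {}"
  proof
    assume "S = {}"
    hence "E = UNIV" by (auto simp: E_def)
    thus False using sumE not_summable_prime_reciprocals by simp
  qed
  then obtain c where c: "c \<in> S" by blast
  have cop: "coprime c Q" if "c \<in> S" for c
  proof (rule ccontr)
    assume nc: "\<not> coprime c Q"
    have "s c p = 0" if "p \<notin> {..Q}" for p
    proof -
      have "\<not> (prime p \<and> p mod Q = c)"
      proof
        assume pc: "prime p \<and> p mod Q = c"
        hence "\<not> coprime p Q" using nc Q coprime_mod_left_iff[of Q p] by simp
        hence "p dvd Q" using pc prime_imp_coprime by blast
        thus False using that Q dvd_imp_le by auto
      qed
      thus ?thesis unfolding s_def by (rule if_not_P)
    qed
    hence "summable (s c)" by (intro summable_finite[of "{..Q}"]) auto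
    thus False using \<open>c \<in> S\<close> by (simp add: S_def)
  qed
  have rel: "shift_rel Q c 1" if "c \<in> S" for c
    using that by (intro shift_rel_class[OF Q]) (auto simp: S_def s_def)
  have ce: "[c ^ e = 1] (mod Q)" unfolding e_def by (rule euler_theorem[OF cop[OF c]])
  have rel_e: "shift_rel Q 1 e"
    using shift_rel_cong[OF ce] shift_rel_power[OF rel[OF c], of e] by simp
  define H where "H = {y. y < Q \<and> coprime y Q \<and> shift_rel Q y 0}"
  have modrel: "shift_rel Q (y mod Q) l \<longleftrightarrow> shift_rel Q y l" for y l
    using shift_rel_cong[of "y mod Q" y Q l] shift_rel_cong[of y "y mod Q" Q l] by (auto simp: cong_def)
  have sub: "residue_subgroup Q H"
    unfolding residue_subgroup_def
  proof (intro conjI ballI)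
    show "H \<subseteq> {n. n < Q \<and> coprime n Q}" by (auto simp: H_def)
    have "coprime (1 mod Q) Q" using coprime_mod_left_iff[of Q 1] Q by simp
    moreover have "shift_rel Q (1 mod Q) 0" using shift_rel_one[of Q] modrel[of 1 0] by blast
    moreover have "1 mod Q < Q" using Q by simp
    ultimately show "1 mod Q \<in> H" unfolding H_def by blast
    fix a b assume "a \<in> H" "b \<in> H"
    hence ab: "coprime a Q" "coprime b Q" "shift_rel Q a 0" "shift_rel Q b 0" by (auto simp: H_def)
    have "shift_rel Q (a * b) (0 + 0)" by (rule shift_rel_mult[OF ab(3,4)])
    thus "a * b mod Q \<in> H" using ab Q by (simp add: H_def modrel coprime_mod_left_iff)
  qed
  have "c mod Q \<in> H"
  proof (rule coset_of_almost_all_primes_trivial[OF Q sub cop[OF c] sumE])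
    fix p :: nat assume p: "prime p" "p \<notin> E"
    define c' where "c' = p mod Q"
    have c': "c' \<in> S" using p by (simp add: E_def c'_def)
    \<comment> \<open>The quotient of \<open>p\<close> by \<open>c\<close> modulo \<open>Q\<close>.
      It has shift \<open>e\<close>, which \<open>shift_rel_cancel\<close> reduces to
      \<open>0\<close>.\<close>
    define h where "h = c ^ (e - 1) * c'"
    have "shift_rel Q h ((e - 1) * 1 + 1)" unfolding h_def
      by (intro shift_rel_mult shift_rel_power rel c c')
    hence "shift_rel Q h (0 + e)" using e0 by simp
    hence "shift_rel Q h 0" by (rule shift_rel_cancel[OF rel_e])
    moreover have "coprime h Q" using cop[OF c] cop[OF c'] by (simp add: h_def)
    ultimately have "h mod Q \<in> H" using Q by (simp add: H_def modrel coprime_mod_left_iff)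
    moreover have "[p = c * h] (mod Q)"
    proof -
      have "c * h = c ^ e * c'" using e0 unfolding h_def by (metis Suc_diff_1 mult.assoc power_Suc)
      moreover have "[c ^ e * c' = 1 * c'] (mod Q)" using ce by (rule cong_scalar_right)
      ultimately show ?thesis by (simp add: c'_def cong_def)
    qed
    ultimately show "\<exists>h. h mod Q \<in> H \<and> [p = c * h] (mod Q)" by blast
  qed
  hence "shift_rel Q c 0" by (simp add: H_def modrel)
  \<comment> \<open>Use \<open>c\<close> with shift \<open>0\<close> for \<open>e - 1\<close>
    factors and with shift \<open>1\<close> for the last one.\<close>
  from shift_rel_power[OF this, of "e - 1"] have "shift_rel Q (c ^ (e - 1)) 0" by simp
  from shift_rel_mult[OF this rel[OF c]] have "shift_rel Q (c ^ (e - 1) * c) (0 + 1)" .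
  hence "shift_rel Q (c ^ e) 1" using e0 by (simp add: power_eq_if mult.commute)
  thus ?thesis using shift_rel_cong[OF ce] by blast
qed

section \<open>Measures from finitely additive limits\<close>

text \<open>Tychonoff's theorem for the cube. The index type will be that of all subsets of the
  space, where a cluster point yields a finer filter but in general no subsequence.\<close>

lemma sequence_in_cube_cluster_filter:
  fixes f :: "nat \<Rightarrow> 'i \<Rightarrow> real"
  assumes G: "G \<noteq> bot" and f: "eventually (\<lambda>n. \<forall>i. f n i \<in> {0..1}) G"
  shows "\<exists>F l. F \<noteq> bot \<and> F \<le> G \<and> (\<forall>i. ((\<lambda>n. f n i) \<longlongrightarrow> l i) F)"
proof -
  define U :: "('i \<Rightarrow> real) set" where "U = PiE UNIV (\<lambda>_. {0..1})"
  have "compactin (product_topology (\<lambda>i::'i. euclidean :: real topology) UNIV) U"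
    unfolding U_def compactin_PiE by simp
  hence "compact U" by (simp add: euclidean_product_topology)
  moreover have "eventually (\<lambda>x. x \<in> U) (filtermap f G)"
    using f by (simp add: eventually_filtermap U_def PiE_UNIV_domain Pi_iff)
  moreover have "filtermap f G \<noteq> bot" using G by (simp add: filtermap_bot_iff)
  ultimately obtain l where l: "inf (nhds l) (filtermap f G) \<noteq> bot"
    unfolding compact_filter by blast
  define F where "F = inf G (filtercomap f (nhds l))"
  have "F \<noteq> bot"
  proof
    assume "F = bot"
    hence "eventually (\<lambda>_. False) F" by simp
    then obtain P Q where PQ: "eventually P G" "eventually Q (filtercomap f (nhds l))" "\<And>x. P x \<Longrightarrow> Q x \<Longrightarrow> False"
      unfolding F_def eventually_inf by blast
    then obtain Q' where Q': "eventually Q' (nhds l)" "\<And>x. Q' (f x) \<Longrightarrow> Q x"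
      unfolding eventually_filtercomap by blast
    have "eventually (\<lambda>y. \<not> Q' y) (filtermap f G)"
      unfolding eventually_filtermap using PQ(1) by (rule eventually_mono) (use PQ(3) Q'(2) in blast)
    hence "eventually (\<lambda>_. False) (inf (nhds l) (filtermap f G))"
      unfolding eventually_inf using Q'(1) by blast
    thus False using l by (simp add: trivial_limit_def)
  qed
  moreover have "F \<le> G" by (simp add: F_def)
  moreover have "((\<lambda>n. f n i) \<longlongrightarrow> l i) F" for i
  proof -
    have lim: "(f \<longlongrightarrow> l) F"
      unfolding F_def by (rule filterlim_mono[OF filterlim_filtercomap]) auto
    show ?thesis
    proof (rule topological_tendstoI)
      fix V :: "real set" assume V: "open V" "l i \<in> V"
      have "open ((\<lambda>x. x i) -` V)" by (rule open_vimage[OF V(1)]) simp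
      with lim V(2) show "eventually (\<lambda>n. f n i \<in> V) F"
        by (auto dest: topological_tendstoD)
    qed
  qed
  ultimately show ?thesis by blast
qed

text \<open>Riesz' construction: inner approximation by compact sets followed by outer approximation by
  open sets turns \<open>l\<close> into a Borel measure that dominates \<open>l\<close> on compact sets.\<close>

locale finitely_additive_prob =
  fixes X :: "'a::metric_space set" and l :: "'a set \<Rightarrow> real"
  assumes compact: "compact X"
    and nonneg: "l A \<ge> 0"
    and additive: "A \<inter> B = {} \<Longrightarrow> l (A \<union> B) = l A + l B"
    and total: "l X = 1" and outside: "l (- X) = 0"
begin

lemma mono: "A \<subseteq> B \<Longrightarrow> l A \<le> l B"
  using additive[of A "B - A"] nonneg[of "B - A"] by (simp add: Un_absorb1)

lemma subadd: "l (A \<union> B) \<le> l A + l B"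
  using additive[of A "B - A"] mono[of "B - A" B] by simp

lemma empty: "l {} = 0"
  using additive[of "{}" "{}"] by simp

lemma Int_X: "l (A \<inter> X) = l A"
proof -
  have "l A = l (A \<inter> X) + l (A - X)" using additive[of "A \<inter> X" "A - X"] by (auto simp: Int_Diff_Un)
  moreover have "l (A - X) \<le> 0" using mono[of "A - X" "- X"] outside by auto
  ultimately show ?thesis using nonneg[of "A - X"] by linarith
qed

definition cpt_sup :: "'a set \<Rightarrow> ennreal" where
  "cpt_sup U = (SUP K\<in>{K. compact K \<and> K \<subseteq> U}. ennreal (l K))"

definition outer :: "'a set \<Rightarrow> ennreal" where
  "outer A = (INF U\<in>{U. open U \<and> A \<subseteq> U}. cpt_sup U)"

lemma cpt_sup_ge: "compact K \<Longrightarrow> K \<subseteq> U \<Longrightarrow> ennreal (l K) \<le> cpt_sup U"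
  unfolding cpt_sup_def by (rule SUP_upper) auto

lemma cpt_sup_mono: "U \<subseteq> V \<Longrightarrow> cpt_sup U \<le> cpt_sup V"
  unfolding cpt_sup_def by (rule SUP_subset_mono) auto

lemma cpt_sup_empty: "cpt_sup {} = 0"
  unfolding cpt_sup_def by (intro antisym SUP_least) (auto simp: empty)

lemma cpt_sup_le_1: "cpt_sup U \<le> 1"
proof -
  have "l K \<le> 1" for K using mono[of "K \<inter> X" X] total by (simp add: Int_X)
  thus ?thesis unfolding cpt_sup_def by (intro SUP_least) auto
qed

text \<open>The disjoint closed sets \<open>K - U\<close> and \<open>K - V\<close> have disjoint
  open neighbourhoods \<open>W1\<close> and \<open>W2\<close>, so \<open>K\<close> is the union of
  the compact sets \<open>K - W1\<close>, inside \<open>U\<close>, and \<open>K - W2\<close>, inside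
  \<open>V\<close>.\<close>

lemma cpt_sup_Un: 
  assumes "open U" "open V"
  shows "cpt_sup (U \<union> V) \<le> cpt_sup U + cpt_sup V"
  unfolding cpt_sup_def[of "U \<union> V"]
proof (rule SUP_least)
  fix K assume "K \<in> {K. compact K \<and> K \<subseteq> U \<union> V}"
  hence K: "compact K" "K \<subseteq> U \<union> V" by auto
  have "closed (K - U)" "closed (K - V)" "(K - U) \<inter> (K - V) = {}"
    using K assms compact_imp_closed[OF K(1)] by (auto intro: closed_Diff)
  then obtain W1 W2 where W: "open W1" "open W2" "K - U \<subseteq> W1" "K - V \<subseteq> W2" "W1 \<inter> W2 = {}"
    using t4_space[of "K - U" "K - V"] by blast
  have c: "compact (K - W1)" "compact (K - W2)" using K W by (auto intro: compact_diff)
  have "l K \<le> l ((K - W1) \<union> (K - W2))" using W by (intro mono) auto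
  also have "\<dots> \<le> l (K - W1) + l (K - W2)" by (rule subadd)
  finally have "ennreal (l K) \<le> ennreal (l (K - W1)) + ennreal (l (K - W2))"
    by (simp add: nonneg flip: ennreal_plus)
  also have "\<dots> \<le> cpt_sup U + cpt_sup V"
    using c W by (intro add_mono cpt_sup_ge) auto
  finally show "ennreal (l K) \<le> cpt_sup U + cpt_sup V" .
qed

lemma cpt_sup_UN_finite:
  fixes U :: "nat \<Rightarrow> 'a set"
  assumes "\<And>i. open (U i)"
  shows "cpt_sup (\<Union>i<n. U i) \<le> (\<Sum>i<n. cpt_sup (U i))"
proof (induction n)
  case (Suc n)
  have "(\<Union>i<Suc n. U i) = (\<Union>i<n. U i) \<union> U n" by (auto simp: less_Suc_eq)
  hence "cpt_sup (\<Union>i<Suc n. U i) \<le> cpt_sup (\<Union>i<n. U i) + cpt_sup (U n)"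
    using cpt_sup_Un[OF open_UN assms, of "{..<n}" U n] assms by auto
  also have "\<dots> \<le> (\<Sum>i<Suc n. cpt_sup (U i))" using Suc by (auto intro: add_right_mono)
  finally show ?case .
qed (simp add: cpt_sup_empty)

lemma cpt_sup_UN:
  fixes U :: "nat \<Rightarrow> 'a set"
  assumes "\<And>i. open (U i)"
  shows "cpt_sup (\<Union>i. U i) \<le> (\<Sum>i. cpt_sup (U i))"
  unfolding cpt_sup_def[of "\<Union>i. U i"]
proof (rule SUP_least)
  fix K assume "K \<in> {K. compact K \<and> K \<subseteq> (\<Union>i. U i)}"
  hence K: "compact K" "K \<subseteq> (\<Union>i\<in>UNIV. U i)" by auto
  obtain C where C: "finite C" "K \<subseteq> (\<Union>i\<in>C. U i)"
    using compactE_image[OF K(1), of UNIV U] K(2) assms by metis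
  obtain n where n: "C \<subseteq> {..<n}" using C(1) finite_nat_iff_bounded by blast
  have "K \<subseteq> (\<Union>i<n. U i)" using C(2) n by blast
  hence "ennreal (l K) \<le> cpt_sup (\<Union>i<n. U i)" using K by (intro cpt_sup_ge)
  also have "\<dots> \<le> (\<Sum>i<n. cpt_sup (U i))" by (rule cpt_sup_UN_finite[OF assms])
  also have "\<dots> \<le> (\<Sum>i. cpt_sup (U i))" by (rule sum_le_suminf) auto
  finally show "ennreal (l K) \<le> (\<Sum>i. cpt_sup (U i))" .
qed

lemma outer_mono: "A \<subseteq> B \<Longrightarrow> outer A \<le> outer B"
  unfolding outer_def by (rule INF_superset_mono) auto

lemma outer_open: "open U \<Longrightarrow> outer U = cpt_sup U"
  unfolding outer_def by (intro antisym INF_lower INF_greatest cpt_sup_mono) auto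

lemma outer_le_1: "outer A \<le> 1"
  using outer_mono[of A UNIV] outer_open[of UNIV] cpt_sup_le_1[of UNIV] by simp

lemma outer_compact_ge: "compact K \<Longrightarrow> ennreal (l K) \<le> outer K"
  unfolding outer_def by (intro INF_greatest cpt_sup_ge) auto

lemma outer_approx:
  assumes "e > (0::real)"
  shows "\<exists>U. open U \<and> A \<subseteq> U \<and> cpt_sup U \<le> outer A + ennreal e"
proof (rule ccontr)
  assume no: "\<not> ?thesis"
  have "outer A + ennreal e \<le> outer A"
    unfolding outer_def[of A]
    by (rule INF_greatest, unfold outer_def[symmetric]) (use no in \<open>auto simp: not_le intro: less_imp_le\<close>)
  thus False using assms outer_le_1[of A]
    by (cases "outer A" rule: ennreal_cases) (auto simp: top_unique simp flip: ennreal_plus)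
qed

lemma outer_countably_subadditive: 
  fixes A :: "nat \<Rightarrow> 'a set"
  shows "outer (\<Union>i. A i) \<le> (\<Sum>i. outer (A i))"
proof (rule ennreal_le_epsilon)
  fix e :: real assume e: "0 < e"
  define d where "d i = e * (1/2) ^ Suc i" for i
  have "\<forall>i. \<exists>U. open U \<and> A i \<subseteq> U \<and> cpt_sup U \<le> outer (A i) + ennreal (d i)"
    using e by (intro allI outer_approx) (simp add: d_def)
  then obtain U where U: "\<And>i. open (U i)" "\<And>i. A i \<subseteq> U i" "\<And>i. cpt_sup (U i) \<le> outer (A i) + ennreal (d i)"
    by metis
  have "outer (\<Union>i. A i) \<le> outer (\<Union>i. U i)" using U(2) by (intro outer_mono) blast
  also have "\<dots> = cpt_sup (\<Union>i. U i)" using U(1) by (intro outer_open) auto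
  also have "\<dots> \<le> (\<Sum>i. cpt_sup (U i))" by (rule cpt_sup_UN[OF U(1)])
  also have "\<dots> \<le> (\<Sum>i. outer (A i) + ennreal (d i))" by (intro suminf_le U(3)) auto
  also have "\<dots> = (\<Sum>i. outer (A i)) + (\<Sum>i. ennreal (d i))" by (rule suminf_add[symmetric]) auto
  also have "(\<Sum>i. ennreal (d i)) = ennreal e"
  proof (rule suminf_ennreal_eq)
    show "0 \<le> d i" for i using e by (simp add: d_def)
    show "d sums e" unfolding d_def using sums_mult[OF power_half_series, of e] by simp
  qed
  finally show "outer (\<Union>i. A i) \<le> (\<Sum>i. outer (A i)) + ennreal e" .
qed

lemma outer_Un: "outer (A \<union> B) \<le> outer A + outer B"
proof -
  have "outer (\<Union>i. binaryset A B i) \<le> (\<Sum>i. outer (binaryset A B i))"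
    by (rule outer_countably_subadditive)
  moreover have "outer {} = 0" using outer_open[of "{}"] cpt_sup_empty by simp
  ultimately show ?thesis by (simp add: UN_binaryset_eq suminf_binaryset_eq)
qed

text \<open>Caratheodory's condition for open sets. A compact \<open>K\<close> inside
  \<open>V \<inter> U\<close> and a compact subset of \<open>V - K\<close> are disjoint, so
  \<open>l\<close> is additive on them; taking suprema gives the inequality, as \<open>V - U\<close>
  is contained in \<open>V - K\<close>.\<close>

lemma outer_split_open:
  assumes U: "open U"
  shows "outer (U \<inter> A) + outer (A - U) \<le> outer A"
  unfolding outer_def[of A]
proof (rule INF_greatest)
  fix V assume "V \<in> {V. open V \<and> A \<subseteq> V}"
  hence V: "open V" "A \<subseteq> V" by auto
  have step: "ennreal (l K) + outer (V - U) \<le> cpt_sup V" if K: "compact K" "K \<subseteq> V \<inter> U" for K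
  proof -
    have oVK: "open (V - K)" using V K by (intro open_Diff compact_imp_closed)
    have "ennreal (l K) + outer (V - U) \<le> ennreal (l K) + cpt_sup (V - K)"
      using K outer_mono[of "V - U" "V - K"] outer_open[OF oVK] by (intro add_left_mono) auto
    also have "\<dots> = (SUP K'\<in>{K'. compact K' \<and> K' \<subseteq> V - K}. ennreal (l K) + ennreal (l K'))"
      unfolding cpt_sup_def by (rule ennreal_SUP_add_right) auto
    also have "\<dots> \<le> cpt_sup V"
    proof (rule SUP_least)
      fix K' assume "K' \<in> {K'. compact K' \<and> K' \<subseteq> V - K}"
      hence K': "compact K'" "K' \<subseteq> V - K" by auto
      have "l K + l K' = l (K \<union> K')" using K' by (intro additive[symmetric]) auto
      hence "ennreal (l K) + ennreal (l K') = ennreal (l (K \<union> K'))"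
        by (simp add: nonneg flip: ennreal_plus)
      also have "\<dots> \<le> cpt_sup V" using K K' by (intro cpt_sup_ge compact_Un) auto
      finally show "ennreal (l K) + ennreal (l K') \<le> cpt_sup V" .
    qed
    finally show ?thesis .
  qed
  have "outer (U \<inter> A) + outer (A - U) \<le> cpt_sup (V \<inter> U) + outer (V - U)"
    unfolding outer_open[OF open_Int[OF V(1) U], symmetric]
    using V(2) by (intro add_mono outer_mono) auto
  also have "\<dots> = (SUP K\<in>{K. compact K \<and> K \<subseteq> V \<inter> U}. ennreal (l K) + outer (V - U))"
    unfolding cpt_sup_def by (rule ennreal_SUP_add_left[symmetric]) auto
  also have "\<dots> \<le> cpt_sup V" by (rule SUP_least) (use step in auto)
  finally show "outer (U \<inter> A) + outer (A - U) \<le> cpt_sup V" .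
qed

definition riesz :: "'a measure" where "riesz = measure_of UNIV (sets borel) outer"

lemma sets_riesz [simp]: "sets riesz = sets borel"
  unfolding riesz_def using sets.sets_measure_of_eq[of borel outer] by simp

lemma space_riesz [simp]: "space riesz = UNIV"
  unfolding riesz_def by (simp add: space_measure_of_conv)

lemma emeasure_riesz: 
  assumes "A \<in> sets borel"
  shows "emeasure riesz A = outer A"
proof -
  have oms: "outer_measure_space (Pow UNIV) outer"
    unfolding outer_measure_space_def positive_def increasing_def countably_subadditive_def
    using outer_open[of "{}"] cpt_sup_empty outer_mono outer_countably_subadditive by auto
  interpret P: sigma_algebra UNIV "Pow UNIV :: 'a set set" by (rule sigma_algebra_Pow)
  have ms: "measure_space UNIV (lambda_system UNIV (Pow UNIV) outer) outer"
    by (rule P.caratheodory_lemma[OF oms])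
  have op: "U \<in> lambda_system UNIV (Pow UNIV) outer" if "open U" for U
  proof -
    have "outer (U \<inter> A) + outer ((UNIV - U) \<inter> A) = outer A" for A
    proof (rule antisym)
      have "(UNIV - U) \<inter> A = A - U" by auto
      thus "outer (U \<inter> A) + outer ((UNIV - U) \<inter> A) \<le> outer A" using outer_split_open[OF that] by simp
      have "(U \<inter> A) \<union> ((UNIV - U) \<inter> A) = A" by auto
      thus "outer A \<le> outer (U \<inter> A) + outer ((UNIV - U) \<inter> A)" using outer_Un by metis
    qed
    thus ?thesis by (auto simp: lambda_system_def)
  qed
  interpret L: sigma_algebra UNIV "lambda_system UNIV (Pow UNIV) outer"
    using ms by (simp add: measure_space_def)
  have "sigma_sets UNIV {U. open U} \<subseteq> lambda_system UNIV (Pow UNIV) outer"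
    by (rule L.sigma_sets_subset) (use op in auto)
  hence sub: "sets borel \<subseteq> lambda_system UNIV (Pow UNIV) outer"
    by (simp add: borel_def)
  have sa: "sigma_algebra UNIV (sets (borel :: 'a measure))"
    using sets.sigma_algebra_axioms[of borel] by simp
  have "measure_space UNIV (sets borel) outer"
    by (rule measure_down[OF ms sa sub])
  thus ?thesis unfolding riesz_def measure_space_def
    by (intro emeasure_measure_of_sigma assms) auto
qed

lemma X_borel: "X \<in> sets borel" using compact by (simp add: compact_imp_closed)

lemma emeasure_riesz_X: "emeasure riesz X = 1"
  unfolding emeasure_riesz[OF X_borel]
  by (rule antisym[OF outer_le_1]) (use outer_compact_ge[OF compact] total in simp)

lemma emeasure_riesz_outside: 
  assumes "A \<in> sets borel" shows "emeasure riesz (A \<inter> X) = emeasure riesz A"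
proof -
  have "open (- X)" using compact by (simp add: compact_imp_closed open_Compl)
  moreover have "cpt_sup (- X) = 0"
  proof -
    have "l K = 0" if "K \<subseteq> - X" for K using mono[OF that] nonneg[of K] outside by linarith
    thus ?thesis unfolding cpt_sup_def by (intro antisym SUP_least) auto
  qed
  ultimately have "outer (- X) = 0" by (simp add: outer_open)
  hence z: "outer (A - X) = 0" using outer_mono[of "A - X" "- X"] by auto
  have "outer A \<le> outer (A \<inter> X) + outer (A - X)" using outer_Un[of "A \<inter> X" "A - X"] by (simp add: Int_Diff_Un)
  hence "outer A \<le> outer (A \<inter> X)" using z by simp
  hence "outer (A \<inter> X) = outer A" using outer_mono[of "A \<inter> X" A] by (intro antisym) auto
  thus ?thesis using assms X_borel by (simp add: emeasure_riesz)
qed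

text \<open>For open \<open>U\<close> one inequality against the image measure \<open>N\<close> is
  direct, since \<open>T\<close> pulls compact subsets of \<open>U\<close> back to compact subsets
  of \<open>X\<close> and \<open>l\<close> is invariant. As both masses are \<open>1\<close>,
  complements give the opposite inequality on closed sets; shrinking open neighbourhoods give the
  original one there as well. Closed sets generate the Borel sets.\<close>

lemma riesz_invariant:
  assumes T: "continuous_on X T" "T ` X \<subseteq> X" and inv: "\<And>A. l (T -` A) = l A"
    and A: "A \<in> sets borel"
  shows "emeasure riesz (T -` A \<inter> X) = emeasure riesz A"
proof -
  define Mx where "Mx = restrict_space riesz X"
  have Tm: "T \<in> measurable Mx borel"
  proof -
    have "T \<in> borel_measurable (restrict_space borel X)"
      by (rule borel_measurable_continuous_on_restrict[OF T(1)])
    moreover have "sets Mx = sets (restrict_space borel X)"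
      unfolding Mx_def by (simp add: sets_restrict_space)
    ultimately show ?thesis by (simp cong: measurable_cong_sets)
  qed
  define N where "N = distr Mx borel T"
  have spMx: "space Mx = X" by (simp add: Mx_def space_restrict_space)
  have emMx: "emeasure Mx B = emeasure riesz B" if "B \<subseteq> X" for B
    unfolding Mx_def by (rule emeasure_restrict_space) (use that X_borel in auto)
  have emN: "emeasure N B = emeasure riesz (T -` B \<inter> X)" if "B \<in> sets borel" for B
    unfolding N_def using that emMx[of "T -` B \<inter> X"] by (simp add: emeasure_distr[OF Tm] spMx)
  have meas: "T -` B \<inter> X \<in> sets borel" if "B \<in> sets borel" for B
  proof -
    have "T -` B \<inter> X \<in> sets Mx" using measurable_sets[OF Tm that] by (simp add: spMx)
    then obtain C where "C \<in> sets borel" "T -` B \<inter> X = X \<inter> C"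
      unfolding Mx_def by (auto simp: sets_restrict_space)
    thus ?thesis using X_borel by simp
  qed
  have op: "emeasure riesz U \<le> emeasure N U" if U: "open U" for U
  proof -
    have "cpt_sup U \<le> outer (T -` U \<inter> X)"
      unfolding cpt_sup_def
    proof (rule SUP_least)
      fix K assume "K \<in> {K. compact K \<and> K \<subseteq> U}"
      hence K: "compact K" "K \<subseteq> U" by auto
      have "closed (X \<inter> T -` K)"
        using T(1) compact K by (intro continuous_closed_preimage) (auto intro: compact_imp_closed)
      hence "compact (X \<inter> (X \<inter> T -` K))" by (rule compact_Int_closed[OF compact])
      hence c: "compact (T -` K \<inter> X)" by (simp add: Int_commute)
      have "l K = l (T -` K \<inter> X)" by (simp add: inv Int_X)
      also have "ennreal \<dots> \<le> outer (T -` K \<inter> X)" by (rule outer_compact_ge[OF c])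
      also have "\<dots> \<le> outer (T -` U \<inter> X)" using K by (intro outer_mono) auto
      finally show "ennreal (l K) \<le> outer (T -` U \<inter> X)" .
    qed
    thus ?thesis using U meas by (simp add: emN emeasure_riesz outer_open)
  qed
  have UNIV1: "emeasure riesz UNIV = 1" using emeasure_riesz_outside[of UNIV] emeasure_riesz_X by simp
  have N1: "emeasure N UNIV = 1" using emN[of UNIV] emeasure_riesz_X by simp
  have spN: "space N = UNIV" and setsN [simp]: "sets N = sets borel" by (simp_all add: N_def)
  interpret R: finite_measure riesz by (rule finite_measureI) (simp add: UNIV1)
  interpret NN: finite_measure N by (rule finite_measureI) (simp add: N1 spN)
  have cl: "emeasure riesz F = emeasure N F" if F: "closed F" for F
  proof (rule antisym)
    have "emeasure riesz F = 1 - emeasure riesz (- F)"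
      using emeasure_compl[of "- F" riesz] R.emeasure_finite[of "- F"] F by (simp add: UNIV1 Compl_eq_Diff_UNIV[symmetric])
    moreover have "emeasure N F = 1 - emeasure N (- F)"
      using emeasure_compl[of "- F" N] NN.emeasure_finite[of "- F"] F by (simp add: N1 spN Compl_eq_Diff_UNIV[symmetric])
    ultimately show "emeasure N F \<le> emeasure riesz F"
      using op[of "- F"] F by (simp add: open_Compl ennreal_minus_mono)
    show "emeasure riesz F \<le> emeasure N F"
    proof (cases "F = {}")
      case False
      define U where "U n = {x. infdist x F < 1 / real (Suc n)}" for n
      have oU: "open (U n)" for n unfolding U_def
        by (intro open_Collect_less continuous_intros)
      have FU: "F \<subseteq> U n" for n by (auto simp: U_def)
      have INT: "(\<Inter>n. U n) = F"
      proof
        show "F \<subseteq> (\<Inter>n. U n)" using FU by blast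
        show "(\<Inter>n. U n) \<subseteq> F"
        proof
          fix x assume x: "x \<in> (\<Inter>n. U n)"
          have "infdist x F \<le> 0"
          proof (rule field_le_epsilon)
            fix e :: real assume "0 < e"
            then obtain n where "1 / real (Suc n) < e" using nat_approx_posE by blast
            thus "infdist x F \<le> 0 + e" using x by (auto simp: U_def dest!: spec[of _ n])
          qed
          hence "infdist x F = 0" using infdist_nonneg[of x F] by linarith
          thus "x \<in> F" using in_closed_iff_infdist_zero[OF F False] by simp
        qed
      qed
      have dec: "decseq U"
        unfolding decseq_def
      proof (intro allI impI subsetI)
        fix m n x assume mn: "m \<le> n" and x: "x \<in> U n"
        have "1 / real (Suc n) \<le> 1 / real (Suc m)" using mn by (intro divide_left_mono) auto
        thus "x \<in> U m" using x unfolding U_def by (auto intro: less_le_trans)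
      qed
      have "emeasure riesz F \<le> (INF n. emeasure N (U n))"
      proof (rule INF_greatest)
        fix n
        have "emeasure riesz F \<le> emeasure riesz (U n)" using FU oU by (intro emeasure_mono) auto
        also have "\<dots> \<le> emeasure N (U n)" by (rule op[OF oU])
        finally show "emeasure riesz F \<le> emeasure N (U n)" .
      qed
      also have "\<dots> = emeasure N (\<Inter>n. U n)"
        by (rule INF_emeasure_decseq) (use oU dec NN.emeasure_finite in auto)
      finally show ?thesis by (simp add: INT)
    qed (simp add: emeasure_riesz)
  qed
  have "riesz = N"
  proof (rule measure_eqI_generator_eq[where E = "Collect closed" and \<Omega> = UNIV and A = "\<lambda>_. UNIV"])
    show "Int_stable (Collect (closed :: 'a set \<Rightarrow> bool))" by (auto simp: Int_stable_def)
    show "sets riesz = sigma_sets UNIV (Collect closed)" "sets N = sigma_sets UNIV (Collect closed)"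
      by (simp_all add: N_def borel_eq_closed)
  qed (use cl UNIV1 in auto)
  thus ?thesis using emN[OF A] by simp
qed

end

section \<open>Unique ergodicity\<close>

text \<open>Discrete layer-cake formula. It reduces integrals of a continuous function to its
  superlevel sets, which are compact, and there \<open>l\<close> will be dominated by
  \<open>\<mu>\<close>.\<close>

lemma sum_step_functions:
  fixes t :: real
  assumes t: "0 \<le> t" "t \<le> 1" and n: "n > 0"
  shows "(\<Sum>i=1..n. if real i / real n \<le> t then 1 else 0) / real n \<le> t"
    and "t \<le> 1 / real n + (\<Sum>i=1..n. if real i / real n \<le> t then 1 else 0) / real n"
proof -
  define k where "k = nat \<lfloor>real n * t\<rfloor>"
  have nt: "0 \<le> real n * t" using t by simp
  have k: "real k \<le> real n * t" "real n * t < real k + 1" unfolding k_def using nt by (auto simp: of_nat_floor)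
  have "real n * t \<le> real n * 1" using t n by (intro mult_left_mono) auto
  hence "real k \<le> real n" using k by linarith
  hence kn: "k \<le> n" by simp
  have iff: "real i / real n \<le> t \<longleftrightarrow> i \<le> k" for i
  proof -
    have "real i / real n \<le> t \<longleftrightarrow> real i \<le> real n * t" using n by (simp add: field_simps)
    also have "\<dots> \<longleftrightarrow> i \<le> k" using k by (auto simp: k_def le_nat_floor) 
    finally show ?thesis .
  qed
  have "(\<Sum>i=1..n. if real i / real n \<le> t then 1 else 0) = (\<Sum>i\<in>{i\<in>{1..n}. i \<le> k}. 1::real)"
    unfolding iff by (rule sum.inter_filter[symmetric]) simp
  also have "{i\<in>{1..n}. i \<le> k} = {1..k}" using kn by auto
  finally have s: "(\<Sum>i=1..n. if real i / real n \<le> t then 1 else 0) = real k" by simp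
  show "(\<Sum>i=1..n. if real i / real n \<le> t then 1 else 0) / real n \<le> t"
    unfolding s using k n by (simp add: field_simps)
  show "t \<le> 1 / real n + (\<Sum>i=1..n. if real i / real n \<le> t then 1 else 0) / real n"
    unfolding s using k n by (simp add: field_simps)
qed

section \<open>Limits of weighted empirical measures\<close>

context
  fixes X :: "'a::metric_space set" and \<mu> :: "'a measure" and T :: "'a \<Rightarrow> 'a"
  assumes ue: "uniquely_ergodic_system X \<mu> T"
begin

lemma cpt: "compact X" and T: "continuous_on X T" "T ` X \<subseteq> X" 
  and sets_mu: "sets \<mu> = sets (restrict_space borel X)" and prob_mu: "prob_space \<mu>"
  using ue unfolding uniquely_ergodic_system_def invariant_borel_prob_def by auto

lemma space_mu: "space \<mu> = X"
  using sets_eq_imp_space_eq[OF sets_mu] by (simp add: space_restrict_space)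

lemma continuous_measurable_mu: 
  fixes g :: "'a \<Rightarrow> 'b::topological_space"
  assumes "continuous_on X g" shows "g \<in> borel_measurable \<mu>"
  using borel_measurable_continuous_on_restrict[OF assms] measurable_cong_sets[OF sets_mu refl] by blast

context
  fixes y :: "nat \<Rightarrow> 'a" and w :: "nat \<Rightarrow> nat \<Rightarrow> real"
  assumes y: "\<And>n. y n \<in> X"
    and w: "\<And>N n. w N n \<ge> 0" "eventually (\<lambda>N. (\<Sum>n=1..N. w N n) = 1) sequentially"
    and inv: "\<And>A. (\<lambda>N. \<Sum>n=1..N. w N n * (indicator A (T (y n)) - indicator A (y n))) \<longlonglongrightarrow> 0"
begin

definition emp :: "nat \<Rightarrow> 'a set \<Rightarrow> real" where
  "emp N A = (\<Sum>n=1..N. w N n * indicator A (y n))"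

text \<open>The limit \<open>l\<close> is finitely additive and \<open>T\<close>-invariant, so its
  Riesz measure restricted to \<open>X\<close> is an invariant Borel probability. Unique ergodicity
  identifies it with \<open>\<mu>\<close>.\<close>

lemma limit_dominated:
  assumes F: "F \<noteq> bot" "F \<le> sequentially" and l: "\<And>A. ((\<lambda>N. emp N A) \<longlongrightarrow> l A) F"
    and K: "compact K" "K \<subseteq> X"
  shows "l K \<le> measure \<mu> K"
proof -
  have w1: "eventually (\<lambda>N. (\<Sum>n=1..N. w N n) = 1) F" using w(2) F(2) by (rule filter_leD[rotated])
  interpret finitely_additive_prob X l
  proof
    show "compact X" by (rule cpt)
    show "l A \<ge> 0" for A
      by (rule tendsto_lowerbound[OF l always_eventually F(1)]) (auto simp: emp_def w intro!: sum_nonneg mult_nonneg_nonneg)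
    show "l (A \<union> B) = l A + l B" if "A \<inter> B = {}" for A B
    proof -
      have "emp N (A \<union> B) = emp N A + emp N B" for N
        unfolding emp_def sum.distrib[symmetric] using that
        by (intro sum.cong refl) (auto simp: indicator_def algebra_simps)
      hence "((\<lambda>N. emp N (A \<union> B)) \<longlongrightarrow> l A + l B) F" using tendsto_add[OF l[of A] l[of B]] by simp
      thus ?thesis using tendsto_unique[OF F(1) l[of "A \<union> B"]] by simp
    qed
    have "eventually (\<lambda>N. emp N X = 1) F" using w1
      by eventually_elim (simp add: emp_def y)
    hence "((\<lambda>N. emp N X) \<longlongrightarrow> 1) F" by (rule tendsto_eventually)
    thus "l X = 1" using tendsto_unique[OF F(1) l[of X]] by simp
    have "emp N (- X) = 0" for N unfolding emp_def using y by (simp add: indicator_def)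
    hence "((\<lambda>N. emp N (- X)) \<longlongrightarrow> 0) F" by simp
    thus "l (- X) = 0" using tendsto_unique[OF F(1) l[of "- X"]] by simp
  qed
  have linv: "l (T -` A) = l A" for A
  proof -
    have "((\<lambda>N. \<Sum>n=1..N. w N n * (indicator A (T (y n)) - indicator A (y n))) \<longlongrightarrow> 0) F"
      using inv F(2) by (rule tendsto_mono[rotated])
    moreover have "(\<Sum>n=1..N. w N n * (indicator A (T (y n)) - indicator A (y n))) = emp N (T -` A) - emp N A" for N
      unfolding emp_def sum_subtractf[symmetric] by (intro sum.cong refl) (simp add: indicator_def algebra_simps)
    ultimately have "((\<lambda>N. emp N (T -` A) - emp N A) \<longlongrightarrow> 0) F" by simp
    moreover have "((\<lambda>N. emp N (T -` A) - emp N A) \<longlongrightarrow> l (T -` A) - l A) F" by (intro tendsto_diff l)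
    ultimately show ?thesis using tendsto_unique[OF F(1)] by fastforce
  qed
  define M where "M = restrict_space riesz X"
  have emM: "emeasure M B = emeasure riesz B" if "B \<subseteq> X" for B
    unfolding M_def by (rule emeasure_restrict_space) (use that X_borel in auto)
  have "invariant_borel_prob X T M"
    unfolding invariant_borel_prob_def
  proof (intro conjI ballI)
    have "space M = X" by (simp add: M_def space_restrict_space)
    thus "prob_space M" by (intro prob_spaceI) (simp add: emM emeasure_riesz_X)
    show "sets M = sets (restrict_space borel X)" by (simp add: M_def sets_restrict_space)
    fix A assume "A \<in> sets M"
    hence A: "A \<in> sets borel" "A \<subseteq> X" using X_borel by (auto simp: M_def sets_restrict_space)
    show "emeasure M (T -` A \<inter> X) = emeasure M A"
      using riesz_invariant[OF T linv A(1)] A(2) by (simp add: emM)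
  qed
  hence "M = \<mu>" using ue by (simp add: uniquely_ergodic_system_def)
  have "ennreal (l K) \<le> emeasure \<mu> K"
    unfolding \<open>M = \<mu>\<close>[symmetric] emM[OF K(2)] using K outer_compact_ge[OF K(1)]
    by (simp add: emeasure_riesz compact_imp_closed)
  also have "\<dots> = ennreal (measure \<mu> K)"
    using prob_mu by (simp add: prob_space_def finite_measure.emeasure_eq_measure)
  finally show ?thesis by simp
qed

text \<open>Domination on compact sets is one-sided, so only an upper bound results; the lower bound
  will follow by applying it to the negated function.\<close>

lemma limit_upper_bound:
  fixes g :: "'a \<Rightarrow> real"
  assumes F: "F \<noteq> bot" "F \<le> sequentially" and l: "\<And>A. ((\<lambda>N. emp N A) \<longlongrightarrow> l A) F"
    and g: "continuous_on X g" "\<And>x. x \<in> X \<Longrightarrow> 0 \<le> g x \<and> g x \<le> 1" and e: "e > 0"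
  shows "eventually (\<lambda>N. (\<Sum>n=1..N. w N n * g (y n)) < (LINT x|\<mu>. g x) + e) F"
proof -
  interpret prob_space \<mu> by (rule prob_mu)
  obtain k where k: "1 / real (Suc k) < e" using nat_approx_posE[OF e] by blast
  define n where "n = Suc k"
  have n: "n > 0" "1 / real n < e" using k by (auto simp: n_def)
  define K where "K i = X \<inter> g -` {real i / real n..}" for i :: nat
  have cK: "compact (K i)" for i
  proof -
    have "closed (K i)" unfolding K_def using g(1) cpt by (intro continuous_closed_preimage) (auto intro: compact_imp_closed)
    hence "compact (X \<inter> K i)" by (rule compact_Int_closed[OF cpt])
    moreover have "X \<inter> K i = K i" by (auto simp: K_def)
    ultimately show ?thesis by simp
  qed
  have KX: "K i \<subseteq> X" for i by (auto simp: K_def)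
  have Kmeas: "K i \<in> sets \<mu>" for i
  proof -
    have "K i \<in> sets borel" using cK by (simp add: compact_imp_closed)
    moreover have "K i = X \<inter> K i" using KX by blast
    ultimately show ?thesis unfolding sets_mu sets_restrict_space by (rule image_eqI[rotated])
  qed
  have ind: "(\<Sum>i=1..n. if real i / real n \<le> g x then 1 else 0) = (\<Sum>i=1..n. indicator (K i) x :: real)" if "x \<in> X" for x
    using that by (intro sum.cong refl) (auto simp: K_def indicator_def)
  have gint: "integrable \<mu> g"
    by (rule integrable_const_bound[where B = 1])
       (use g continuous_measurable_mu[OF g(1)] in \<open>auto simp: space_mu\<close>)
  have "(\<Sum>i=1..n. measure \<mu> (K i)) / real n = (LINT x|\<mu>. (\<Sum>i=1..n. indicator (K i) x :: real) / real n)"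
  proof -
    have "(LINT x|\<mu>. (\<Sum>i=1..n. indicator (K i) x :: real) / real n) = (LINT x|\<mu>. (\<Sum>i=1..n. indicator (K i) x :: real)) / real n"
      by (rule integral_divide_zero)
    also have "(LINT x|\<mu>. (\<Sum>i=1..n. indicator (K i) x :: real)) = (\<Sum>i=1..n. (LINT x|\<mu>. indicator (K i) x))"
      by (rule Bochner_Integration.integral_sum) (use Kmeas in \<open>auto simp: emeasure_eq_measure\<close>)
    also have "\<dots> = (\<Sum>i=1..n. measure \<mu> (K i))"
      using Kmeas by (intro sum.cong refl) simp
    finally show ?thesis ..
  qed
  also have "\<dots> \<le> (LINT x|\<mu>. g x)"
  proof (rule integral_mono)
    show "integrable \<mu> (\<lambda>x. (\<Sum>i=1..n. indicator (K i) x :: real) / real n)"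
      using Kmeas by (auto simp: emeasure_eq_measure)
    show "integrable \<mu> g" by (rule gint)
    fix x assume "x \<in> space \<mu>"
    hence x: "x \<in> X" by (simp add: space_mu)
    show "(\<Sum>i=1..n. indicator (K i) x :: real) / real n \<le> g x"
      using sum_step_functions(1)[of "g x" n] g(2)[OF x] n ind[OF x] by simp
  qed
  finally have int: "(\<Sum>i=1..n. measure \<mu> (K i)) / real n \<le> (LINT x|\<mu>. g x)" .
  have "(\<Sum>i=1..n. l (K i)) / real n \<le> (\<Sum>i=1..n. measure \<mu> (K i)) / real n"
    by (intro divide_right_mono sum_mono limit_dominated[OF F l cK KX]) auto
  hence "1 / real n + (\<Sum>i=1..n. l (K i)) / real n < (LINT x|\<mu>. g x) + e"
    using int n by linarith
  moreover have "((\<lambda>N. 1 / real n + (\<Sum>i=1..n. emp N (K i)) / real n) \<longlongrightarrow> 1 / real n + (\<Sum>i=1..n. l (K i)) / real n) F"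
    using n by (intro tendsto_intros l) auto
  ultimately have "eventually (\<lambda>N. 1 / real n + (\<Sum>i=1..n. emp N (K i)) / real n < (LINT x|\<mu>. g x) + e) F"
    by (rule order_tendstoD(2)[rotated])
  moreover have "eventually (\<lambda>N. (\<Sum>n=1..N. w N n) = 1) F" using w(2) F(2) by (rule filter_leD[rotated])
  ultimately show ?thesis
  proof eventually_elim
    case (elim N)
    have "(\<Sum>j=1..N. w N j * g (y j)) \<le> (\<Sum>j=1..N. w N j * (1 / real n + (\<Sum>i=1..n. indicator (K i) (y j)) / real n))"
    proof (intro sum_mono mult_left_mono w)
      fix j
      show "g (y j) \<le> 1 / real n + (\<Sum>i=1..n. indicator (K i) (y j)) / real n"
        using sum_step_functions(2)[of "g (y j)" n] g(2)[OF y] n ind[OF y, of j] by simp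
    qed
    also have "\<dots> = (\<Sum>j=1..N. 1 / real n * w N j + (\<Sum>i=1..n. w N j * indicator (K i) (y j)) / real n)"
    proof (intro sum.cong refl)
      fix j
      have "w N j * (a + S / real n) = a * w N j + w N j * S / real n" for a S :: real by (simp add: distrib_left)
      thus "w N j * (1 / real n + (\<Sum>i=1..n. indicator (K i) (y j)) / real n)
          = 1 / real n * w N j + (\<Sum>i=1..n. w N j * indicator (K i) (y j)) / real n"
        unfolding sum_distrib_left[symmetric] .
    qed
    also have "\<dots> = 1 / real n * (\<Sum>j=1..N. w N j) + (\<Sum>j=1..N. \<Sum>i=1..n. w N j * indicator (K i) (y j)) / real n"
      by (simp only: sum.distrib sum_distrib_left[symmetric] sum_divide_distrib[symmetric])
    also have "(\<Sum>j=1..N. \<Sum>i=1..n. w N j * indicator (K i) (y j)) = (\<Sum>i=1..n. emp N (K i))"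
      unfolding emp_def by (rule sum.swap)
    finally show ?case using elim by simp
  qed
qed

lemma limit_along_filter:
  fixes g :: "'a \<Rightarrow> real"
  assumes F: "F \<noteq> bot" "F \<le> sequentially" and l: "\<And>A. ((\<lambda>N. emp N A) \<longlongrightarrow> l A) F"
    and g: "continuous_on X g" 
  shows "((\<lambda>N. \<Sum>n=1..N. w N n * g (y n)) \<longlongrightarrow> (LINT x|\<mu>. g x)) F"
proof -
  interpret prob_space \<mu> by (rule prob_mu)
  have "bounded (g ` X)" using compact_continuous_image[OF g cpt] by (rule compact_imp_bounded)
  then obtain B0 where "\<And>x. x \<in> X \<Longrightarrow> \<bar>g x\<bar> \<le> B0" unfolding bounded_iff by auto
  then obtain B where B: "B > 0" "\<And>x. x \<in> X \<Longrightarrow> \<bar>g x\<bar> \<le> B" 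
    by (metis abs_ge_self dual_order.trans less_add_one abs_ge_zero le_less_trans less_imp_le)
  have gint: "integrable \<mu> g"
    by (rule integrable_const_bound[where B = B])
       (use B continuous_measurable_mu[OF g] in \<open>auto simp: space_mu\<close>)
  have w1: "eventually (\<lambda>N. (\<Sum>n=1..N. w N n) = 1) F" using w(2) F(2) by (rule filter_leD[rotated])
  have up: "eventually (\<lambda>N. (\<Sum>n=1..N. w N n * (s * g (y n))) < s * (LINT x|\<mu>. g x) + e) F"
    if s: "\<bar>s\<bar> = 1" and e: "e > 0" for s e :: real
  proof -
    \<comment> \<open>Affine normalisation of \<open>s * g\<close> to the interval from
      \<open>0\<close> to \<open>1\<close>; total weight \<open>1\<close> makes it commute with the
      averages.\<close>
    define h where "h x = (s * g x + B) / (2 * B)" for x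
    have ev: "eventually (\<lambda>N. (\<Sum>n=1..N. w N n * h (y n)) < (LINT x|\<mu>. h x) + e / (2 * B)) F"
    proof (rule limit_upper_bound[OF F l])
      show "continuous_on X h" unfolding h_def using g B by (intro continuous_intros) auto
      fix x assume "x \<in> X"
      hence "\<bar>s * g x\<bar> \<le> B" using B(2)[of x] s by (simp add: abs_mult)
      thus "0 \<le> h x \<and> h x \<le> 1" unfolding h_def using B(1) by (auto simp: abs_le_iff field_simps)
    qed (use e B in auto)
    have int: "(LINT x|\<mu>. h x) = (s * (LINT x|\<mu>. g x) + B) / (2 * B)"
      unfolding h_def using gint by (simp add: prob_space)
    from ev[unfolded int] w1 show ?thesis
    proof eventually_elim
      case (elim N)
      have "(\<Sum>n=1..N. w N n * h (y n)) = (\<Sum>n=1..N. (w N n * (s * g (y n)) + w N n * B) / (2 * B))"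
        unfolding h_def by (intro sum.cong refl) (simp add: distrib_left)
      also have "\<dots> = ((\<Sum>n=1..N. w N n * (s * g (y n))) + (\<Sum>n=1..N. w N n) * B) / (2 * B)"
        by (simp add: sum_divide_distrib[symmetric] sum.distrib sum_distrib_right)
      finally have "((\<Sum>n=1..N. w N n * (s * g (y n))) + B) / (2 * B) < (s * (LINT x|\<mu>. g x) + B) / (2 * B) + e / (2 * B)"
        using elim by simp
      hence "((\<Sum>n=1..N. w N n * (s * g (y n))) + B) / (2 * B) < (s * (LINT x|\<mu>. g x) + B + e) / (2 * B)"
        by (simp only: add_divide_distrib)
      thus ?case using B(1) by (simp add: divide_less_cancel)
    qed
  qed
  show ?thesis
  proof (rule tendstoI)
    fix e :: real assume "e > 0"
    from up[of 1 e, OF _ this] up[of "-1" e, OF _ this]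
    show "eventually (\<lambda>N. dist (\<Sum>n=1..N. w N n * g (y n)) (LINT x|\<mu>. g x) < e) F"
      by (auto simp: dist_real_def abs_less_iff sum_negf elim: eventually_elim2)
  qed
qed

text \<open>If convergence failed, the filter of bad indices would have a refinement along which
  \<open>emp N A\<close> converges for all \<open>A\<close> at once, and there
  \<open>limit_along_filter\<close> forces convergence.\<close>

theorem weighted_equidistribution:
  fixes g :: "'a \<Rightarrow> real"
  assumes g: "continuous_on X g"
  shows "(\<lambda>N. \<Sum>n=1..N. w N n * g (y n)) \<longlonglongrightarrow> (LINT x|\<mu>. g x)"
proof (rule ccontr)
  assume "\<not> ?thesis"
  then obtain e where e: "e > 0" "\<not> eventually (\<lambda>N. dist (\<Sum>n=1..N. w N n * g (y n)) (LINT x|\<mu>. g x) < e) sequentially"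
    unfolding tendsto_iff by blast
  define P where "P N \<longleftrightarrow> \<not> dist (\<Sum>n=1..N. w N n * g (y n)) (LINT x|\<mu>. g x) < e" for N
  define G where "G = inf sequentially (principal {N. P N})"
  have "G \<noteq> bot"
    using e(2) unfolding G_def trivial_limit_def eventually_inf_principal by (simp add: P_def)
  moreover have "eventually (\<lambda>N. \<forall>A. emp N A \<in> {0..1}) G"
  proof -
    have "eventually (\<lambda>N. \<forall>A. emp N A \<in> {0..1}) sequentially" using w(2)
    proof eventually_elim
      case (elim N)
      show ?case
      proof
        fix A
        have "emp N A \<ge> 0" unfolding emp_def by (intro sum_nonneg mult_nonneg_nonneg w) auto
        moreover have "emp N A \<le> (\<Sum>n=1..N. w N n * 1)"
          unfolding emp_def by (intro sum_mono mult_left_mono w) (auto simp: indicator_def)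
        ultimately show "emp N A \<in> {0..1}" using elim by simp
      qed
    qed
    thus ?thesis unfolding G_def by (rule filter_leD[rotated]) simp
  qed
  ultimately obtain F l where F: "F \<noteq> bot" "F \<le> G" "\<And>A. ((\<lambda>N. emp N A) \<longlongrightarrow> l A) F"
    using sequence_in_cube_cluster_filter[of G emp] by blast
  have "F \<le> sequentially" using F(2) by (simp add: G_def)
  hence "eventually (\<lambda>N. dist (\<Sum>n=1..N. w N n * g (y n)) (LINT x|\<mu>. g x) < e) F"
    using limit_along_filter[OF F(1) _ F(3) g] e(1) by (auto dest: tendstoD)
  moreover have "eventually P F"
    using F(2) unfolding G_def by (auto simp: le_principal)
  ultimately have "eventually (\<lambda>_. False) F" by eventually_elim (simp add: P_def)
  thus False using F(1) by (simp add: trivial_limit_def)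
qed

end

end

section \<open>Periodic weights along \<open>big_omega\<close>\<close>

lemma periodic_sum_error:
  fixes \<phi> :: "nat \<Rightarrow> real"
  assumes Q: "Q > 0" and per: "\<And>n. \<phi> (n + Q) = \<phi> n" and bd: "\<And>n. 0 \<le> \<phi> n \<and> \<phi> n \<le> 1"
  shows "\<bar>(\<Sum>n=1..N. \<phi> n) - real N * ((\<Sum>n<Q. \<phi> n) / real Q)\<bar> \<le> real Q + 2"
proof -
  define b where "b = (\<Sum>n<Q. \<phi> n) / real Q"
  have Qb: "(\<Sum>n<Q. \<phi> n) = real Q * b" using Q by (simp add: b_def)
  have "(\<Sum>n<Q. \<phi> n) \<le> (\<Sum>n<Q. 1)" using bd by (intro sum_mono) auto
  hence b01: "0 \<le> b" "b \<le> 1" unfolding b_def using bd Q by (auto intro!: divide_nonneg_nonneg sum_nonneg simp: divide_le_eq)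
  have *: "(\<Sum>n<k*Q + r. \<phi> n) = real (k * Q) * b + (\<Sum>n<r. \<phi> n)" for k r
  proof (induction k)
    case (Suc k)
    have "(\<Sum>n<Suc k * Q + r. \<phi> n) = (\<Sum>n<Q. \<phi> n) + (\<Sum>n\<in>{Q..<Suc k*Q+r}. \<phi> n)"
      by (subst sum.union_disjoint[symmetric]) (auto intro!: sum.cong)
    also have "(\<Sum>n\<in>{Q..<Suc k*Q+r}. \<phi> n) = (\<Sum>n<k*Q+r. \<phi> (n + Q))"
      by (rule sum.reindex_bij_witness[where i = "\<lambda>n. n + Q" and j = "\<lambda>n. n - Q"]) auto
    finally show ?case using Suc by (simp add: per Qb algebra_simps)
  qed simp
  define k r where "k = Suc N div Q" and "r = Suc N mod Q"
  have kr: "Suc N = k * Q + r" by (simp add: k_def r_def)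
  have rQ: "r \<le> Q" using Q by (simp add: r_def less_imp_le)
  have "(\<Sum>n=1..N. \<phi> n) = (\<Sum>n<Suc N. \<phi> n) - \<phi> 0"
  proof -
    have "{..<Suc N} = insert 0 {1..N}" by auto
    thus ?thesis by simp
  qed
  also have "(\<Sum>n<Suc N. \<phi> n) = real (k * Q) * b + (\<Sum>n<r. \<phi> n)" unfolding kr by (rule *)
  also have "real (k * Q) = real (Suc N) - real r" unfolding kr by simp
  finally have eq: "(\<Sum>n=1..N. \<phi> n) - real N * b = b - real r * b + (\<Sum>n<r. \<phi> n) - \<phi> 0"
    by (simp add: algebra_simps)
  have "(\<Sum>n<r. \<phi> n) \<le> (\<Sum>n<r. 1)" using bd by (intro sum_mono) auto
  hence s: "0 \<le> (\<Sum>n<r. \<phi> n)" "(\<Sum>n<r. \<phi> n) \<le> real Q" using bd rQ by (auto intro: sum_nonneg order.trans)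
  have "real r * b \<le> real Q * 1" using rQ b01 by (intro mult_mono) auto
  moreover have "real r * b \<ge> 0" using b01 by simp
  ultimately show ?thesis using eq s b01 bd[of 0] unfolding b_def[symmetric] abs_le_iff by linarith
qed

lemma periodic_mean:
  fixes \<phi> :: "nat \<Rightarrow> real"
  assumes Q: "Q > 0" and per: "\<And>n. \<phi> (n + Q) = \<phi> n" and bd: "\<And>n. 0 \<le> \<phi> n \<and> \<phi> n \<le> 1"
  shows "(\<lambda>N. (\<Sum>n=1..N. \<phi> n) / real N) \<longlonglongrightarrow> (\<Sum>n<Q. \<phi> n) / real Q"
proof (rule Lim_null[THEN iffD2], rule Lim_null_comparison)
  show "(\<lambda>N. (real Q + 2) / real N) \<longlonglongrightarrow> 0" by real_asymp
  show "eventually (\<lambda>N. norm ((\<Sum>n=1..N. \<phi> n) / real N - (\<Sum>n<Q. \<phi> n) / real Q) \<le> (real Q + 2) / real N) sequentially"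
    using eventually_gt_at_top[of 0]
  proof eventually_elim
    case (elim N)
    have "(\<Sum>n=1..N. \<phi> n) / real N - (\<Sum>n<Q. \<phi> n) / real Q = ((\<Sum>n=1..N. \<phi> n) - real N * ((\<Sum>n<Q. \<phi> n) / real Q)) / real N"
      using elim by (simp add: diff_divide_distrib)
    also have "norm \<dots> \<le> (real Q + 2) / real N"
      using periodic_sum_error[of Q \<phi> N, OF assms] by (simp add: divide_right_mono)
    finally show ?case .
  qed
qed

lemma avg_of_nat: "avg h (real N) = (\<Sum>n=1..N. h n) / of_nat N"
  by (simp add: avg_def)

text \<open>The weights \<open>\<phi> n\<close> divided by their sum turn this into
  \<open>weighted_equidistribution\<close>, and the mean of \<open>\<phi>\<close> is restored at the
  end. If that mean is \<open>0\<close>, the nonnegative periodic \<open>\<phi>\<close> vanishes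
  identically.\<close>

lemma periodic_omega_equidistribution_real:
  fixes \<phi> :: "nat \<Rightarrow> real" and g :: "'a::metric_space \<Rightarrow> real"
  assumes ue: "uniquely_ergodic_system X \<mu> T"
    and Q: "Q > 0" and per: "\<And>n. \<phi> (n + Q) = \<phi> n" and bd: "\<And>n. 0 \<le> \<phi> n \<and> \<phi> n \<le> 1"
    and g: "continuous_on X g" and x: "x \<in> X"
  shows "(\<lambda>N. (\<Sum>n=1..N. \<phi> n * g ((T ^^ big_omega n) x)) / real N) \<longlonglongrightarrow> (\<Sum>n<Q. \<phi> n) / real Q * (LINT y|\<mu>. g y)"
proof -
  define b where "b = (\<Sum>n<Q. \<phi> n) / real Q"
  have mean: "(\<lambda>N. (\<Sum>n=1..N. \<phi> n) / real N) \<longlonglongrightarrow> b" unfolding b_def by (rule periodic_mean[of Q \<phi>, OF Q per bd])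
  show ?thesis
  proof (cases "b = 0")
    case True
    hence "(\<Sum>n<Q. \<phi> n) = 0" using Q by (simp add: b_def)
    hence z: "\<phi> n = 0" if "n < Q" for n using that bd by (subst (asm) sum_nonneg_eq_0_iff) auto
    have "\<phi> n = 0" for n
    proof (induction n rule: less_induct)
      case (less n)
      show ?case
      proof (cases "n < Q")
        case False
        hence "\<phi> n = \<phi> (n - Q)" using per[of "n - Q"] by simp
        thus ?thesis using less[of "n - Q"] False Q by simp
      qed (rule z)
    qed
    thus ?thesis using True unfolding b_def by simp
  next
    case False
    have "b \<ge> 0" unfolding b_def using bd by (intro divide_nonneg_nonneg sum_nonneg) auto
    hence b: "b > 0" using False by simp
    define W where "W N = (\<Sum>n=1..N. \<phi> n)" for N
    define w where "w N n = \<phi> n / W N" for N n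
    define y where "y n = (T ^^ big_omega n) x" for n
    have TX: "T ` X \<subseteq> X" using ue by (simp add: uniquely_ergodic_system_def)
    have orb: "(T ^^ k) x \<in> X" for k using TX x by (induction k) auto
    have W0: "W N \<ge> 0" for N unfolding W_def using bd by (intro sum_nonneg) auto
    have Wpos: "eventually (\<lambda>N. W N > 0) sequentially"
      using order_tendstoD(1)[OF mean b]
      by eventually_elim (auto simp: W_def zero_less_divide_iff)
    have lim: "(\<lambda>N. \<Sum>n=1..N. w N n * g (y n)) \<longlonglongrightarrow> (LINT y|\<mu>. g y)"
    proof (rule weighted_equidistribution[OF ue _ _ _ _ g])
      show "y n \<in> X" for n unfolding y_def by (rule orb)
      show "w N n \<ge> 0" for N n unfolding w_def using bd W0 by simp
      show "eventually (\<lambda>N. (\<Sum>n=1..N. w N n) = 1) sequentially"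
        using Wpos
      proof eventually_elim
        case (elim N)
        have "(\<Sum>n=1..N. w N n) = W N / W N"
          by (simp only: w_def sum_divide_distrib[symmetric] W_def[of N, symmetric])
        thus ?case using elim by simp
      qed
      fix A :: "'a set"
      \<comment> \<open>Membership of the orbit point in \<open>A\<close> depends on
        \<open>big_omega n\<close> alone, so \<open>shift_rel Q 1 1\<close> gives asymptotic
        invariance for every set \<open>A\<close>, measurable or not.\<close>
      define a where "a k = (indicator A ((T ^^ k) x) :: complex)" for k
      have up: "unit_periodic Q (\<lambda>n. complex_of_real (\<phi> n))"
        using per bd by (auto simp: unit_periodic_def)
      have "((\<lambda>x. avg (\<lambda>n. of_real (\<phi> n) * a (big_omega n)) x - avg (\<lambda>n. of_real (\<phi> (1 * n)) * a (big_omega n + 1)) x) \<longlongrightarrow> 0) at_top"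
        by (rule shift_relD[OF shift_rel_one_one[OF Q] up]) (simp add: a_def indicator_def)
      hence "(\<lambda>N. avg (\<lambda>n. of_real (\<phi> n) * a (big_omega n)) (real N) - avg (\<lambda>n. of_real (\<phi> (1 * n)) * a (big_omega n + 1)) (real N)) \<longlonglongrightarrow> 0"
        by (rule filterlim_compose[OF _ filterlim_real_sequentially])
      also have "(\<lambda>N. avg (\<lambda>n. of_real (\<phi> n) * a (big_omega n)) (real N) - avg (\<lambda>n. of_real (\<phi> (1 * n)) * a (big_omega n + 1)) (real N))
         = (\<lambda>N. complex_of_real (- ((\<Sum>n=1..N. \<phi> n * (indicator A (T (y n)) - indicator A (y n))) / real N)))"
      proof
        fix N
        have "avg (\<lambda>n. of_real (\<phi> n) * a (big_omega n)) (real N) - avg (\<lambda>n. of_real (\<phi> (1 * n)) * a (big_omega n + 1)) (real N)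
           = (\<Sum>n=1..N. of_real (\<phi> n) * a (big_omega n) - of_real (\<phi> n) * a (big_omega n + 1)) / of_nat N"
          by (simp add: avg_of_nat sum_subtractf diff_divide_distrib)
        also have "(\<Sum>n=1..N. of_real (\<phi> n) * a (big_omega n) - of_real (\<phi> n) * a (big_omega n + 1))
           = (\<Sum>n=1..N. complex_of_real (- (\<phi> n * (indicator A (T (y n)) - indicator A (y n)))))"
          by (intro sum.cong refl) (simp add: a_def y_def indicator_def)
        finally show "avg (\<lambda>n. of_real (\<phi> n) * a (big_omega n)) (real N) - avg (\<lambda>n. of_real (\<phi> (1 * n)) * a (big_omega n + 1)) (real N)
           = complex_of_real (- ((\<Sum>n=1..N. \<phi> n * (indicator A (T (y n)) - indicator A (y n))) / real N))"
          by (simp add: sum_negf)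
      qed
      finally have "(\<lambda>N. - ((\<Sum>n=1..N. \<phi> n * (indicator A (T (y n)) - indicator A (y n))) / real N)) \<longlonglongrightarrow> 0"
        by (subst (asm) tendsto_of_real_iff[where c = 0, simplified]) 
      from tendsto_divide[OF tendsto_minus[OF this] mean] b
      have "(\<lambda>N. ((\<Sum>n=1..N. \<phi> n * (indicator A (T (y n)) - indicator A (y n))) / real N) / (W N / real N)) \<longlonglongrightarrow> 0"
        by (simp add: W_def)
      moreover have "eventually (\<lambda>N. ((\<Sum>n=1..N. \<phi> n * (indicator A (T (y n)) - indicator A (y n))) / real N) / (W N / real N)
          = (\<Sum>n=1..N. w N n * (indicator A (T (y n)) - indicator A (y n)))) sequentially"
        using eventually_gt_at_top[of 0]
      proof eventually_elim
        case (elim N)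
        have "(\<Sum>n=1..N. w N n * (indicator A (T (y n)) - indicator A (y n)))
            = (\<Sum>n=1..N. \<phi> n * (indicator A (T (y n)) - indicator A (y n))) / W N"
          unfolding w_def sum_divide_distrib by (intro sum.cong refl) simp
        thus ?case using elim by simp
      qed
      ultimately show "(\<lambda>N. \<Sum>n=1..N. w N n * (indicator A (T (y n)) - indicator A (y n))) \<longlonglongrightarrow> 0"
        by (rule Lim_transform_eventually)
    qed
    from tendsto_mult[OF mean lim]
    have "(\<lambda>N. (\<Sum>n=1..N. \<phi> n) / real N * (\<Sum>n=1..N. w N n * g (y n))) \<longlonglongrightarrow> b * (LINT y|\<mu>. g y)" .
    moreover have "eventually (\<lambda>N. (\<Sum>n=1..N. \<phi> n) / real N * (\<Sum>n=1..N. w N n * g (y n)) = (\<Sum>n=1..N. \<phi> n * g (y n)) / real N) sequentially"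
      using Wpos
    proof eventually_elim
      case (elim N)
      have "(\<Sum>n=1..N. w N n * g (y n)) = (\<Sum>n=1..N. \<phi> n * g (y n)) / W N"
        unfolding w_def sum_divide_distrib by (intro sum.cong refl) simp
      thus ?case using elim unfolding W_def[symmetric] by simp
    qed
    ultimately show ?thesis unfolding b_def[symmetric] y_def by (rule Lim_transform_eventually)
  qed
qed

theorem periodic_omega_equidistribution:
  fixes \<phi> :: "nat \<Rightarrow> real" and g :: "'a::metric_space \<Rightarrow> complex"
  assumes ue: "uniquely_ergodic_system X \<mu> T"
    and Q: "Q > 0" and per: "\<And>n. \<phi> (n + Q) = \<phi> n" and bd: "\<And>n. 0 \<le> \<phi> n \<and> \<phi> n \<le> 1"
    and g: "continuous_on X g" and x: "x \<in> X"
  shows "(\<lambda>N. (\<Sum>n=1..N. of_real (\<phi> n) * g ((T ^^ big_omega n) x)) / of_nat N) \<longlonglongrightarrow> of_real ((\<Sum>n<Q. \<phi> n) / real Q) * (LINT y|\<mu>. g y)"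
proof -
  interpret prob_space \<mu> using ue by (simp add: uniquely_ergodic_system_def invariant_borel_prob_def)
  have cpt: "compact X" using ue by (simp add: uniquely_ergodic_system_def)
  have "bounded (g ` X)" using compact_continuous_image[OF g cpt] by (rule compact_imp_bounded)
  then obtain B where B: "\<And>x. x \<in> X \<Longrightarrow> norm (g x) \<le> B" unfolding bounded_iff by auto
  have gint: "integrable \<mu> g"
    by (rule integrable_const_bound[where B = B])
       (use B continuous_measurable_mu[OF ue] g space_mu[OF ue] in auto)
  have re: "continuous_on X (\<lambda>y. Re (g y))" and im: "continuous_on X (\<lambda>y. Im (g y))"
    using g by (auto intro: continuous_intros)
  let ?c = "(\<Sum>n<Q. \<phi> n) / real Q"
  have lr: "(\<lambda>N. (\<Sum>n=1..N. \<phi> n * Re (g ((T ^^ big_omega n) x))) / real N) \<longlonglongrightarrow> ?c * (LINT y|\<mu>. Re (g y))"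
    by (rule periodic_omega_equidistribution_real[where \<phi> = \<phi>, OF ue Q per bd re x])
  have li: "(\<lambda>N. (\<Sum>n=1..N. \<phi> n * Im (g ((T ^^ big_omega n) x))) / real N) \<longlonglongrightarrow> ?c * (LINT y|\<mu>. Im (g y))"
    by (rule periodic_omega_equidistribution_real[where \<phi> = \<phi>, OF ue Q per bd im x])
  show ?thesis
    unfolding tendsto_complex_iff
    using lr li gint by (simp add: integral_Re integral_Im)
qed

section \<open>Roots of polynomials modulo prime powers\<close>

text \<open>A nonzero element of minimal degree of the ideal generated by \<open>f\<close> and its derivative is
  constant, by pseudo-division and irreducibility.\<close>

lemma irreducible_int_poly_discriminant:
  fixes f :: "int poly"
  assumes irr: "irreducible f" and deg: "degree f \<ge> 1"
  shows "\<exists>a b D. D \<noteq> 0 \<and> a * f + b * pderiv f = [:D:]"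
proof -
  define I where "I g \<longleftrightarrow> g \<noteq> 0 \<and> (\<exists>a b. g = a * f + b * pderiv f)" for g
  have f0: "f \<noteq> 0" using deg by auto
  have "f = 1 * f + 0 * pderiv f" by simp
  hence "I f" unfolding I_def using f0 by blast
  then obtain g where g: "I g" "\<And>h. I h \<Longrightarrow> degree g \<le> degree h"
    using ex_has_least_nat[of I f degree] by blast
  obtain a b where ab: "g = a * f + b * pderiv f" using g(1) by (auto simp: I_def)
  have g0: "g \<noteq> 0" using g(1) by (simp add: I_def)
  have div: "\<exists>c q. c \<noteq> 0 \<and> Polynomial.smult c h = g * q" if h: "h = a' * f + b' * pderiv f" for h a' b'
  proof -
    obtain q r where qr: "pseudo_divmod h g = (q, r)" by (cases "pseudo_divmod h g")
    define c where "c = Polynomial.coeff g (degree g) ^ (Suc (degree h) - degree g)"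
    have p: "Polynomial.smult c h = g * q + r" "r = 0 \<or> degree r < degree g"
      using pseudo_divmod[OF g0 qr] by (auto simp: c_def)
    have "r = Polynomial.smult c h - g * q" using p by simp
    also have "\<dots> = ([:c:] * a' - q * a) * f + ([:c:] * b' - q * b) * pderiv f"
      unfolding h ab by (simp add: algebra_simps smult_add_right)
    finally have r: "r = ([:c:] * a' - q * a) * f + ([:c:] * b' - q * b) * pderiv f" .
    have "r = 0"
    proof (rule ccontr)
      assume "r \<noteq> 0"
      hence "I r" unfolding I_def using r by blast
      with g(2)[of r] p(2) \<open>r \<noteq> 0\<close> show False by simp
    qed
    moreover have "c \<noteq> 0" using g0 by (simp add: c_def)
    ultimately show ?thesis using p(1) by auto
  qed
  have df: "pderiv f \<noteq> 0" using deg by (simp add: pderiv_eq_0_iff)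
  obtain c q where c: "c \<noteq> 0" "Polynomial.smult c f = g * q" using div[of f 1 0] by auto
  obtain c' q' where c': "c' \<noteq> 0" "Polynomial.smult c' (pderiv f) = g * q'" using div[of "pderiv f" 0 1] by auto
  have pf: "prime_elem f" using irr by (simp add: irreducible_imp_prime_elem)
  have "f dvd g * q" unfolding c(2)[symmetric] by (simp add: dvd_smult)
  hence "f dvd g \<or> f dvd q" using pf by (simp add: prime_elem_dvd_mult_iff)
  \<comment> \<open>In the first case \<open>f\<close> would divide a nonzero multiple of
    \<open>pderiv f\<close>, which has smaller degree. In the second, cancelling \<open>f\<close>
    shows that \<open>g\<close> divides the constant \<open>c\<close>.\<close>
  hence "degree g = 0"
  proof
    assume "f dvd g"
    hence "f dvd Polynomial.smult c' (pderiv f)" unfolding c'(2) by simp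
    hence "degree f \<le> degree (Polynomial.smult c' (pderiv f))" using c' df by (intro dvd_imp_degree_le) auto
    thus ?thesis using deg by (simp add: degree_pderiv split: if_splits)
  next
    assume "f dvd q"
    then obtain s where s: "q = f * s" by auto
    have "f * [:c:] = f * (g * s)" using c(2) s by (simp add: mult_ac)
    hence "[:c:] = g * s" using f0 by (metis mult_cancel_left)
    moreover from this have "s \<noteq> 0" using c(1) by auto
    ultimately have "degree [:c:] = degree g + degree s" using Polynomial.degree_mult_eq[OF g0, of s] by simp
    thus ?thesis by simp
  qed
  then obtain D where "g = [:D:]" by (metis degree_eq_zeroE)
  thus ?thesis using ab g0 by (intro exI[of _ a] exI[of _ b] exI[of _ D]) auto
qed

text \<open>Lagrange's bound: synthetic division at one root keeps the leading coefficient, and the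
  other roots, being incongruent to it, are roots of the quotient modulo \<open>p\<close>.\<close>

lemma card_roots_mod_prime_le:
  fixes f :: "int poly" and p :: int
  assumes p: "prime p" and A: "finite A" "inj_on (\<lambda>x. x mod p) A" "\<And>x. x \<in> A \<Longrightarrow> p dvd poly f x"
    and lc: "\<not> p dvd lead_coeff f"
  shows "card A \<le> degree f"
  using A lc
proof (induction "degree f" arbitrary: f A)
  case 0
  then obtain c where c: "f = [:c:]" by (metis degree_eq_zeroE)
  have "A = {}" using 0 c by auto
  thus ?case by simp
next
  case (Suc n)
  show ?case
  proof (cases "A = {}")
    case False
    then obtain a where a: "a \<in> A" by blast
    define q where "q = synthetic_div f a"
    have f: "f = [:-a, 1:] * q + [:poly f a:]" unfolding q_def by (simp only: synthetic_div_correct')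
    have dq: "degree q = n" using Suc(2) by (simp add: q_def degree_synthetic_div)
    have "Polynomial.coeff f (Suc n) = Polynomial.coeff q n"
      by (subst f) (simp add: coeff_eq_0 dq)
    hence lc: "\<not> p dvd lead_coeff q" using Suc dq by simp
    have "card (A - {a}) \<le> degree q"
    proof (rule Suc(1))
      show "n = degree q" by (simp add: dq)
      show "finite (A - {a})" using Suc by simp
      show "inj_on (\<lambda>x. x mod p) (A - {a})" using Suc(4) by (rule inj_on_subset) auto
      show "\<not> p dvd lead_coeff q" by (rule lc)
      fix b assume b: "b \<in> A - {a}"
      have "poly f b = (b - a) * poly q b + poly f a" by (subst f) (simp add: algebra_simps)
      hence "p dvd (b - a) * poly q b" using Suc(5)[of b] Suc(5)[OF a] b by (simp add: dvd_add_left_iff)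
      moreover have "\<not> p dvd b - a"
      proof
        assume "p dvd b - a"
        hence "b mod p = a mod p" by (simp add: mod_eq_dvd_iff)
        thus False using Suc(4) a b by (auto simp: inj_on_def)
      qed
      ultimately show "p dvd poly q b" using p by (simp add: prime_dvd_mult_iff)
    qed
    thus ?thesis using a Suc dq by (simp add: card_Diff_singleton)
  qed simp
qed

lemma poly_taylor_int:
  fixes f :: "int poly"
  shows "\<exists>r. poly f v = poly f w + (v - w) * (poly (pderiv f) w + (v - w) * r)"
proof (induction f)
  case (pCons c g)
  then obtain r where r: "poly g v = poly g w + (v - w) * (poly (pderiv g) w + (v - w) * r)" by blast
  show ?case
    by (rule exI[of _ "poly (pderiv g) w + v * r"]) (simp add: r pderiv_pCons algebra_simps)
qed simp

lemma poly_cong_int: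
  fixes f :: "int poly"
  assumes "q dvd v - w"
  shows "q dvd poly f v \<longleftrightarrow> q dvd poly f w"
proof -
  obtain r where "poly f v = poly f w + (v - w) * (poly (pderiv f) w + (v - w) * r)"
    using poly_taylor_int by blast
  thus ?thesis using assms by (simp add: dvd_add_left_iff)
qed

text \<open>The uniqueness half of Hensel's lemma: reduction modulo \<open>p\<close> is injective on
  roots modulo \<open>p ^ k\<close>. If \<open>v\<close> and \<open>w\<close> agree modulo
  \<open>p\<close>, Taylor expansion gives \<open>f(v) - f(w) = (v - w) * u\<close> with
  \<open>u\<close> congruent to \<open>f'(w)\<close>, a unit modulo \<open>p\<close> because
  \<open>p\<close> does not divide \<open>D\<close>.\<close>

lemma root_count_prime_power_le:
  assumes p: "prime p" and k: "k \<ge> 1"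
    and D: "a * f + b * pderiv f = [:D:]" "\<not> int p dvd D" and lc: "\<not> int p dvd lead_coeff f"
  shows "root_count f (p ^ k) \<le> degree f"
proof -
  define A where "A = {v \<in> {0..<int (p ^ k)}. int (p ^ k) dvd poly f v}"
  have ip: "prime (int p)" using p by simp
  have pk: "int p dvd int (p ^ k)" using k by simp
  have "card A \<le> degree f"
  proof (rule card_roots_mod_prime_le[OF ip _ _ _ lc])
    show "finite A" unfolding A_def by (rule finite_subset[of _ "{0..<int (p ^ k)}"]) auto
    show "int p dvd poly f x" if "x \<in> A" for x using that pk dvd_trans by (auto simp: A_def)
    show "inj_on (\<lambda>x. x mod int p) A"
    proof (rule inj_onI)
      fix v w assume v: "v \<in> A" and w: "w \<in> A" and vw: "v mod int p = w mod int p"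
      obtain r where r: "poly f v = poly f w + (v - w) * (poly (pderiv f) w + (v - w) * r)"
        using poly_taylor_int by blast
      define u where "u = poly (pderiv f) w + (v - w) * r"
      have pvw: "int p dvd v - w" using vw by (simp add: mod_eq_dvd_iff)
      have "\<not> int p dvd u"
      proof
        assume "int p dvd u"
        hence "int p dvd poly (pderiv f) w" using pvw by (simp add: u_def dvd_add_left_iff)
        moreover have "int p dvd poly f w" using w pk dvd_trans by (auto simp: A_def)
        moreover have "poly a w * poly f w + poly b w * poly (pderiv f) w = D"
          using arg_cong[OF D(1), of "\<lambda>h. poly h w"] by simp
        ultimately have "int p dvd D" by (metis dvd_add dvd_mult)
        thus False using D(2) by blast
      qed
      hence "coprime (int p) u" using ip by (simp add: prime_imp_coprime)
      hence "coprime (int (p ^ k)) u" by simp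
      moreover have "int (p ^ k) dvd (v - w) * u"
      proof -
        have "(v - w) * u = poly f v - poly f w" using r by (simp add: u_def)
        thus ?thesis using v w by (simp add: A_def)
      qed
      ultimately have "int (p ^ k) dvd v - w" by (simp add: coprime_dvd_mult_left_iff)
      moreover have "\<bar>v - w\<bar> < int (p ^ k)" using v w by (auto simp: A_def)
      ultimately have "v - w = 0" by (metis dvd_imp_le_int not_less abs_of_nat)
      thus "v = w" by simp
    qed
  qed
  thus ?thesis by (simp add: A_def root_count_def)
qed

lemma card_roots_upto_le:
  assumes q: "q > 0"
  shows "card {n\<in>{1..N}. int q dvd poly f (int n)} \<le> root_count f q * (N div q + 1)"
proof -
  let ?R = "{v \<in> {0..<int q}. int q dvd poly f v}"
  have "card {n\<in>{1..N}. int q dvd poly f (int n)} \<le> card (?R \<times> {..N div q})"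
  proof (rule card_inj_on_le)
    show "inj_on (\<lambda>n. (int n mod int q, n div q)) {n\<in>{1..N}. int q dvd poly f (int n)}"
    proof (rule inj_onI)
      fix m n :: nat assume "(int m mod int q, m div q) = (int n mod int q, n div q)"
      hence "m mod q = n mod q" "m div q = n div q" by (auto simp flip: zmod_int)
      thus "m = n" by (metis div_mult_mod_eq)
    qed
    show "(\<lambda>n. (int n mod int q, n div q)) ` {n\<in>{1..N}. int q dvd poly f (int n)} \<subseteq> ?R \<times> {..N div q}"
    proof (rule image_subsetI)
      fix n assume n: "n \<in> {n\<in>{1..N}. int q dvd poly f (int n)}"
      have "int q dvd int n mod int q - int n" by (metis dvd_minus_mod minus_diff_eq dvd_minus_iff)
      hence "int q dvd poly f (int n mod int q)" using n poly_cong_int by blast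
      moreover have "n div q \<le> N div q" using n by (simp add: div_le_mono)
      ultimately show "(int n mod int q, n div q) \<in> ?R \<times> {..N div q}" using q by simp
    qed
    have "finite ?R" by (rule finite_subset[of _ "{0..<int q}"]) auto
    thus "finite (?R \<times> {..N div q})" by simp
  qed
  thus ?thesis by (simp add: root_count_def card_cartesian_product)
qed

section \<open>The truncated indicator and its mean\<close>

definition trunc_kfree :: "nat \<Rightarrow> int poly \<Rightarrow> nat \<Rightarrow> nat \<Rightarrow> real" where
  "trunc_kfree k f z n = (if \<exists>p\<le>z. prime p \<and> int (p ^ k) dvd poly f (int n) then 0 else 1)"

text \<open>By the Chinese remainder theorem the two residues vary independently over a period
  \<open>Q * q\<close>.\<close>

lemma periodic_product_sum:
  fixes \<phi> \<psi> :: "nat \<Rightarrow> real"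
  assumes Q: "Q > 0" "q > 0" "coprime Q q" and per: "\<And>n. \<phi> (n + Q) = \<phi> n" "\<And>n. \<psi> (n + q) = \<psi> n"
  shows "(\<Sum>n<Q*q. \<phi> n * \<psi> n) = (\<Sum>n<Q. \<phi> n) * (\<Sum>n<q. \<psi> n)"
proof -
  have pm: "\<phi> n = \<phi> (n mod Q)" if "\<And>n. \<phi> (n + Q) = \<phi> n" for \<phi> :: "nat \<Rightarrow> real" and n Q
  proof -
    have "\<phi> (m + k * Q) = \<phi> m" for k m
    proof (induction k)
      case (Suc k)
      have "\<phi> (m + Suc k * Q) = \<phi> ((m + k * Q) + Q)" by (simp add: algebra_simps)
      thus ?case using Suc that by simp
    qed simp
    from this[of "n mod Q" "n div Q"] show ?thesis by (simp add: add.commute)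
  qed
  have inj: "inj_on (\<lambda>n. (n mod Q, n mod q)) {..<Q*q}"
  proof (rule inj_onI)
    fix m n assume mn: "m \<in> {..<Q*q}" "n \<in> {..<Q*q}" "(m mod Q, m mod q) = (n mod Q, n mod q)"
    hence "[m = n] (mod Q)" "[m = n] (mod q)" by (auto simp: cong_def)
    hence "[m = n] (mod (Q * q))" using Q(3) by (rule coprime_cong_mult_nat)
    thus "m = n" using mn by (simp add: cong_def)
  qed
  have img: "(\<lambda>n. (n mod Q, n mod q)) ` {..<Q*q} = {..<Q} \<times> {..<q}"
  proof (rule card_subset_eq)
    show "(\<lambda>n. (n mod Q, n mod q)) ` {..<Q*q} \<subseteq> {..<Q} \<times> {..<q}" using Q by auto
    show "card ((\<lambda>n. (n mod Q, n mod q)) ` {..<Q*q}) = card ({..<Q} \<times> {..<q})"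
      using inj by (simp add: card_image card_cartesian_product)
  qed simp
  have "(\<Sum>n<Q*q. \<phi> n * \<psi> n) = (\<Sum>n<Q*q. (\<lambda>(i,j). \<phi> i * \<psi> j) (n mod Q, n mod q))"
    using pm[of \<phi> Q, OF per(1)] pm[of \<psi> q, OF per(2)] by (intro sum.cong refl) (metis case_prod_conv)
  also have "\<dots> = (\<Sum>(i,j)\<in>{..<Q} \<times> {..<q}. \<phi> i * \<psi> j)"
    unfolding img[symmetric] by (rule sum.reindex[OF inj, unfolded o_def, symmetric])
  also have "\<dots> = (\<Sum>n<Q. \<phi> n) * (\<Sum>n<q. \<psi> n)"
    by (simp add: sum_product sum.cartesian_product)
  finally show ?thesis .
qed

text \<open>Induction on \<open>z\<close>. The claim that the period is coprime to all primes beyond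
  \<open>z\<close> is carried along to make the factor of the next prime independent of the earlier
  ones.\<close>

lemma trunc_kfree_mean:
  assumes k: "k \<ge> 1"
  shows "\<exists>Q>0. (\<forall>p. prime p \<longrightarrow> p > z \<longrightarrow> coprime Q p) \<and> (\<forall>n. trunc_kfree k f z (n + Q) = trunc_kfree k f z n) \<and>
     (\<Sum>n<Q. trunc_kfree k f z n) / real Q = (\<Prod>p\<le>z. if prime p then 1 - real (root_count f (p ^ k)) / real (p ^ k) else 1)"
proof (induction z)
  case 0
  show ?case by (rule exI[of _ 1]) (auto simp: trunc_kfree_def)
next
  case (Suc z)
  then obtain Q where Q: "Q > 0" "\<And>p. prime p \<Longrightarrow> p > z \<Longrightarrow> coprime Q p"
    "\<And>n. trunc_kfree k f z (n + Q) = trunc_kfree k f z n"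
    "(\<Sum>n<Q. trunc_kfree k f z n) / real Q = (\<Prod>p\<le>z. if prime p then 1 - real (root_count f (p ^ k)) / real (p ^ k) else 1)"
    by blast
  show ?case
  proof (cases "prime (Suc z)")
    case False
    have "trunc_kfree k f (Suc z) n = trunc_kfree k f z n" for n
      using False unfolding trunc_kfree_def by (metis le_Suc_eq le_SucI)
    thus ?thesis using Q False by (intro exI[of _ Q]) auto
  next
    case True
    define q where "q = Suc z ^ k"
    have q0: "q > 0" by (simp add: q_def)
    define \<psi> where "\<psi> n = (if int q dvd poly f (int n) then 0 else 1 :: real)" for n
    have eq: "trunc_kfree k f (Suc z) n = trunc_kfree k f z n * \<psi> n" for n
      using True unfolding trunc_kfree_def \<psi>_def q_def by (auto simp: le_Suc_eq)
    have per: "\<psi> (n + q) = \<psi> n" for n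
      unfolding \<psi>_def using poly_cong_int[of "int q" "int (n + q)" "int n" f] by simp
    have cop: "coprime Q q" using Q(2)[OF True] by (simp add: q_def)
    have s: "(\<Sum>n<q. \<psi> n) = real q - real (root_count f q)"
    proof -
      have "(\<Sum>n<q. \<psi> n) = (\<Sum>n<q. 1 - (if int q dvd poly f (int n) then 1 else 0))"
        by (intro sum.cong refl) (simp add: \<psi>_def)
      also have "\<dots> = real q - (\<Sum>n<q. if int q dvd poly f (int n) then 1 else 0)"
        by (simp add: sum_subtractf)
      also have "(\<Sum>n<q. if int q dvd poly f (int n) then 1 else 0) = (\<Sum>n\<in>{n\<in>{..<q}. int q dvd poly f (int n)}. 1::real)"
        by (rule sum.inter_filter[symmetric]) simp
      also have "\<dots> = real (card {n\<in>{..<q}. int q dvd poly f (int n)})" by simp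
      also have "card {n\<in>{..<q}. int q dvd poly f (int n)} = root_count f q"
        unfolding root_count_def
        by (rule bij_betw_same_card[of int], rule bij_betw_byWitness[where f' = nat]) auto
      finally show ?thesis .
    qed
    have "(\<Sum>n<Q*q. trunc_kfree k f (Suc z) n) / real (Q * q)
       = ((\<Sum>n<Q. trunc_kfree k f z n) / real Q) * ((\<Sum>n<q. \<psi> n) / real q)"
      unfolding eq using periodic_product_sum[OF Q(1) q0 cop, of "trunc_kfree k f z" \<psi>] Q(3) per by simp
    also have "(\<Sum>n<q. \<psi> n) / real q = 1 - real (root_count f q) / real q"
      using q0 by (simp add: s diff_divide_distrib)
    finally have mean: "(\<Sum>n<Q*q. trunc_kfree k f (Suc z) n) / real (Q * q)
       = (\<Prod>p\<le>Suc z. if prime p then 1 - real (root_count f (p ^ k)) / real (p ^ k) else 1)"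
      using True unfolding Q(4) by (simp add: q_def)
    have p1: "trunc_kfree k f z (n + j * Q) = trunc_kfree k f z n" for n j
    proof (induction j)
      case (Suc j)
      have "trunc_kfree k f z (n + Suc j * Q) = trunc_kfree k f z ((n + j * Q) + Q)" by (simp add: algebra_simps)
      thus ?case using Suc Q(3) by simp
    qed simp
    have p2: "\<psi> (n + j * q) = \<psi> n" for n j
    proof (induction j)
      case (Suc j)
      have "\<psi> (n + Suc j * q) = \<psi> ((n + j * q) + q)" by (simp add: algebra_simps)
      thus ?case using Suc per by simp
    qed simp
    have "trunc_kfree k f (Suc z) (n + Q * q) = trunc_kfree k f (Suc z) n" for n
      unfolding eq using p1[of n q] p2[of n Q] by (simp add: mult.commute)
    moreover have "coprime (Q * q) p" if "prime p" "p > Suc z" for p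
    proof -
      have "coprime (Suc z) p" using that True by (intro primes_coprime) auto
      thus ?thesis using Q(2)[of p] that by (simp add: q_def)
    qed
    moreover have "Q * q > 0" using Q(1) q0 by simp
    ultimately show ?thesis using mean by (intro exI[of _ "Q * q"]) blast
  qed
qed

section \<open>k-free values\<close>

lemma sum_inverse_squares_tail_le:
  assumes "z \<ge> 1"
  shows "(\<Sum>p\<in>{z<..M}. 1 / real p ^ 2) \<le> 1 / real z"
proof -
  have "(\<Sum>p\<in>{z<..M}. 1 / real p ^ 2) \<le> 1 / real z - 1 / real M" if "M \<ge> z" for M
    using that
  proof (induction M rule: dec_induct)
    case (step n)
    have "{z<..Suc n} = insert (Suc n) {z<..n}" using step by auto
    moreover have "1 / real (Suc n) ^ 2 \<le> 1 / real n - 1 / real (Suc n)"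
    proof -
      have "1 / real (Suc n) ^ 2 \<le> 1 / (real n * real (Suc n))"
        using step assms by (intro divide_left_mono) (auto simp: power2_eq_square)
      also have "\<dots> = 1 / real n - 1 / real (Suc n)" using step assms by (simp add: field_simps)
      finally show ?thesis .
    qed
    ultimately show ?case using step.IH by simp
  qed simp
  note le = this
  have M0: "1 / real M \<ge> 0" by simp
  show ?thesis
  proof (cases "M \<ge> z")
    case True
    thus ?thesis using le[OF True] M0 by linarith
  qed simp
qed

lemma kfree_indicator_eq_0_iff:
  "kfree_indicator k m = 0 \<longleftrightarrow> (\<exists>p::nat. prime p \<and> int (p ^ k) dvd m)"
proof
  assume "kfree_indicator k m = 0"
  then obtain p :: int where p: "prime p" "p ^ k dvd m" by (auto simp: kfree_indicator_def split: if_splits)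
  have "p = int (nat p)" using p(1) by (simp add: prime_ge_0_int)
  thus "\<exists>p::nat. prime p \<and> int (p ^ k) dvd m" using p by (intro exI[of _ "nat p"]) (metis of_nat_power prime_nat_int_transfer)
next
  assume "\<exists>p::nat. prime p \<and> int (p ^ k) dvd m"
  then obtain p :: nat where "prime p" "int p ^ k dvd m" by auto
  thus "kfree_indicator k m = 0" unfolding kfree_indicator_def by (metis prime_nat_int_transfer)
qed

text \<open>Choosing one prime per \<open>n\<close> leaves finitely many primes. These are
  squarefree, hence admissible \<open>d\<close>, and a nonnegative infinite sum dominates its finite
  partial sums.\<close>

lemma card_divisible_by_large_prime_power_le:
  "ennreal (real (card {n\<in>{1..N}. \<exists>p. prime p \<and> real p > Y \<and> int (p ^ k) dvd poly f (int n)})) \<le> divisor_excess k f Y N"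
proof -
  define B where "B = {n\<in>{1..N}. \<exists>p. prime p \<and> real p > Y \<and> int (p ^ k) dvd poly f (int n)}"
  have finB: "finite B" by (simp add: B_def)
  have "\<forall>n\<in>B. \<exists>p. prime p \<and> real p > Y \<and> int (p ^ k) dvd poly f (int n)" by (auto simp: B_def)
  then obtain P where P: "\<And>n. n \<in> B \<Longrightarrow> prime (P n) \<and> real (P n) > Y \<and> int (P n ^ k) dvd poly f (int n)" by metis
  let ?c = "\<lambda>d. card {n \<in> {1..N}. int d ^ k dvd poly f (int n)}"
  have "B \<subseteq> (\<Union>d\<in>P ` B. {n \<in> {1..N}. int d ^ k dvd poly f (int n)})"
  proof
    fix n assume n: "n \<in> B"
    hence "int (P n) ^ k dvd poly f (int n)" using P[OF n] by simp
    thus "n \<in> (\<Union>d\<in>P ` B. {n \<in> {1..N}. int d ^ k dvd poly f (int n)})" using n by (auto simp: B_def)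
  qed
  hence "card B \<le> card (\<Union>d\<in>P ` B. {n \<in> {1..N}. int d ^ k dvd poly f (int n)})"
    using finB by (intro card_mono) auto
  also have "\<dots> \<le> (\<Sum>d\<in>P ` B. ?c d)" using finB by (intro card_UN_le) auto
  finally have "ennreal (real (card B)) \<le> ennreal (real (\<Sum>d\<in>P ` B. ?c d))"
    by (intro ennreal_leI of_nat_mono)
  also have "\<dots> = (\<Sum>d\<in>P ` B. of_nat (?c d) :: ennreal)"
    by (simp add: ennreal_of_nat_eq_real_of_nat sum_ennreal)
  also have "\<dots> \<le> divisor_excess k f Y N"
    unfolding divisor_excess_def
    by (subst nonneg_infsum_complete, simp, rule SUP_upper)
       (use finB P in \<open>auto intro: squarefree_prime\<close>)
  finally show ?thesis unfolding B_def .
qed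

section \<open>Truncation error and conclusion\<close>

context
  fixes k :: nat and f :: "int poly" and \<delta> \<Delta> C :: real
  assumes k: "k \<ge> 2" and irr: "irreducible f" and deg: "degree f \<ge> 1"
    and pos: "\<delta> > 0" "\<Delta> > 0" "C > 0"
    and excess: "\<And>N::nat. N \<ge> 1 \<Longrightarrow>
           divisor_excess k f (real N powr (1 - \<delta>)) N \<le> ennreal (C * real N powr (1 - \<Delta>))"
begin

lemma root_count_eventually_le: "\<exists>z0\<ge>1. \<forall>p>z0. prime p \<longrightarrow> root_count f (p ^ k) \<le> degree f"
proof -
  obtain a b D where D: "D \<noteq> 0" "a * f + b * pderiv f = [:D:]"
    using irreducible_int_poly_discriminant[OF irr deg] by blast
  define z0 where "z0 = nat \<bar>D\<bar> + nat \<bar>lead_coeff f\<bar>"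
  have lc0: "lead_coeff f \<noteq> 0" using deg by auto
  have nd: "\<not> int p dvd x" if "x \<noteq> 0" "nat \<bar>x\<bar> \<le> z0" "p > z0" for p x
  proof
    assume "int p dvd x"
    hence "\<bar>int p\<bar> \<le> \<bar>x\<bar>" using that(1) by (intro dvd_imp_le_int)
    thus False using that(2,3) by simp
  qed
  have "root_count f (p ^ k) \<le> degree f" if "p > z0" "prime p" for p
  proof (rule root_count_prime_power_le[OF that(2) _ D(2)])
    show "1 \<le> k" using k by simp
    show "\<not> int p dvd D" by (rule nd[OF D(1) _ that(1)]) (simp add: z0_def)
    show "\<not> int p dvd lead_coeff f" by (rule nd[OF lc0 _ that(1)]) (simp add: z0_def)
  qed
  moreover have "z0 \<ge> 1" using D(1) by (simp add: z0_def)
  ultimately show ?thesis by blast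
qed

text \<open>The two indicators differ at \<open>n\<close> only if \<open>p ^ k\<close> divides
  \<open>f(n)\<close> for some prime \<open>p > z\<close>. For \<open>p \<le> Y\<close> the main
  terms sum to \<open>O(N / z)\<close> because \<open>k \<ge> 2\<close>, and the rounding term
  \<open>1\<close> per prime contributes at most \<open>Y\<close>; larger primes fall under
  \<open>excess\<close>.\<close>

lemma trunc_error:
  assumes z0: "z0 \<ge> 1" "\<And>p. p > z0 \<Longrightarrow> prime p \<Longrightarrow> root_count f (p ^ k) \<le> degree f"
    and z: "z \<ge> z0" and N: "N \<ge> 1"
  shows "(\<Sum>n=1..N. \<bar>trunc_kfree k f z n - real (kfree_indicator k (poly f (int n)))\<bar>)
     \<le> real (degree f) * (real N / real z + real N powr (1 - \<delta>)) + C * real N powr (1 - \<Delta>)"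
proof -
  define Y where "Y = real N powr (1 - \<delta>)"
  define S where "S = {p\<in>{z<..nat \<lfloor>Y\<rfloor>}. prime p}"
  define A where "A p = {n\<in>{1..N}. int (p ^ k) dvd poly f (int n)}" for p
  define B where "B = {n\<in>{1..N}. \<exists>p. prime p \<and> real p > Y \<and> int (p ^ k) dvd poly f (int n)}"
  have Y0: "Y \<ge> 0" by (simp add: Y_def)
  have fin: "finite S" "finite B" "finite (A p)" for p by (auto simp: S_def A_def B_def)
  let ?U = "(\<Union>p\<in>S. A p) \<union> B"
  have pt: "\<bar>trunc_kfree k f z n - real (kfree_indicator k (poly f (int n)))\<bar> \<le> indicator ?U n" if n: "n \<in> {1..N}" for n
  proof (cases "n \<in> ?U")
    case True
    thus ?thesis by (auto simp: trunc_kfree_def kfree_indicator_def)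
  next
    case False
    have "trunc_kfree k f z n = 0 \<longleftrightarrow> kfree_indicator k (poly f (int n)) = 0"
    proof
      assume "trunc_kfree k f z n = 0"
      thus "kfree_indicator k (poly f (int n)) = 0"
        unfolding kfree_indicator_eq_0_iff by (auto simp: trunc_kfree_def split: if_splits)
    next
      assume "kfree_indicator k (poly f (int n)) = 0"
      then obtain p where p: "prime p" "int (p ^ k) dvd poly f (int n)" unfolding kfree_indicator_eq_0_iff by blast
      have "p \<le> z"
      proof (rule ccontr)
        assume pz: "\<not> p \<le> z"
        show False
        proof (cases "real p > Y")
          case True
          hence "n \<in> B" using p n by (auto simp: B_def)
          thus False using False by blast
        next
          case le: False
          hence "p \<le> nat \<lfloor>Y\<rfloor>" by (simp add: le_nat_floor)
          hence "p \<in> S" "n \<in> A p" using p n pz by (auto simp: S_def A_def)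
          thus False using False by blast
        qed
      qed
      thus "trunc_kfree k f z n = 0" using p by (auto simp: trunc_kfree_def)
    qed
    hence "trunc_kfree k f z n = real (kfree_indicator k (poly f (int n)))"
      by (auto simp: trunc_kfree_def kfree_indicator_def split: if_splits)
    thus ?thesis by simp
  qed
  have sub: "?U \<subseteq> {1..N}" by (auto simp: A_def B_def)
  have "(\<Sum>n=1..N. \<bar>trunc_kfree k f z n - real (kfree_indicator k (poly f (int n)))\<bar>) \<le> (\<Sum>n=1..N. indicator ?U n)"
    by (intro sum_mono pt)
  also have "\<dots> = real (card ?U)"
  proof -
    have "(\<Sum>n=1..N. indicator ?U n :: real) = real (card ({1..N} \<inter> ?U))"
      unfolding indicator_def of_bool_def by (subst sum.If_cases) (auto intro!: arg_cong[of _ _ card])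
    also have "{1..N} \<inter> ?U = ?U" using sub by blast
    finally show ?thesis .
  qed
  also have "\<dots> \<le> real (card (\<Union>p\<in>S. A p)) + real (card B)"
    using card_Un_le[of "\<Union>p\<in>S. A p" B] by (metis of_nat_add of_nat_mono)
  also have "real (card (\<Union>p\<in>S. A p)) \<le> (\<Sum>p\<in>S. real (card (A p)))"
    using card_UN_le[of S A] fin by (metis of_nat_mono of_nat_sum)
  also have "(\<Sum>p\<in>S. real (card (A p))) \<le> (\<Sum>p\<in>S. real (degree f) * (real N * (1 / real p ^ 2) + 1))"
  proof (rule sum_mono)
    fix p assume "p \<in> S"
    hence p: "prime p" "p > z" by (auto simp: S_def)
    have p1: "real p \<ge> 1" using p by simp
    have "card (A p) \<le> root_count f (p ^ k) * (N div (p ^ k) + 1)"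
      unfolding A_def using p by (intro card_roots_upto_le) (simp add: prime_gt_0_nat)
    also have "\<dots> \<le> degree f * (N div (p ^ k) + 1)"
      using z0(2)[of p] p z by (intro mult_right_mono) auto
    finally have "real (card (A p)) \<le> real (degree f * (N div (p ^ k) + 1))" by (rule of_nat_mono)
    also have "\<dots> = real (degree f) * (real (N div (p ^ k)) + 1)" by (simp add: distrib_left)
    also have "real (N div (p ^ k)) \<le> real N / real (p ^ k)" by (rule nat_div_le_real_div)
    also have "\<dots> \<le> real N / real p ^ 2"
    proof -
      have "real p ^ 2 \<le> real p ^ k" using p1 k by (intro power_increasing) auto
      thus ?thesis using p1 by (simp add: divide_left_mono)
    qed
    finally show "real (card (A p)) \<le> real (degree f) * (real N * (1 / real p ^ 2) + 1)"
      by (simp add: mult_left_mono)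
  qed
  also have "\<dots> = real (degree f) * (real N * (\<Sum>p\<in>S. 1 / real p ^ 2) + real (card S))"
    by (simp only: sum_distrib_left[symmetric] sum.distrib) simp
  also have "\<dots> \<le> real (degree f) * (real N * (1 / real z) + Y)"
  proof (intro mult_left_mono add_mono)
    have "(\<Sum>p\<in>S. 1 / real p ^ 2) \<le> (\<Sum>p\<in>{z<..nat \<lfloor>Y\<rfloor>}. 1 / real p ^ 2)"
      by (intro sum_mono2) (auto simp: S_def)
    also have "\<dots> \<le> 1 / real z" using z z0(1) by (intro sum_inverse_squares_tail_le) simp
    finally show "(\<Sum>p\<in>S. 1 / real p ^ 2) \<le> 1 / real z" .
    have "card S \<le> card {1..nat \<lfloor>Y\<rfloor>}" by (intro card_mono) (auto simp: S_def)
    hence "real (card S) \<le> real (nat \<lfloor>Y\<rfloor>)" by simp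
    also have "\<dots> \<le> Y" using Y0 by (simp add: of_nat_floor)
    finally show "real (card S) \<le> Y" .
  qed auto
  also have "real (card B) \<le> C * real N powr (1 - \<Delta>)"
  proof -
    have "ennreal (real (card B)) \<le> divisor_excess k f Y N"
      unfolding B_def by (rule card_divisible_by_large_prime_power_le)
    also have "\<dots> \<le> ennreal (C * real N powr (1 - \<Delta>))" unfolding Y_def by (rule excess[OF N])
    finally show ?thesis using pos(3) by (simp add: ennreal_le_iff)
  qed
  finally show ?thesis by (simp add: Y_def)
qed

text \<open>The factors are \<open>1 - O(1 / p^2)\<close>, so the product converges absolutely.
  Single factors may be \<open>0\<close>; \<open>convergent_prod\<close> admits this, and the value
  is then \<open>0\<close>.\<close>

lemma local_densities_product:
  "(\<lambda>z. \<Prod>p\<le>z. if prime p then 1 - real (root_count f (p ^ k)) / real (p ^ k) else 1)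
     \<longlonglongrightarrow> (\<Prod>p. if prime p then 1 - real (root_count f (p ^ k)) / real (p ^ k) else 1)"
proof -
  define t where "t p = (if prime p then 1 - real (root_count f (p ^ k)) / real (p ^ k) else 1)" for p :: nat
  obtain z0 where z0: "z0 \<ge> 1" "\<And>p. p > z0 \<Longrightarrow> prime p \<Longrightarrow> root_count f (p ^ k) \<le> degree f"
    using root_count_eventually_le by blast
  have "summable (\<lambda>p. real (degree f) * (1 / real p ^ 2))"
    by (intro summable_mult) (use inverse_power_summable[of 2, where 'a=real] in \<open>simp add: divide_inverse\<close>)
  hence "summable (\<lambda>p. norm (t p - 1))"
  proof (rule summable_comparison_test_ev[rotated])
    show "eventually (\<lambda>p. norm (norm (t p - 1)) \<le> real (degree f) * (1 / real p ^ 2)) sequentially"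
      using eventually_gt_at_top[of z0]
    proof eventually_elim
      case (elim p)
      show ?case
      proof (cases "prime p")
        case True
        have p1: "real p \<ge> 1" using elim by simp
        have "real p ^ 2 \<le> real p ^ k" using p1 k by (intro power_increasing) auto
        hence "real (root_count f (p ^ k)) / real p ^ k \<le> real (degree f) / real p ^ 2"
          using z0(2)[OF elim True] p1 by (intro frac_le) auto
        thus ?thesis using True by (simp add: t_def)
      qed (simp add: t_def)
    qed
  qed
  hence "abs_convergent_prod t" by (simp add: abs_convergent_prod_conv_summable)
  hence "convergent_prod t" by (rule abs_convergent_prod_imp_convergent_prod)
  hence "(\<lambda>n. \<Prod>i\<le>n. t i) \<longlonglongrightarrow> prodinf t" by (rule convergent_prod_LIMSEQ)
  thus ?thesis unfolding t_def .
qed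

text \<open>The cut-off \<open>z\<close> is fixed before \<open>N\<close> grows: the part
  \<open>degree f / z\<close> of the truncation error is uniform in \<open>N\<close>, and all other
  errors vanish for fixed \<open>z\<close>.\<close>

lemma kfree_omega_equidistribution:
  fixes g :: "'a::metric_space \<Rightarrow> complex"
  assumes ue: "uniquely_ergodic_system X \<mu> T" and g: "continuous_on X g" and x: "x \<in> X"
  shows "(\<lambda>N. (\<Sum>n=1..N. of_nat (kfree_indicator k (poly f (int n))) * g ((T ^^ big_omega n) x)) / of_nat N)
     \<longlonglongrightarrow> of_real (\<Prod>p. if prime p then 1 - real (root_count f (p ^ k)) / real (p ^ k) else 1) * (LINT y|\<mu>. g y)"
proof (rule tendstoI)
  fix e :: real assume e: "e > 0"
  define P where "P z = (\<Prod>p\<le>z. if prime p then 1 - real (root_count f (p ^ k)) / real (p ^ k) else 1)" for z :: nat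
  define Pinf where "Pinf = (\<Prod>p. if prime p then 1 - real (root_count f (p ^ k)) / real (p ^ k) else 1)"
  define I where "I = (LINT y|\<mu>. g y)"
  have PI: "(\<lambda>z. of_real (P z) * I) \<longlonglongrightarrow> of_real Pinf * I"
    unfolding P_def Pinf_def by (intro tendsto_intros local_densities_product)
  have cpt: "compact X" and TX: "T ` X \<subseteq> X" using ue by (auto simp: uniquely_ergodic_system_def)
  have "bounded (g ` X)" using compact_continuous_image[OF g cpt] by (rule compact_imp_bounded)
  then obtain B where B: "B > 0" "\<And>y. y \<in> X \<Longrightarrow> norm (g y) \<le> B" unfolding bounded_pos by auto
  define u where "u n = g ((T ^^ big_omega n) x)" for n
  have "(T ^^ j) x \<in> X" for j using TX x by (induction j) auto
  hence u: "norm (u n) \<le> B" for n unfolding u_def by (intro B)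
  obtain z0 where z0: "z0 \<ge> 1" "\<And>p. p > z0 \<Longrightarrow> prime p \<Longrightarrow> root_count f (p ^ k) \<le> degree f"
    using root_count_eventually_le by blast
  have "(\<lambda>z::nat. B * (real (degree f) / real z)) \<longlonglongrightarrow> 0" by real_asymp
  hence "eventually (\<lambda>z::nat. B * (real (degree f) / real z) < e / 4) sequentially"
    using e by (intro order_tendstoD(2)) auto
  moreover have "eventually (\<lambda>z. dist (of_real (P z) * I) (of_real Pinf * I) < e / 4) sequentially"
    using e by (intro tendstoD[OF PI]) auto
  moreover have "eventually (\<lambda>z. z \<ge> z0) sequentially" by (rule eventually_ge_at_top)
  ultimately have "eventually (\<lambda>z. B * (real (degree f) / real z) < e / 4 \<and> dist (of_real (P z) * I) (of_real Pinf * I) < e / 4 \<and> z \<ge> z0) sequentially"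
    by eventually_elim auto
  then obtain z where z: "B * (real (degree f) / real z) < e / 4" "dist (of_real (P z) * I) (of_real Pinf * I) < e / 4" "z \<ge> z0"
    using eventually_happens' sequentially_bot by blast
  define av where "av w N = (\<Sum>n=1..N. of_real (w n) * u n) / complex_of_nat N" for w N
  define nu where "nu n = real (kfree_indicator k (poly f (int n)))" for n
  have k1: "k \<ge> 1" using k by simp
  obtain Q where Q: "Q > 0" "\<And>n. trunc_kfree k f z (n + Q) = trunc_kfree k f z n" "(\<Sum>n<Q. trunc_kfree k f z n) / real Q = P z"
    using trunc_kfree_mean[OF k1, of z f] unfolding P_def by blast
  have "av (trunc_kfree k f z) \<longlonglongrightarrow> of_real (P z) * I"
    unfolding Q(3)[symmetric] av_def u_def I_def
    by (rule periodic_omega_equidistribution[where \<phi> = "trunc_kfree k f z", OF ue Q(1,2) _ g x])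
       (simp add: trunc_kfree_def)
  hence "eventually (\<lambda>N. dist (av (trunc_kfree k f z) N) (of_real (P z) * I) < e / 4) sequentially"
    using e by (intro tendstoD) auto
  moreover have "eventually (\<lambda>N::nat. B * (real (degree f) * real N powr (-\<delta>) + C * real N powr (-\<Delta>)) < e / 4) sequentially"
  proof -
    have "(\<lambda>N::nat. B * (real (degree f) * real N powr (-\<delta>) + C * real N powr (-\<Delta>))) \<longlonglongrightarrow> B * (real (degree f) * 0 + C * 0)"
      using pos by (intro tendsto_intros filterlim_compose[OF tendsto_neg_powr filterlim_real_sequentially]) (auto intro: filterlim_ident)
    thus ?thesis using e by (intro order_tendstoD(2)) auto
  qed
  moreover have "eventually (\<lambda>N::nat. N \<ge> 1) sequentially" by (rule eventually_ge_at_top)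
  ultimately show "eventually (\<lambda>N. dist ((\<Sum>n=1..N. of_nat (kfree_indicator k (poly f (int n))) * g ((T ^^ big_omega n) x)) / of_nat N) (of_real Pinf * I) < e) sequentially"
  proof eventually_elim
    case (elim N)
    have N0: "real N > 0" using elim by simp
    have "dist (av nu N) (av (trunc_kfree k f z) N) \<le> B * (real (degree f) / real z) + B * (real (degree f) * real N powr (-\<delta>) + C * real N powr (-\<Delta>))"
    proof -
      have d: "dist (av nu N) (av (trunc_kfree k f z) N) = norm (av (trunc_kfree k f z) N - av nu N)"
        by (metis dist_commute dist_norm)
      have "av (trunc_kfree k f z) N - av nu N = (\<Sum>n=1..N. of_real (trunc_kfree k f z n - nu n) * u n) / of_nat N"
        unfolding av_def diff_divide_distrib[symmetric] sum_subtractf[symmetric] by (simp add: algebra_simps)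
      hence "dist (av nu N) (av (trunc_kfree k f z) N) = norm (\<Sum>n=1..N. of_real (trunc_kfree k f z n - nu n) * u n) / real N"
        unfolding d by (simp only: norm_divide norm_of_nat)
      also have "norm (\<Sum>n=1..N. of_real (trunc_kfree k f z n - nu n) * u n) \<le> (\<Sum>n=1..N. \<bar>trunc_kfree k f z n - nu n\<bar> * B)"
      proof (rule order.trans[OF norm_sum], intro sum_mono)
        fix n
        show "norm (of_real (trunc_kfree k f z n - nu n) * u n) \<le> \<bar>trunc_kfree k f z n - nu n\<bar> * B"
          unfolding norm_mult norm_of_real by (intro mult_left_mono u) auto
      qed
      also have "\<dots> = (\<Sum>n=1..N. \<bar>trunc_kfree k f z n - nu n\<bar>) * B" by (simp only: sum_distrib_right)
      also have "\<dots> \<le> (real (degree f) * (real N / real z + real N powr (1 - \<delta>)) + C * real N powr (1 - \<Delta>)) * B"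
        unfolding nu_def using B(1) elim by (intro mult_right_mono trunc_error[OF z0 z(3)]) auto
      finally have "dist (av nu N) (av (trunc_kfree k f z) N) \<le> (real (degree f) * (real N / real z + real N powr (1 - \<delta>)) + C * real N powr (1 - \<Delta>)) * B / real N"
        using N0 by (simp add: divide_right_mono)
      also have "\<dots> = B * (real (degree f) / real z) + B * (real (degree f) * real N powr (-\<delta>) + C * real N powr (-\<Delta>))"
      proof -
        have "real N powr (1 - s) = real N * real N powr (-s)" for s
          using N0 powr_add[of "real N" 1 "-s"] by simp
        thus ?thesis using N0 by (simp add: field_simps)
      qed
      finally show ?thesis .
    qed
    hence "dist (av nu N) (av (trunc_kfree k f z) N) < e / 4 + e / 4" using z(1) elim(2) by linarith
    moreover have "dist (av nu N) (of_real Pinf * I) \<le> dist (av nu N) (av (trunc_kfree k f z) N) + (dist (av (trunc_kfree k f z) N) (of_real (P z) * I) + dist (of_real (P z) * I) (of_real Pinf * I))"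
      by (meson add_left_mono dist_triangle order.trans)
    ultimately have "dist (av nu N) (of_real Pinf * I) < e" using elim(1) z(2) by linarith
    thus ?case by (simp add: av_def nu_def u_def)
  qed
qed

end

theorem theorem3p2:
  fixes k :: nat and f :: "int poly"
    and X :: "'a::metric_space set" and \<mu> :: "'a measure" and T :: "'a \<Rightarrow> 'a"
    and \<delta> \<Delta> C :: real
  assumes "k \<ge> 2"
    and "irreducible f" and "degree f \<ge> 1"
    and "uniquely_ergodic_system X \<mu> T"
    and "\<delta> > 0" and "\<Delta> > 0" and "C > 0"
    and "\<And>N::nat. N \<ge> 1 \<Longrightarrow>
           divisor_excess k f (real N powr (1 - \<delta>)) N \<le> ennreal (C * real N powr (1 - \<Delta>))"
  shows "\<forall>g :: 'a \<Rightarrow> complex. continuous_on X g \<longrightarrow> (\<forall>x\<in>X.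
           (\<lambda>N. (\<Sum>n=1..N. of_nat (kfree_indicator k (poly f (int n))) * g ((T ^^ big_omega n) x))
                  / of_nat N)
           \<longlonglongrightarrow> complex_of_real
                 (\<Prod>p. if prime p then 1 - real (root_count f (p ^ k)) / real (p ^ k) else 1)
               * (LINT y|\<mu>. g y))"
  using kfree_omega_equidistribution[OF assms(1-3,5-8) assms(4)] by blast

end
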